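(* Let $p\geq 3$ be a prime and $0<k<p$. For integers $i\geq 0$ put $c_i=ip+k$ if $i$ is even and $c_i=(i+1)p-k$ if $i$ is odd. Then the sequence of TQFT's over $\mathbb{F}_p$ $$\cdots\to\mathcal{V}^{(c_{i+1})}_p\to\mathcal{V}^{(c_i)}_p\to\cdots\to\mathcal{V}^{(2p+k)}_p\to\mathcal{V}^{(2p-k)}_p\to\mathcal{V}^{(k)}_p\to\overline{\mathcal{V}}^{(k)}_p\to 0,$$ whose maps $\mathcal{V}^{(c_{i+1})}_p\to\mathcal{V}^{(c_i)}_p$ are $E^{p-k}$ for $i$ even and $E^{k}$ for $i$ odd, and whose last map is the canonical quotient map, is exact (i.e. exact when evaluated on every closed connected oriented surface). Moreover, the TQFT's $\overline{\mathcal{V}}^{(k)}_p$ are irreducible (so they are irreducible TQFT's with resolutions $\cdots\to\mathcal{V}^{(c_{i+1})}_p\to\mathcal{V}^{(c_i)}_p\to\cdots\to\mathcal{V}^{(2p+k)}_p\to\mathcal{V}^{(2p-k)}_p\to\mathcal{V}^{(k)}_p\to\overline{\mathcal{V}}^{(k)}_p\to 0$).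
   Context: Let $\Sigma_g$ be the closed connected oriented surface of genus $g$, with a symplectic basis $a_1,\dots,a_g,b_1,\dots,b_g$ of $H_1(\Sigma_g,\mathbb{Z})$. Equip $\bigwedge^*H_1(\Sigma_g,\mathbb{Z})$ with the inner product $\langle\,,\rangle$ induced from the one on $H_1$ for which $\{a_i,b_i\}$ is orthonormal. Put $\omega=\sum_i a_i\wedge b_i$, $Ex=x\wedge\omega$, $F=E^*$ (the adjoint of $E$), and $Hx=(\deg(x)-g)x$; these generate an action of $\mathfrak{sl}(2,\mathbb{Z})$. Frohman-Nicas TQFT: $\mathcal{V}^{FN}_{\mathbb{Z}}(\Sigma)=H^*(J(\Sigma),\mathbb{Z})\cong\bigwedge^*H_1(\Sigma,\mathbb{Z})$, where $J(X)=\mathrm{Hom}(\pi_1(X),U(1))$. For a connected cobordism $M:\Sigma_-\to\Sigma_+$ between connected surfaces of genera $g_-,g_+$, let $r_\pm:J(M)\to J(\Sigma_\pm)$ be restriction; the map $\mathcal{V}^{FN}_{\mathbb{Z}}(M)$ is $\alpha\mapsto PD^{-1}\big((r_+)_*(r_-^*\alpha\cap[J(M)])\big)$ if $\beta_1(M)=g_-+g_+$, and $0$ if $\beta_1(M)>g_-+g_+$ ($PD$ is Poincaré duality in $J(\Sigma_+)$). It is well defined and functorial up to sign, and commutes with the $\mathfrak{sl}_2$-action. On mapping classes it is the standard action of $Sp(2g,\mathbb{Z})$ on $\bigwedge^*H_1(\Sigma_g)$. For $k\ge1$, $\mathcal{V}^{(k)}_{\mathbb{Z}}$ is the sub-TQFT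 with $\mathcal{V}^{(k)}_{\mathbb{Z}}(\Sigma_g)=\ker(F)\cap\bigwedge^{g-k+1}H_1(\Sigma_g,\mathbb{Z})$ (zero if $k>g+1$), and $\mathcal{V}^{(k)}_p=\mathcal{V}^{(k)}_{\mathbb{Z}}\otimes\mathbb{F}_p$, regarded as a subspace of $\bigwedge^*H_1(\Sigma_g,\mathbb{F}_p)$. If $j\equiv l\pmod p$ with $0<l<p$ and $j>l$, then $E^l$ induces a well-defined natural transformation $\mathcal{V}^{(j)}_p\to\mathcal{V}^{(j-2l)}_p$. The inner product restricted to $\mathcal{V}^{(k)}_{\mathbb{Z}}(\Sigma)$ and reduced modulo $p$ gives a (possibly degenerate) form $\langle\,,\rangle_p$ on $\mathcal{V}^{(k)}_p(\Sigma)$; $\overline{\mathcal{V}}^{(k)}_p$ denotes the quotient TQFT of $\mathcal{V}^{(k)}_p$ by the null spaces of $\langle\,,\rangle_p$. Irreducible here means that each $\overline{\mathcal{V}}^{(k)}_p(\Sigma_g)$ is zero or an irreducible $\mathbb{F}_p[Sp(2g,\mathbb{Z})]$-module. *)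

theory Defs
  imports
    "Jordan_Normal_Form.VS_Connect"
    "Berlekamp_Zassenhaus.Finite_Field"
begin

section \<open>The exterior algebra of the first homology of a surface\<close>

text \<open>
  The symplectic basis \<open>a\<^sub>1, \<dots>, a\<^sub>g, b\<^sub>1, \<dots>, b\<^sub>g\<close> of the first homology of the surface of genus \<open>g\<close>
  is indexed by \<open>0, \<dots>, 2g - 1\<close> in this order. An element of the exterior algebra with
  coefficients in \<open>'a\<close> is given by its coordinates with respect to the monomials
  \<open>e\<^sub>S = e\<^bsub>s\<^sub>1\<^esub> \<and> \<dots> \<and> e\<^bsub>s\<^sub>m\<^esub>\<close>, where \<open>S = {s\<^sub>1 < \<dots> < s\<^sub>m}\<close> is a subset of \<open>{0, \<dots>, 2g - 1}\<close>.
\<close>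

type_synonym 'a ext = "nat set \<Rightarrow> 'a"

definition ext_space :: "nat \<Rightarrow> 'a::comm_ring_1 ext set" where
  "ext_space g = {x. \<forall>S. \<not> S \<subseteq> {..<2 * g} \<longrightarrow> x S = 0}"

definition ext_deg :: "nat \<Rightarrow> nat \<Rightarrow> 'a::comm_ring_1 ext set" where
  "ext_deg g d = {x \<in> ext_space g. \<forall>S. x S \<noteq> 0 \<longrightarrow> card S = d}"

definition ext_basis :: "nat set \<Rightarrow> 'a::comm_ring_1 ext" where
  "ext_basis S = (\<lambda>T. if T = S then 1 else 0)"

text \<open>
  For disjoint \<open>T\<close> and \<open>U\<close>, sorting the product of \<open>e\<^sub>T\<close> and \<open>e\<^sub>U\<close> takes one transposition
  for every pair \<open>(t, u)\<close> with \<open>u < t\<close>.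
\<close>

definition shuffle_sign :: "nat set \<Rightarrow> nat set \<Rightarrow> 'a::comm_ring_1" where
  "shuffle_sign T U = (- 1) ^ card {(t, u). t \<in> T \<and> u \<in> U \<and> u < t}"

definition wedge :: "'a::comm_ring_1 ext \<Rightarrow> 'a ext \<Rightarrow> 'a ext" where
  "wedge x y = (\<lambda>S. \<Sum>T\<in>Pow S. shuffle_sign T (S - T) * x T * y (S - T))"

lemma wedge_ext_basis:
  assumes "finite S" "finite T"
  shows "wedge (ext_basis S) (ext_basis T) =
    (if S \<inter> T = {} then \<lambda>U. shuffle_sign S T * ext_basis (S \<union> T) U else (\<lambda>_. 0))"
proof
  fix U :: "nat set"
  show "wedge (ext_basis S) (ext_basis T) U =
    (if S \<inter> T = {} then \<lambda>U. shuffle_sign S T * ext_basis (S \<union> T) U else (\<lambda>_. 0)) U"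
  proof (cases "finite U")
    case False
    then show ?thesis
      using assms by (auto simp: wedge_def ext_basis_def)
  next
    case True
    have "wedge (ext_basis S) (ext_basis T) U =
        (\<Sum>V\<in>Pow U. if V = S then (if U - S = T then shuffle_sign S T else 0) else 0)"
      unfolding wedge_def by (rule sum.cong) (auto simp: ext_basis_def)
    also have "\<dots> = (if S \<subseteq> U \<and> U - S = T then shuffle_sign S T else 0)"
      using True by (auto simp: sum.delta)
    also have "\<dots> = (if S \<inter> T = {} then \<lambda>U. shuffle_sign S T * ext_basis (S \<union> T) U
        else (\<lambda>_. 0)) U"
    proof -
      have "S \<subseteq> U \<and> U - S = T \<longleftrightarrow> S \<inter> T = {} \<and> U = S \<union> T"
        by blast
      then show ?thesis
        by (auto simp: ext_basis_def)
    qed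
    finally show ?thesis .
  qed
qed

text \<open>
  The inner product induced from the one on homology for which the \<open>e\<^sub>i\<close> are orthonormal; the
  \<open>e\<^sub>S\<close> are then orthonormal as well.
\<close>

definition ext_inner :: "nat \<Rightarrow> 'a::comm_ring_1 ext \<Rightarrow> 'a ext \<Rightarrow> 'a" where
  "ext_inner g x y = (\<Sum>S\<in>Pow {..<2 * g}. x S * y S)"

definition omega :: "nat \<Rightarrow> 'a::comm_ring_1 ext" where
  "omega g = (\<lambda>S. \<Sum>i<g. wedge (ext_basis {i}) (ext_basis {g + i}) S)"

definition E_op :: "nat \<Rightarrow> 'a::comm_ring_1 ext \<Rightarrow> 'a ext" where
  "E_op g x = wedge x (omega g)"

text \<open>The adjoint of \<^const>\<open>E_op\<close>, written in the orthonormal basis \<open>e\<^sub>S\<close>.\<close>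

definition F_op :: "nat \<Rightarrow> 'a::comm_ring_1 ext \<Rightarrow> 'a ext" where
  "F_op g x = (\<lambda>S. if S \<subseteq> {..<2 * g} then ext_inner g x (E_op g (ext_basis S)) else 0)"

lemma F_op_adjoint:
  assumes y: "y \<in> ext_space g"
  shows "ext_inner g (F_op g x) y = ext_inner g x (E_op g y)"
proof -
  let ?P = "Pow {..<2 * g}"
  have E: "E_op g y T = (\<Sum>S\<in>?P. E_op g (ext_basis S) T * y S)" if T: "T \<in> ?P" for T
  proof -
    have fin: "finite T"
      using T finite_subset by auto
    have "(\<Sum>S\<in>?P. E_op g (ext_basis S) T * y S) =
        (\<Sum>S\<in>?P. \<Sum>U\<in>Pow T. if S = U
            then shuffle_sign U (T - U) * y U * omega g (T - U) else 0)"
      unfolding E_op_def wedge_def sum_distrib_right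
      by (intro sum.cong refl) (auto simp: ext_basis_def)
    also have "\<dots> = (\<Sum>U\<in>Pow T. \<Sum>S\<in>?P. if S = U
            then shuffle_sign U (T - U) * y U * omega g (T - U) else 0)"
      by (rule sum.swap)
    also have "\<dots> = (\<Sum>U\<in>Pow T. shuffle_sign U (T - U) * y U * omega g (T - U))"
      using T by (intro sum.cong refl) auto
    finally show ?thesis
      by (simp add: E_op_def wedge_def)
  qed
  have "ext_inner g x (E_op g y) = (\<Sum>T\<in>?P. \<Sum>S\<in>?P. x T * (E_op g (ext_basis S) T * y S))"
    unfolding ext_inner_def by (intro sum.cong refl) (simp add: E sum_distrib_left)
  also have "\<dots> = (\<Sum>S\<in>?P. \<Sum>T\<in>?P. x T * (E_op g (ext_basis S) T * y S))"
    by (rule sum.swap)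
  also have "\<dots> = ext_inner g (F_op g x) y"
    unfolding ext_inner_def F_op_def
    by (intro sum.cong refl) (simp add: sum_distrib_right mult.assoc)
  finally show ?thesis ..
qed


section \<open>The action of the integral symplectic group\<close>

definition symp_form :: "nat \<Rightarrow> int mat" where
  "symp_form g = four_block_mat (0\<^sub>m g g) (1\<^sub>m g) (- 1\<^sub>m g) (0\<^sub>m g g)"

definition Sp :: "nat \<Rightarrow> int mat monoid" where
  "Sp g = \<lparr>carrier = {A \<in> carrier_mat (2 * g) (2 * g).
                       transpose_mat A * symp_form g * A = symp_form g},
           monoid.mult = (*), one = 1\<^sub>m (2 * g)\<rparr>"

definition homology_image :: "nat \<Rightarrow> int mat \<Rightarrow> nat \<Rightarrow> 'a::comm_ring_1 ext" where
  "homology_image g A j = (\<lambda>T. \<Sum>i<2 * g. of_int (A $$ (i, j)) * ext_basis {i} T)"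

text \<open>The induced map sends \<open>e\<^bsub>s\<^sub>1\<^esub> \<and> \<dots> \<and> e\<^bsub>s\<^sub>m\<^esub>\<close> to \<open>A e\<^bsub>s\<^sub>1\<^esub> \<and> \<dots> \<and> A e\<^bsub>s\<^sub>m\<^esub>\<close>.\<close>

definition ext_act :: "nat \<Rightarrow> int mat \<Rightarrow> 'a::comm_ring_1 ext \<Rightarrow> 'a ext" where
  "ext_act g A x = (\<lambda>T. \<Sum>S\<in>Pow {..<2 * g}.
     x S * foldr wedge (map (homology_image g A) (sorted_list_of_set S)) (ext_basis {}) T)"


section \<open>Modules with a group action\<close>

definition group_module ::
    "'g monoid \<Rightarrow> 'r ring \<Rightarrow> ('r, 'm) module \<Rightarrow> ('g \<Rightarrow> 'm \<Rightarrow> 'm) \<Rightarrow> bool" where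
  "group_module G R M \<phi> \<longleftrightarrow> group G \<and> Module.module R M
     \<and> (\<forall>a\<in>carrier G. \<phi> a \<in> LinearCombinations.module_hom R M M)
     \<and> (\<forall>x\<in>carrier M. \<phi> \<one>\<^bsub>G\<^esub> x = x)
     \<and> (\<forall>a\<in>carrier G. \<forall>b\<in>carrier G. \<forall>x\<in>carrier M. \<phi> (a \<otimes>\<^bsub>G\<^esub> b) x = \<phi> a (\<phi> b x))"

definition irreducible_group_module ::
    "'g monoid \<Rightarrow> 'r ring \<Rightarrow> ('r, 'm) module \<Rightarrow> ('g \<Rightarrow> 'm \<Rightarrow> 'm) \<Rightarrow> bool" where
  "irreducible_group_module G R M \<phi> \<longleftrightarrow> group_module G R M \<phi>
     \<and> carrier M \<noteq> {\<zero>\<^bsub>M\<^esub>}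
     \<and> (\<forall>W. Module.submodule W R M \<and> (\<forall>a\<in>carrier G. \<phi> a ` W \<subseteq> W)
            \<longrightarrow> W = {\<zero>\<^bsub>M\<^esub>} \<or> W = carrier M)"

definition group_module_hom ::
    "'g monoid \<Rightarrow> 'r ring \<Rightarrow> ('r, 'm) module \<Rightarrow> ('g \<Rightarrow> 'm \<Rightarrow> 'm)
      \<Rightarrow> ('r, 'n) module \<Rightarrow> ('g \<Rightarrow> 'n \<Rightarrow> 'n) \<Rightarrow> ('m \<Rightarrow> 'n) \<Rightarrow> bool" where
  "group_module_hom G R M \<phi> N \<psi> f \<longleftrightarrow> group_module G R M \<phi> \<and> group_module G R N \<psi>
     \<and> mod_hom R M N f \<and> (\<forall>a\<in>carrier G. \<forall>x\<in>carrier M. f (\<phi> a x) = \<psi> a (f x))"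

text \<open>The quotient module follows the pattern of \<open>FactRing\<close> in HOL-Algebra.\<close>

definition induced_on_cosets ::
    "('r, 'm) module \<Rightarrow> 'm set \<Rightarrow> ('m \<Rightarrow> 'm) \<Rightarrow> 'm set \<Rightarrow> 'm set" where
  "induced_on_cosets M N f C = (\<Union>x\<in>C. N +>\<^bsub>M\<^esub> f x)"

definition quotient_module :: "('r, 'm) module \<Rightarrow> 'm set \<Rightarrow> ('r, 'm set) module" where
  "quotient_module M N =
     \<lparr>carrier = a_rcosets\<^bsub>M\<^esub> N, monoid.mult = undefined, one = undefined, zero = N, add = set_add M,
      Module.module.smult = (\<lambda>c. induced_on_cosets M N (\<lambda>x. c \<odot>\<^bsub>M\<^esub> x))\<rparr>"


section \<open>The TQFTs evaluated on the surface of genus \<open>g\<close>\<close>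

definition V_int :: "nat \<Rightarrow> nat \<Rightarrow> int ext set" where
  "V_int k g = (if k \<le> g + 1 then {x \<in> ext_deg g (g + 1 - k). F_op g x = (\<lambda>_. 0)}
                else {\<lambda>_. 0})"

definition reduce :: "int ext \<Rightarrow> 'a::comm_ring_1 ext" where
  "reduce x = (\<lambda>S. of_int (x S))"

text \<open>
  \<^const>\<open>V_int\<close> is the kernel of an integral map, hence a direct summand of the exterior algebra
  over the integers. So its tensor product with the prime field embeds into the exterior algebra
  over that field, with image the set of reductions. This can be strictly smaller than the kernel
  of \<^const>\<open>F_op\<close> over the field.
\<close>

definition V_mod :: "'p::prime_card itself \<Rightarrow> nat \<Rightarrow> nat \<Rightarrow> ('p mod_ring, 'p mod_ring ext) module"
  where
  "V_mod _ k g = \<lparr>carrier = reduce ` V_int k g, monoid.mult = undefined, one = undefined,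
     zero = (\<lambda>_. 0), add = (\<lambda>x y S. x S + y S), Module.module.smult = (\<lambda>c x S. c * x S)\<rparr>"

text \<open>
  The inner product of integral lifts, reduced modulo \<open>p\<close>, is the inner product of the reductions.
\<close>

lemma ext_inner_reduce:
  "ext_inner g (reduce x) (reduce y) = of_int (ext_inner g x y)"
  by (simp add: ext_inner_def reduce_def)

definition V_null :: "'p::prime_card itself \<Rightarrow> nat \<Rightarrow> nat \<Rightarrow> 'p mod_ring ext set" where
  "V_null P k g = {x \<in> carrier (V_mod P k g). \<forall>y\<in>carrier (V_mod P k g). ext_inner g x y = 0}"

definition Vbar_mod ::
    "'p::prime_card itself \<Rightarrow> nat \<Rightarrow> nat \<Rightarrow> ('p mod_ring, 'p mod_ring ext set) module" where
  "Vbar_mod P k g = quotient_module (V_mod P k g) (V_null P k g)"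

definition Vbar_proj ::
    "'p::prime_card itself \<Rightarrow> nat \<Rightarrow> nat \<Rightarrow> 'p mod_ring ext \<Rightarrow> 'p mod_ring ext set" where
  "Vbar_proj P k g x = V_null P k g +>\<^bsub>V_mod P k g\<^esub> x"

definition Vbar_act ::
    "'p::prime_card itself \<Rightarrow> nat \<Rightarrow> nat \<Rightarrow> int mat \<Rightarrow> 'p mod_ring ext set \<Rightarrow> 'p mod_ring ext set"
  where
  "Vbar_act P k g A = induced_on_cosets (V_mod P k g) (V_null P k g) (ext_act g A)"


section \<open>The indices and the maps of the resolution\<close>

definition res_index :: "nat \<Rightarrow> nat \<Rightarrow> nat \<Rightarrow> nat" where
  "res_index p k i = (if even i then i * p + k else (i + 1) * p - k)"

definition res_map :: "nat \<Rightarrow> nat \<Rightarrow> nat \<Rightarrow> nat \<Rightarrow> 'a::comm_ring_1 ext \<Rightarrow> 'a ext" where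
  "res_map p k i g = (E_op g ^^ (if even i then p - k else k))"

end

theory Submission
  imports Defs "HOL-Library.Function_Algebras"
begin

text \<open>
  Splitting off one handle writes an element of the exterior algebra of genus \<open>n + 1\<close> as
  \<open>1 \<otimes> u + a \<otimes> x + b \<otimes> y + (a \<and> b) \<otimes> w\<close> with \<open>u, x, y, w\<close> of genus \<open>n\<close>. If \<open>j\<close> is invertible
  modulo \<open>p\<close>, then
  \<open>V\<^sub>j(n + 1) = a \<otimes> V\<^sub>j(n) \<oplus> b \<otimes> V\<^sub>j(n) \<oplus> 1 \<otimes> V\<^bsub>j-1\<^esub>(n) \<oplus> s(V\<^bsub>j+1\<^esub>(n))\<close> with
  \<open>s(w) = (a \<and> b) \<otimes> w - 1 \<otimes> E w / j\<close>. For \<open>j \<equiv> l\<close> modulo \<open>p\<close> the map \<open>E\<^sup>l\<close> sends \<open>1 \<otimes> z\<close> to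
  \<open>l s(E\<^bsup>l-1\<^esup> z)\<close> and \<open>s(w)\<close> to \<open>- 1 \<otimes> E\<^bsup>l+1\<^esup> w / l\<close>. So the complex for \<open>k\<close> in genus \<open>n + 1\<close> is the
  direct sum of two copies of the complex for \<open>k\<close> and of the complexes for \<open>k - 1\<close> and \<open>k + 1\<close> in
  genus \<open>n\<close>, and exactness follows by induction on the genus, because for \<open>k = 0\<close> and \<open>k = p\<close> the
  maps are alternately zero and the identity. The same splitting is orthogonal and determines the
  null space of the form.

  Irreducibility is the highest weight argument: transvections minus the identity are root vectors
  of the symplectic Lie algebra. Over the integers they generate \<open>V\<^sub>j\<close> from
  \<open>a\<^sub>1 \<and> \<dots> \<and> a\<^sub>m\<close>, and every submodule that is not contained in the null space contains a vector
  not orthogonal to it, from which products of root vectors cut out a multiple of it.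
\<close>


section \<open>Linear operators on coordinate functions\<close>

text \<open>Because the complex for \<open>k\<close> involves those for \<open>k - 1\<close> and
  \<open>k + 1\<close>, the genus induction has to cover all residues from 0 to p. The splitting
  divides by the residue, so it fails exactly at the two ends, where the claims are immediate: the
  powers of \<open>E\<close> in question are the identity and \<open>E^p\<close>, which is 0 modulo
  p. The obstacle is that the modules are reductions of integral kernels and not kernels of
  \<open>F\<close> modulo p. Membership is therefore always shown through an integral lift, with
  denominators cleared before the reduction and divided out after it. That \<open>V_0\<close>
  vanishes is likewise an integral fact, due to positivity. The null space comes from the embedding
  s: it multiplies the form on \<open>V_(j+1)\<close> by \<open>(j + 1) / j\<close>, which vanishes
  for the first time at \<open>j = p - 1\<close>. No denominators arise there, because a
  transvection minus the identity is exactly one exterior multiplication composed with one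
  contraction.\<close>

definition scal :: "'a::comm_ring_1 \<Rightarrow> ('i \<Rightarrow> 'a) \<Rightarrow> 'i \<Rightarrow> 'a" where
  "scal c x = (\<lambda>i. c * x i)"

definition linop :: "(('i \<Rightarrow> 'a::comm_ring_1) \<Rightarrow> 'j \<Rightarrow> 'a) \<Rightarrow> bool" where
  "linop T \<longleftrightarrow> (\<forall>x y. T (x + y) = T x + T y) \<and> (\<forall>c x. T (scal c x) = scal c (T x))"

lemma scal_apply [simp]: "scal c x i = c * x i"
  by (simp add: scal_def)

lemma scal_simps [simp]:
  "scal 0 x = 0" "scal c 0 = 0" "scal 1 x = x" "scal c (scal d x) = scal (c * d) x"
  by (auto simp: fun_eq_iff algebra_simps)

lemma scal_minus_left: "scal (- c) x = - scal c x"
  by (auto simp: fun_eq_iff)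

lemma scal_add: "scal c (x + y) = scal c x + scal c y"
  and scal_diff: "scal c (x - y) = scal c x - scal c y"
  and scal_uminus: "scal c (- x) = - scal c x"
  by (auto simp: fun_eq_iff algebra_simps)

lemma linopI:
  assumes "\<And>x y i. T (x + y) i = T x i + T y i" "\<And>c x i. T (scal c x) i = c * T x i"
  shows "linop T"
  using assms by (auto simp: linop_def fun_eq_iff)

lemma linop_add: "linop T \<Longrightarrow> T (x + y) = T x + T y"
  and linop_scal: "linop T \<Longrightarrow> T (scal c x) = scal c (T x)"
  by (auto simp: linop_def)

lemma linop_zero: "linop T \<Longrightarrow> T 0 = 0"
  by (metis linop_add add_cancel_right_right)

lemma linop_uminus: "linop T \<Longrightarrow> T (- x) = - T x"
  using linop_scal[of T "- 1" x] by (simp add: scal_minus_left)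

lemma linop_diff:
  assumes "linop T"
  shows "T (x - y) = T x - T y"
  using linop_add[OF assms, of x "- y"] linop_uminus[OF assms, of y] by simp

lemma linop_sum: "linop T \<Longrightarrow> T (\<Sum>i\<in>I. f i) = (\<Sum>i\<in>I. T (f i))"
  by (induction I rule: infinite_finite_induct) (auto simp: linop_zero linop_add)

lemmas linop_simps = linop_add linop_scal linop_zero linop_uminus linop_diff linop_sum

lemma linop_id: "linop (\<lambda>x. x)"
  by (simp add: linop_def)

lemma linop_comp: "linop S \<Longrightarrow> linop T \<Longrightarrow> linop (\<lambda>x. S (T x))"
  by (simp add: linop_def)

lemma linop_plus: "linop S \<Longrightarrow> linop T \<Longrightarrow> linop (\<lambda>x. S x + T x)"
  by (simp add: linop_def fun_eq_iff algebra_simps)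

lemma linop_funpow:
  fixes T :: "('i \<Rightarrow> 'a::comm_ring_1) \<Rightarrow> 'i \<Rightarrow> 'a"
  shows "linop T \<Longrightarrow> linop (T ^^ n)"
proof (induction n)
  case 0
  then show ?case by (simp add: linop_def)
next
  case (Suc n)
  then show ?case by (simp add: linop_def)
qed

lemma sum_fun_apply: "(\<Sum>i\<in>I. f i) x = (\<Sum>i\<in>I. f i x)"
  by (induction I rule: infinite_finite_induct) auto

definition red :: "('i \<Rightarrow> int) \<Rightarrow> 'i \<Rightarrow> 'a::comm_ring_1" where
  "red x = (\<lambda>i. of_int (x i))"

lemma red_apply [simp]: "red x i = of_int (x i)"
  by (simp add: red_def)

lemma red_simps:
  "red (x + y) = red x + red y" "red (x - y) = red x - red y" "red (- x) = - red x" "red 0 = 0"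
  "red (scal c x) = scal (of_int c) (red x)"
  by (auto simp: fun_eq_iff)


section \<open>The handle model of the exterior algebra\<close>

text \<open>
  The exterior algebra of the homology of a surface of genus \<open>n\<close> is the \<open>n\<close>-fold graded tensor
  power of the exterior algebra on \<open>a, b\<close> with basis \<open>1, a, b, a \<and> b\<close>. An element is given by its
  coordinates with respect to the tensor products of basis elements, which are words of
  length \<open>n\<close>; the head of a word belongs to the handle with index \<open>n - 1\<close>.
\<close>

datatype handle = H0 | Ha | Hb | Hab

type_synonym 'a hfun = "handle list \<Rightarrow> 'a"

fun hwt :: "handle \<Rightarrow> nat" where
  "hwt H0 = 0" | "hwt Ha = 1" | "hwt Hb = 1" | "hwt Hab = 2"

definition hdeg :: "handle list \<Rightarrow> nat" where
  "hdeg L = sum_list (map hwt L)"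

lemma hdeg_simps [simp]: "hdeg [] = 0" "hdeg (c # L) = hwt c + hdeg L"
  by (simp_all add: hdeg_def)

definition slice :: "handle \<Rightarrow> 'a hfun \<Rightarrow> 'a hfun" where
  "slice c x = (\<lambda>L. x (c # L))"

definition mk :: "'a::comm_ring_1 hfun \<Rightarrow> 'a hfun \<Rightarrow> 'a hfun \<Rightarrow> 'a hfun \<Rightarrow> 'a hfun" where
  "mk u a b w L = (case L of [] \<Rightarrow> 0 | c # L' \<Rightarrow>
     (case c of H0 \<Rightarrow> u L' | Ha \<Rightarrow> a L' | Hb \<Rightarrow> b L' | Hab \<Rightarrow> w L'))"

lemma slice_apply [simp]: "slice c x L = x (c # L)"
  by (simp add: slice_def)

lemma linop_slice: "linop (slice c)"
  by (rule linopI) auto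

lemma mk_apply [simp]:
  "mk u a b w [] = 0" "mk u a b w (H0 # L) = u L" "mk u a b w (Ha # L) = a L"
  "mk u a b w (Hb # L) = b L" "mk u a b w (Hab # L) = w L"
  by (simp_all add: mk_def)

lemma slice_mk [simp]:
  "slice H0 (mk u a b w) = u" "slice Ha (mk u a b w) = a"
  "slice Hb (mk u a b w) = b" "slice Hab (mk u a b w) = w"
  by (auto simp: fun_eq_iff)

lemma mk_inject [simp]:
  "mk u a b w = mk u' a' b' w' \<longleftrightarrow> u = u' \<and> a = a' \<and> b = b' \<and> w = w'"
  by (metis slice_mk)

lemma mk_eqI:
  assumes "x [] = 0" "slice H0 x = u" "slice Ha x = a" "slice Hb x = b" "slice Hab x = w"
  shows "x = mk u a b w"
proof
  fix L
  show "x L = mk u a b w L"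
    using assms by (cases L; cases "hd L") (auto simp: fun_eq_iff)
qed

lemma mk_slices: "x [] = 0 \<Longrightarrow> mk (slice H0 x) (slice Ha x) (slice Hb x) (slice Hab x) = x"
  by (rule mk_eqI[symmetric]) auto

lemma mk_simps:
  "mk u a b w + mk u' a' b' w' = mk (u + u') (a + a') (b + b') (w + w')"
  "mk u a b w - mk u' a' b' w' = mk (u - u') (a - a') (b - b') (w - w')"
  "scal c (mk u a b w) = mk (scal c u) (scal c a) (scal c b) (scal c w)"
  "mk 0 0 0 0 = 0"
  "red (mk ui ai bi wi) = mk (red ui) (red ai) (red bi) (red wi)"
  by (rule mk_eqI mk_eqI[symmetric]; auto simp: fun_eq_iff)+

lemma mk_eq_0 [simp]: "mk u a b w = 0 \<longleftrightarrow> u = 0 \<and> a = 0 \<and> b = 0 \<and> w = 0"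
  by (metis mk_simps(4) mk_inject)

text \<open>Multiplication by the even element a \<and> b of one handle passes all other factors
  without a sign, so a coordinate of \<open>E x\<close> is a sum over the occurrences of
  \<open>Hab\<close> in the word, each replaced by \<open>H0\<close>. The recursion runs over the
  word because a function on words carries no genus of its own; the genus is the length of the
  word.\<close>

primrec hE_at :: "handle list \<Rightarrow> 'a::comm_ring_1 hfun \<Rightarrow> 'a" where
  "hE_at [] x = 0"
| "hE_at (c # L) x = hE_at L (slice c x) + (if c = Hab then x (H0 # L) else 0)"

primrec hF_at :: "handle list \<Rightarrow> 'a::comm_ring_1 hfun \<Rightarrow> 'a" where
  "hF_at [] x = 0"
| "hF_at (c # L) x = hF_at L (slice c x) + (if c = H0 then x (Hab # L) else 0)"

definition hE :: "'a::comm_ring_1 hfun \<Rightarrow> 'a hfun" where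
  "hE x = (\<lambda>L. hE_at L x)"

definition hF :: "'a::comm_ring_1 hfun \<Rightarrow> 'a hfun" where
  "hF x = (\<lambda>L. hF_at L x)"

lemma hE_simps [simp]:
  "hE x [] = 0" "hE x (c # L) = hE (slice c x) L + (if c = Hab then x (H0 # L) else 0)"
  and hF_simps [simp]:
  "hF x [] = 0" "hF x (c # L) = hF (slice c x) L + (if c = H0 then x (Hab # L) else 0)"
  by (simp_all add: hE_def hF_def)

lemma linop_hE: "linop (hE :: 'a::comm_ring_1 hfun \<Rightarrow> _)"
proof (rule linopI)
  show "hE (x + y) L = hE x L + hE y L" for x y :: "'a hfun" and L
    by (induction L arbitrary: x y) (auto simp: linop_simps[OF linop_slice])
  show "hE (scal c x) L = c * hE x L" for c and x :: "'a hfun" and L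
    by (induction L arbitrary: x) (auto simp: linop_simps[OF linop_slice] algebra_simps)
qed

lemma linop_hF: "linop (hF :: 'a::comm_ring_1 hfun \<Rightarrow> _)"
proof (rule linopI)
  show "hF (x + y) L = hF x L + hF y L" for x y :: "'a hfun" and L
    by (induction L arbitrary: x y) (auto simp: linop_simps[OF linop_slice])
  show "hF (scal c x) L = c * hF x L" for c and x :: "'a hfun" and L
    by (induction L arbitrary: x) (auto simp: linop_simps[OF linop_slice] algebra_simps)
qed

lemmas lin_hE = linop_simps[OF linop_hE]
lemmas lin_hF = linop_simps[OF linop_hF]
lemmas lin_hEn = linop_simps[OF linop_funpow[OF linop_hE]]

lemma hE_mk: "hE (mk u a b w) = mk (hE u) (hE a) (hE b) (hE w + u)"
  by (rule mk_eqI) (auto simp: fun_eq_iff)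

lemma hF_mk: "hF (mk u a b w) = mk (hF u + w) (hF a) (hF b) (hF w)"
  by (rule mk_eqI) (auto simp: fun_eq_iff)

text \<open>\<open>E\<close> is the sum of \<open>E\<close> on the remaining handles and the
  insertion of a \<and> b in the first one. The two commute and the insertion squares to zero, so
  the binomial expansion stops after the linear term. At \<open>l = 0\<close> the truncated exponent
  \<open>l - 1\<close> is harmless because its coefficient is 0.\<close>

lemma hEn_mk:
  fixes u :: "'a::comm_ring_1 hfun"
  shows
  "(hE ^^ l) (mk u a b w) = mk ((hE ^^ l) u) ((hE ^^ l) a) ((hE ^^ l) b)
     ((hE ^^ l) w + scal (of_nat l) ((hE ^^ (l - 1)) u))"
proof (induction l)
  case (Suc l)
  have *: "hE (scal (of_nat l) ((hE ^^ (l - 1)) u)) = scal (of_nat l) ((hE ^^ l) u)"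
    by (cases l) (simp_all add: lin_hE)
  have "scal (of_nat l) y + y = scal (of_nat (Suc l)) y" for y :: "'a hfun"
    by (simp add: fun_eq_iff algebra_simps)
  then have "hE ((hE ^^ l) w + scal (of_nat l) ((hE ^^ (l - 1)) u)) + (hE ^^ l) u
      = hE ((hE ^^ l) w) + scal (of_nat (Suc l)) ((hE ^^ l) u)"
    unfolding lin_hE(1) * add.assoc by simp
  then have "(hE ^^ Suc l) (mk u a b w) = mk ((hE ^^ Suc l) u) ((hE ^^ Suc l) a) ((hE ^^ Suc l) b)
      ((hE ^^ Suc l) w + scal (of_nat (Suc l)) ((hE ^^ (Suc l - 1)) u))"
    unfolding funpow.simps o_apply Suc hE_mk diff_Suc_1 by simp
  then show ?case .
qed simp

lemma red_hE: "red (hE x) = (hE (red x) :: 'a::comm_ring_1 hfun)"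
proof -
  have "of_int (hE_at L x) = (hE_at L (\<lambda>L. of_int (x L)) :: 'a)" for L
    by (induction L arbitrary: x) (auto simp: slice_def)
  then show ?thesis
    by (simp add: hE_def red_def)
qed

lemma red_hF: "red (hF x) = (hF (red x) :: 'a::comm_ring_1 hfun)"
proof -
  have "of_int (hF_at L x) = (hF_at L (\<lambda>L. of_int (x L)) :: 'a)" for L
    by (induction L arbitrary: x) (auto simp: slice_def)
  then show ?thesis
    by (simp add: hF_def red_def)
qed

text \<open>The \<open>sl_2\<close> relation \<open>[F, E] = - H\<close>, one coordinate at a time:
  each handle contributes 1 minus its weight.\<close>

lemma hFE_commutator:
  "hF (hE x) L = hE (hF x) L + (of_nat (length L) - of_nat (hdeg L)) * x L"
proof (induction L arbitrary: x)
  case (Cons c L)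
  have E: "slice c (hE x) = hE (slice c x) + (if c = Hab then slice H0 x else 0)"
    and F: "slice c (hF x) = hF (slice c x) + (if c = H0 then slice Hab x else 0)"
    for c by (auto simp: fun_eq_iff)
  have "hF (hE (slice c x)) L = hE (hF (slice c x)) L
      + (of_nat (length L) - of_nat (hdeg L)) * slice c x L"
    by (rule Cons.IH)
  then show ?case
    by (cases c) (simp_all add: E F lin_hE lin_hF algebra_simps)
qed simp

lemma hE_nonzero:
  "hE x L \<noteq> 0 \<Longrightarrow> \<exists>L'. x L' \<noteq> 0 \<and> length L' = length L \<and> hdeg L = hdeg L' + 2"
proof (induction L arbitrary: x)
  case (Cons c L)
  show ?case
  proof (cases "hE (slice c x) L = 0")
    case True
    with Cons.prems show ?thesis
      by (intro exI[of _ "H0 # L"]) (auto split: if_splits)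
  next
    case False
    from Cons.IH[OF this] obtain L' where
      "slice c x L' \<noteq> 0" "length L' = length L" "hdeg L = hdeg L' + 2"
      by blast
    then show ?thesis
      by (intro exI[of _ "c # L'"]) simp
  qed
qed simp

section \<open>The inner product on words and the adjointness of the two operators\<close>

primrec hdot :: "nat \<Rightarrow> 'a::comm_ring_1 hfun \<Rightarrow> 'a hfun \<Rightarrow> 'a" where
  "hdot 0 x y = x [] * y []"
| "hdot (Suc n) x y = hdot n (slice H0 x) (slice H0 y) + hdot n (slice Ha x) (slice Ha y)
     + hdot n (slice Hb x) (slice Hb y) + hdot n (slice Hab x) (slice Hab y)"

lemma hdot_add_left: "hdot n (x + y) z = hdot n x z + hdot n y z"
proof (induction n arbitrary: x y z)
  case (Suc n)
  show ?case
    unfolding hdot.simps linop_add[OF linop_slice] Suc by (simp only: add_ac)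
qed (simp add: algebra_simps)

lemma hdot_scal_left: "hdot n (scal c x) z = c * hdot n x z"
proof (induction n arbitrary: x z)
  case (Suc n)
  show ?case
    unfolding hdot.simps linop_scal[OF linop_slice] Suc by (simp only: distrib_left)
qed simp

lemma hdot_commute: "hdot n x y = hdot n y x"
proof (induction n arbitrary: x y)
  case (Suc n)
  have "hdot n (slice c x) (slice c y) = hdot n (slice c y) (slice c x)" for c
    by (rule Suc)
  then show ?case by simp
qed simp

lemma hdot_add_right: "hdot n z (x + y) = hdot n z x + hdot n z y"
  and hdot_scal_right: "hdot n z (scal c x) = c * hdot n z x"
  by (simp_all add: hdot_commute[of n z] hdot_add_left hdot_scal_left)

lemma hdot_0_left [simp]: "hdot n 0 y = 0"
  and hdot_0_right [simp]: "hdot n y 0 = 0"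
  using hdot_scal_left[of n 0 0 y] hdot_scal_right[of n y 0 0] by simp_all

lemma hdot_uminus_left: "hdot n (- x) y = - hdot n x y"
  using hdot_scal_left[of n "- 1" x y] by (simp add: scal_minus_left)

lemma hdot_mk:
  "hdot (Suc n) (mk u a b w) (mk u' a' b' w') = hdot n u u' + hdot n a a' + hdot n b b' + hdot n w w'"
  by simp

lemma hE_adjoint: "hdot n (hE x) y = hdot n x (hF y)"
proof (induction n arbitrary: x y)
  case (Suc n)
  have E: "slice c (hE x) = hE (slice c x) + (if c = Hab then slice H0 x else 0)"
    and F: "slice c (hF x) = hF (slice c x) + (if c = H0 then slice Hab x else 0)" for c and x :: "'a hfun"
    by (auto simp: fun_eq_iff)
  have "hdot n (hE (slice c x)) (slice d y) = hdot n (slice c x) (hF (slice d y))" for c d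
    by (rule Suc)
  then show ?case
    by (simp add: E F hdot_add_left hdot_add_right algebra_simps)
qed simp

lemma hEn_adjoint: "hdot n ((hE ^^ l) x) y = hdot n x ((hF ^^ l) y)"
proof (induction l arbitrary: y)
  case (Suc l)
  have "hdot n ((hE ^^ Suc l) x) y = hdot n ((hE ^^ l) x) (hF y)"
    by (simp add: hE_adjoint)
  also have "\<dots> = hdot n x ((hF ^^ l) (hF y))"
    by (rule Suc)
  finally show ?case
    by (simp add: funpow_swap1)
qed simp

lemma hdot_self_nonneg: "hdot n x x \<ge> (0 :: int)"
  by (induction n arbitrary: x) auto

lemma hdot_self_eq_0:
  "hdot n x x = (0 :: int) \<Longrightarrow> length L = n \<Longrightarrow> x L = 0"
proof (induction n arbitrary: x L)
  case (Suc n)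
  then obtain c L' where L: "L = c # L'" "length L' = n"
    by (metis length_Suc_conv)
  have "hdot n (slice c x) (slice c x) = 0"
    using Suc.prems(1) hdot_self_nonneg[of n "slice H0 x"] hdot_self_nonneg[of n "slice Ha x"]
      hdot_self_nonneg[of n "slice Hb x"] hdot_self_nonneg[of n "slice Hab x"]
    by (cases c) auto
  from Suc.IH[OF this L(2)] show ?case
    by (simp add: L)
qed simp

subsection \<open>The integral kernels of the lowering operator\<close>

text \<open>The degree \<open>n + 1 - j\<close> is expressed additively, which avoids truncated
  subtraction and leaves only 0 for \<open>j > n + 1\<close>. Fixing the length of the words makes
  an element determined by its coordinates in genus \<open>n\<close>.\<close>

definition homog :: "nat \<Rightarrow> nat \<Rightarrow> 'a::comm_ring_1 hfun \<Rightarrow> bool" where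
  "homog j n x \<longleftrightarrow> (\<forall>L. x L \<noteq> 0 \<longrightarrow> length L = n \<and> hdeg L + j = n + 1)"

definition LV :: "nat \<Rightarrow> nat \<Rightarrow> int hfun set" where
  "LV j n = {x. homog j n x \<and> hF x = 0}"

lemma homog_zero [simp]: "homog j n 0"
  by (simp add: homog_def)

lemma homog_add: "homog j n x \<Longrightarrow> homog j n y \<Longrightarrow> homog j n (x + y)"
  unfolding homog_def by (metis add.right_neutral plus_fun_apply)

lemma homog_scal: "homog j n x \<Longrightarrow> homog j n (scal c x)"
  unfolding homog_def by (metis mult_zero_right scal_apply)

lemma homog_red: "homog j n x \<Longrightarrow> homog j n (red x)"
  unfolding homog_def by (metis of_int_0 red_apply)

lemma homog_hE: "homog (Suc (Suc j)) n x \<Longrightarrow> homog j n (hE x)"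
  unfolding homog_def using hE_nonzero by fastforce

lemma homog_mk:
  "homog (Suc j) (Suc n) (mk u a b w) \<longleftrightarrow>
     homog j n u \<and> homog (Suc j) n a \<and> homog (Suc j) n b \<and> homog (Suc (Suc j)) n w"
  (is "?l = ?r")
proof
  assume h: ?l
  have "mk u a b w (c # L) \<noteq> 0 \<longrightarrow> length L = n \<and> hwt c + hdeg L + j = n + 1" for c L
    using h unfolding homog_def by fastforce
  from this[of H0] this[of Ha] this[of Hb] this[of Hab] show ?r
    unfolding homog_def by auto
next
  assume ?r
  then show ?l
    unfolding homog_def by (auto simp: mk_def split: list.splits handle.splits)
qed

lemma homog_Nil: "homog j (Suc n) x \<Longrightarrow> x [] = 0"
  unfolding homog_def by fastforce

lemma LV_zero [simp]: "0 \<in> LV j n"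
  by (simp add: LV_def lin_hF)

lemma LV_add: "x \<in> LV j n \<Longrightarrow> y \<in> LV j n \<Longrightarrow> x + y \<in> LV j n"
  and LV_scal: "x \<in> LV j n \<Longrightarrow> scal c x \<in> LV j n"
  by (auto simp: LV_def lin_hF homog_add homog_scal)

lemma LV_uminus: "x \<in> LV j n \<Longrightarrow> - x \<in> LV j n"
  using LV_scal[of x j n "- 1"] by (simp add: scal_minus_left)

lemma LV_mk:
  "mk u a b w \<in> LV (Suc j) (Suc n) \<longleftrightarrow> homog j n u \<and> hF u = - w \<and>
     a \<in> LV (Suc j) n \<and> b \<in> LV (Suc j) n \<and> w \<in> LV (Suc (Suc j)) n"
  by (auto simp: LV_def homog_mk hF_mk eq_neg_iff_add_eq_0)

lemma LV_cases:
  assumes "x \<in> LV (Suc j) (Suc n)"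
  obtains u a b w where "x = mk u a b w" "homog j n u" "hF u = - w"
    "a \<in> LV (Suc j) n" "b \<in> LV (Suc j) n" "w \<in> LV (Suc (Suc j)) n"
proof -
  have "x = mk (slice H0 x) (slice Ha x) (slice Hb x) (slice Hab x)"
    using assms by (intro mk_slices[symmetric]) (auto simp: LV_def dest: homog_Nil)
  with assms that show thesis
    by (metis LV_mk)
qed

lemma LV_hFE:
  assumes "x \<in> LV (Suc j) n"
  shows "hF (hE x) = scal (of_nat j) x"
proof
  fix L
  have "hF (hE x) L = (of_nat (length L) - of_nat (hdeg L)) * x L"
    using assms hFE_commutator[of x L] by (simp add: LV_def lin_hE)
  also have "\<dots> = of_nat j * x L"
    using assms by (cases "x L = 0") (auto simp: LV_def homog_def)
  finally show "hF (hE x) L = scal (of_nat j) x L" by simp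
qed

text \<open>On positive weights the lowering operator is injective, because there
  \<open>\<parallel>E x\<parallel>\<^sup>2 = \<langle>x, F E x\<rangle> = - \<parallel>x\<parallel>\<^sup>2\<close> for \<open>x\<close> in its kernel.\<close>

lemma LV_0: "x \<in> LV 0 n \<longleftrightarrow> x = 0"
proof
  assume x: "x \<in> LV 0 n"
  have "hF (hE x) = - x"
  proof
    fix L
    have "hF (hE x) L = (of_nat (length L) - of_nat (hdeg L)) * x L"
      using x hFE_commutator[of x L] by (simp add: LV_def lin_hE)
    also have "\<dots> = - x L"
      using x by (cases "x L = 0") (auto simp: LV_def homog_def)
    finally show "hF (hE x) L = (- x) L" by simp
  qed
  then have "hdot n (hE x) (hE x) = - hdot n x x"
    by (metis hE_adjoint hdot_commute hdot_uminus_left)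
  with hdot_self_nonneg[of n x] hdot_self_nonneg[of n "hE x"] have "hdot n x x = 0"
    by linarith
  then have "length L = n \<Longrightarrow> x L = 0" for L
    by (rule hdot_self_eq_0)
  then show "x = 0"
    using x by (fastforce simp: LV_def homog_def)
qed simp

lemma LV_base: "x \<in> LV j 0 \<Longrightarrow> j \<noteq> 1 \<Longrightarrow> x = 0"
  unfolding LV_def homog_def by fastforce


section \<open>Exactness in the handle model\<close>

lemmas fun_apply = plus_fun_apply zero_fun_apply uminus_apply minus_apply scal_apply red_apply

text \<open>
  Goals produced by induction can be eta-long in function variables; the pointwise rules would
  then turn sums of functions into abstractions, which no rule about linear operators matches.
\<close>

declare fun_apply [simp del]

definition PV :: "nat \<Rightarrow> nat \<Rightarrow> 'p::prime_card mod_ring hfun set" where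
  "PV j n = red ` LV j n"

lemma PV_zero [simp]: "0 \<in> PV j n"
  unfolding PV_def by (rule image_eqI[of _ _ 0]) (simp_all add: red_simps)

lemma PV_add: "x \<in> PV j n \<Longrightarrow> y \<in> PV j n \<Longrightarrow> x + y \<in> PV j n"
  unfolding PV_def by (auto simp: red_simps(1)[symmetric] intro!: imageI LV_add)

lemma PV_scal: "x \<in> PV j n \<Longrightarrow> scal c x \<in> PV j n"
proof -
  assume "x \<in> PV j n"
  then obtain X where X: "x = red X" "X \<in> LV j n"
    by (auto simp: PV_def)
  obtain i where "c = of_nat i"
    using surj_of_nat_mod_ring[of c] by blast
  then have "scal c x = red (scal (int i) X)"
    by (simp add: red_simps X)
  with X(2) show ?thesis
    unfolding PV_def by (auto intro!: imageI LV_scal)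
qed

lemma PV_uminus: "x \<in> PV j n \<Longrightarrow> - x \<in> PV j n"
  using PV_scal[of x j n "- 1"] by (simp add: scal_minus_left)

text \<open>Inherited from the integral kernels, where it rests on positivity. The kernel of
  \<open>F\<close> modulo p in degree \<open>n + 1\<close> can be nonzero.\<close>

lemma PV_0: "x \<in> PV 0 n \<Longrightarrow> x = 0"
  by (auto simp: PV_def LV_0 red_simps)

lemma PV_base: "x \<in> PV j 0 \<Longrightarrow> j \<noteq> 1 \<Longrightarrow> x = 0"
  by (auto simp: PV_def red_simps dest: LV_base)

lemma PV_hF: "x \<in> PV j n \<Longrightarrow> hF x = 0"
  by (auto simp: PV_def LV_def red_hF[symmetric] red_simps)

lemma PV_cases:
  assumes "x \<in> PV (Suc j) (Suc n)"
  obtains u a b w where "x = mk u a b w"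
  using assms by (auto simp: PV_def mk_simps elim!: LV_cases)

text \<open>
  If \<open>j + 1\<close> is invertible, \<open>PV (j + 1) (n + 1)\<close> splits as a direct sum of two copies of
  \<open>PV (j + 1) n\<close>, of \<open>PV j n\<close> and of \<open>PV (j + 2) n\<close>, the last one being embedded by
  \<open>w \<mapsto> (a \<and> b) \<otimes> w - 1 \<otimes> E w / (j + 1)\<close>.
\<close>

lemma PV_mkD:
  fixes u :: "'p::prime_card mod_ring hfun"
  assumes "mk u a b w \<in> PV (Suc j) (Suc n)" and c: "of_nat (Suc j) \<noteq> (0 :: 'p mod_ring)"
  shows "a \<in> PV (Suc j) n" "b \<in> PV (Suc j) n" "w \<in> PV (Suc (Suc j)) n" "hF u = - w"
    "u + scal (inverse (of_nat (Suc j))) (hE w) \<in> PV j n"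
proof -
  from assms(1) obtain X where X: "X \<in> LV (Suc j) (Suc n)" "mk u a b w = red X"
    by (auto simp: PV_def)
  from X(1) obtain u' a' b' w' where *: "X = mk u' a' b' w'" "homog j n u'" "hF u' = - w'"
    "a' \<in> LV (Suc j) n" "b' \<in> LV (Suc j) n" "w' \<in> LV (Suc (Suc j)) n"
    by (rule LV_cases)
  from X(2) have e: "u = red u'" "a = red a'" "b = red b'" "w = red w'"
    by (simp_all add: *(1) mk_simps)
  show "a \<in> PV (Suc j) n" "b \<in> PV (Suc j) n" "w \<in> PV (Suc (Suc j)) n"
    using * e by (auto simp: PV_def)
  show "hF u = - w"
    by (simp add: e red_hF[symmetric] * red_simps)
  \<comment> \<open>Since \<open>F u' = - w'\<close> and \<open>F E w' = (j + 1) w'\<close>, this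
    integral combination lies in the kernel of \<open>F\<close>. The division by
    \<open>j + 1\<close> is postponed until after the reduction.\<close>
  have "hF (scal (of_nat (Suc j)) u' + hE w') = 0"
    unfolding lin_hF(1,2) *(3) LV_hFE[OF *(6)] scal_uminus by simp
  moreover have "homog j n (scal (of_nat (Suc j)) u' + hE w')"
    using * by (intro homog_add homog_scal homog_hE) (auto simp: LV_def)
  ultimately have "scal (of_nat (Suc j)) u' + hE w' \<in> LV j n"
    by (simp only: LV_def mem_Collect_eq conj_absorb)
  then have "scal (inverse (of_nat (Suc j))) (red (scal (of_nat (Suc j)) u' + hE w')) \<in> PV j n"
    by (intro PV_scal) (auto simp: PV_def)
  also have "scal (inverse (of_nat (Suc j))) (red (scal (of_nat (Suc j)) u' + hE w'))
      = u + scal (inverse (of_nat (Suc j))) (hE w)"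
    unfolding red_simps red_hE e of_int_of_nat_eq scal_add scal_simps(4) left_inverse[OF c]
      scal_simps(3) ..
  finally show "u + scal (inverse (of_nat (Suc j))) (hE w) \<in> PV j n" .
qed

lemma PV_mkI:
  fixes u :: "'p::prime_card mod_ring hfun"
  assumes c: "of_nat (Suc j) \<noteq> (0 :: 'p mod_ring)"
    and "a \<in> PV (Suc j) n" "b \<in> PV (Suc j) n" "w \<in> PV (Suc (Suc j)) n"
    and z: "u + scal (inverse (of_nat (Suc j))) (hE w) \<in> PV j n"
  shows "mk u a b w \<in> PV (Suc j) (Suc n)"
proof -
  define z where "z = u + scal (inverse (of_nat (Suc j))) (hE w)"
  obtain z' a' b' w' where *: "z = red z'" "a = red a'" "b = red b'" "w = red w'"
    "z' \<in> LV j n" "a' \<in> LV (Suc j) n" "b' \<in> LV (Suc j) n" "w' \<in> LV (Suc (Suc j)) n"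
    using assms unfolding PV_def z_def[symmetric] by blast
  have "mk z' a' b' 0 \<in> LV (Suc j) (Suc n)"
    using * by (simp add: LV_mk) (simp add: LV_def)
  then have 1: "mk z a b 0 \<in> PV (Suc j) (Suc n)"
    unfolding PV_def by (rule image_eqI[rotated]) (simp add: mk_simps * red_simps)
  \<comment> \<open>This is the embedded copy of \<open>w'\<close> multiplied by
    \<open>j + 1\<close>, which makes its coordinates integral.\<close>
  have "mk (- hE w') 0 0 (scal (of_nat (Suc j)) w') \<in> LV (Suc j) (Suc n)"
  proof -
    have "homog j n (- hE w')"
      using *(8) homog_scal[OF homog_hE, of j n w' "- 1"] by (simp add: LV_def scal_minus_left)
    then show ?thesis
      unfolding LV_mk lin_hF(4) LV_hFE[OF *(8)] using *(8) by (auto intro: LV_scal)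
  qed
  then have "red (mk (- hE w') 0 0 (scal (of_nat (Suc j)) w'))
      \<in> (PV (Suc j) (Suc n) :: 'p mod_ring hfun set)"
    unfolding PV_def by (rule imageI)
  then have 2: "mk (- hE w) 0 0 (scal (of_nat (Suc j)) w) \<in> PV (Suc j) (Suc n)"
    by (simp add: mk_simps * red_simps red_hE)
  have "mk u a b w = mk z a b 0 +
      scal (inverse (of_nat (Suc j))) (mk (- hE w) 0 0 (scal (of_nat (Suc j)) w))"
    unfolding mk_simps z_def scal_simps scal_uminus left_inverse[OF c] scal_simps(3) add_0_left
      add_0_right add_uminus_conv_diff add_diff_cancel_right' ..
  then show ?thesis
    using PV_add[OF 1 PV_scal[OF 2]] by simp
qed

text \<open>By \<open>hEn_mk\<close>, the only term of \<open>E^p\<close> beyond its action on the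
  remaining handles has coefficient p. The argument is coordinatewise because \<open>x\<close> may
  be any function on words, of unbounded length.\<close>

lemma hE_pow_char:
  fixes x :: "'p::prime_card mod_ring hfun"
  shows "(hE ^^ CARD('p)) x = 0"
proof
  fix L
  obtain m where m: "CARD('p) = Suc m"
    using not0_implies_Suc[of "CARD('p)"] by auto
  show "(hE ^^ CARD('p)) x L = 0 L"
  proof (induction L arbitrary: x)
    case Nil
    then show ?case by (simp add: m zero_fun_apply)
  next
    case (Cons c L)
    \<comment> \<open>\<open>mk\<close> vanishes at the empty word, whereas \<open>x\<close> may
      not. As \<open>hE\<close> ignores that coordinate, \<open>x\<close> can be replaced by
      \<open>?y\<close>.\<close>
    let ?y = "mk (slice H0 x) (slice Ha x) (slice Hb x) (slice Hab x)"
    have "hE x = hE ?y"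
      unfolding hE_mk by (rule mk_eqI) (auto simp: fun_eq_iff fun_apply)
    then have "(hE ^^ CARD('p)) x = (hE ^^ CARD('p)) ?y"
      by (simp add: m funpow_Suc_right del: funpow.simps)
    then have "(hE ^^ CARD('p)) x (c # L) = (hE ^^ CARD('p)) ?y (c # L)"
      by simp
    also have "\<dots> = 0 (c # L)"
    proof -
      have "(hE ^^ CARD('p)) (slice d x) L = 0" for d
        using Cons[of "slice d x"] by (simp only: zero_fun_apply)
      then show ?thesis
        unfolding hEn_mk by (cases c) (simp_all add: of_nat_card_eq_0 fun_apply)
    qed
    finally show ?case .
  qed
qed

lemma of_nat_mod_ring_eq_0:
  assumes "0 < l" "l < CARD('p::prime_card)"
  shows "of_nat l \<noteq> (0 :: 'p mod_ring)"
  using assms of_nat_0_mod_ring_dvd[where 'a='p, of l] nat_dvd_not_less by blast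

lemma of_nat_card_mult_add:
  "of_nat (CARD('p::prime_card) * q + l) = (of_nat l :: 'p mod_ring)"
  by simp

text \<open>Substituting \<open>u = z - E w / l\<close> in \<open>hEn_mk\<close> cancels the two
  terms \<open>E^l w\<close> in the last coordinate. In the coordinates \<open>z\<close> and
  \<open>w\<close> of the splitting, the power \<open>E^l\<close> thus interchanges the two
  summands.\<close>

lemma hE_pow_mk_split:
  fixes u :: "'a::field hfun"
  assumes "of_nat l \<noteq> (0 :: 'a)" and z: "z = u + scal (inverse (of_nat l)) (hE w)"
  shows "(hE ^^ l) (mk u a b w) = mk ((hE ^^ l) z - scal (inverse (of_nat l)) ((hE ^^ Suc l) w))
      ((hE ^^ l) a) ((hE ^^ l) b) (scal (of_nat l) ((hE ^^ (l - 1)) z))"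
proof -
  have l: "l = Suc (l - 1)"
    using assms by (cases l) auto
  have u: "u = z - scal (inverse (of_nat l)) (hE w)"
    using z by simp
  have 1: "(hE ^^ l) (hE w) = (hE ^^ Suc l) w"
    by (simp add: funpow_swap1)
  have "(hE ^^ (l - 1)) (hE w) = (hE ^^ Suc (l - 1)) w"
    by (simp add: funpow_swap1)
  then have 2: "(hE ^^ (l - 1)) (hE w) = (hE ^^ l) w"
    using l by simp
  have "scal (of_nat l) ((hE ^^ (l - 1)) u) = scal (of_nat l) ((hE ^^ (l - 1)) z) - (hE ^^ l) w"
    unfolding u lin_hEn 2 scal_diff scal_simps(4) using assms(1) by simp
  moreover have "(hE ^^ l) u = (hE ^^ l) z - scal (inverse (of_nat l)) ((hE ^^ Suc l) w)"
    unfolding u lin_hEn 1 ..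
  ultimately show ?thesis
    unfolding hEn_mk by simp
qed

text \<open>The induction has to allow every \<open>l \<le> p\<close>, since the summands
  \<open>z\<close> and \<open>w\<close> require \<open>l - 1\<close> and \<open>l + 1\<close>. At
  the ends the map is the identity or \<open>E^p = 0\<close>.\<close>

lemma hE_pow_PV:
  fixes x :: "'p::prime_card mod_ring hfun"
  assumes "p = CARD('p)" "l \<le> p" "q \<ge> 1" "x \<in> PV (p * q + l) n"
  shows "(hE ^^ l) x \<in> PV (p * q - l) n"
  using assms(2,4)
proof (induction n arbitrary: l x)
  case 0
  have "p \<ge> 2"
    using assms(1) prime_ge_2_nat[OF prime_card[where 'a='p]] by simp
  then have "p * q \<ge> 2"
    using mult_le_mono[of 2 p 1 q] \<open>q \<ge> 1\<close> by simp
  with PV_base[OF 0(2)] have "x = 0" by simp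
  then have "(hE ^^ l) x = 0"
    by (simp only: lin_hEn)
  then show ?case by (simp only: PV_zero)
next
  case (Suc n)
  show ?case
  proof (cases "l = 0 \<or> l = p")
    case True
    then show ?thesis
      using Suc.prems hE_pow_char[of x] assms(1) by auto
  next
    case False
    then have l: "0 < l" "l < p"
      using Suc.prems by auto
    define j where "j = p * q + (l - 1)"
    define i where "i = p * q - Suc l"
    have "p * q \<ge> p"
      using assms by simp
    then have ji: "p * q + l = Suc j" "p * q - l = Suc i" "p * q + Suc l = Suc (Suc j)"
      "p * q - (l - 1) = Suc (Suc i)"
      using l unfolding j_def i_def by linarith+
    have c: "of_nat l \<noteq> (0 :: 'p mod_ring)"
      using of_nat_mod_ring_eq_0[where 'p='p] l assms(1) by simp
    have cj: "of_nat (Suc j) = (of_nat l :: 'p mod_ring)"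
      unfolding ji(1)[symmetric] assms(1) by (rule of_nat_card_mult_add)
    have "Suc i + l = p * q"
      using \<open>p * q \<ge> p\<close> l ji(2) by linarith
    then have "of_nat (Suc i) + of_nat l = (of_nat (CARD('p) * q + 0) :: 'p mod_ring)"
      by (metis assms(1) add_0_right of_nat_add)
    then have ci: "of_nat (Suc i) = - (of_nat l :: 'p mod_ring)"
      unfolding of_nat_card_mult_add by (simp only: eq_neg_iff_add_eq_0 of_nat_0)
    obtain u a b w where x: "x = mk u a b w"
      using Suc.prems(2) unfolding ji by (rule PV_cases)
    define z where "z = u + scal (inverse (of_nat l)) (hE w)"
    have cj0: "of_nat (Suc j) \<noteq> (0 :: 'p mod_ring)" and ci0: "of_nat (Suc i) \<noteq> (0 :: 'p mod_ring)"
      using c unfolding cj ci by auto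
    note D = PV_mkD[OF Suc.prems(2)[unfolded ji x] cj0, unfolded cj, folded z_def]
    have "(hE ^^ l) a \<in> PV (Suc i) n" "(hE ^^ l) b \<in> PV (Suc i) n"
      using Suc.IH[of l] D(1,2) l ji by simp_all
    moreover have Z: "scal (of_nat l) ((hE ^^ (l - 1)) z) \<in> PV (Suc (Suc i)) n"
      using Suc.IH[of "l - 1" z] D(5) l ji(4) by (intro PV_scal) (simp add: j_def)
    moreover have "(hE ^^ Suc l) w \<in> PV i n"
      using Suc.IH[of "Suc l" w] D(3) l unfolding ji(3) i_def by (simp del: funpow.simps)
    then have W: "- scal (inverse (of_nat l)) ((hE ^^ Suc l) w) \<in> PV i n"
      by (intro PV_uminus PV_scal)
    have "hE ((hE ^^ (l - 1)) z) = (hE ^^ l) z"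
      using l by (metis Suc_diff_1 comp_apply funpow.simps(2))
    \<comment> \<open>The target index is congruent to \<open>- l\<close>, so its splitting divides
      by \<open>- l\<close>. With this sign the two copies of \<open>E^l z\<close> cancel in the
      coordinate to be tested, and only the part from \<open>w\<close> remains.\<close>
    then have "scal (inverse (- of_nat l)) (hE (scal (of_nat l) ((hE ^^ (l - 1)) z))) = - (hE ^^ l) z"
      unfolding lin_hE scal_simps(4) using c by (simp add: scal_minus_left)
    with W have "((hE ^^ l) z - scal (inverse (of_nat l)) ((hE ^^ Suc l) w)) +
       scal (inverse (of_nat (Suc i))) (hE (scal (of_nat l) ((hE ^^ (l - 1)) z))) \<in> PV i n"
      unfolding ci by simp
    ultimately show ?thesis
      unfolding x hE_pow_mk_split[OF c z_def] ji(2) by (intro PV_mkI[OF ci0])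
  qed
qed

text \<open>The common last step for exactness and for the null space: preimages of the four
  components of a vector, taken with the exponents \<open>m\<close>, \<open>m\<close>,
  \<open>m + 1\<close> and \<open>m - 1\<close>, are assembled into a preimage of the vector under
  \<open>E^m\<close>.\<close>

lemma hE_pow_preimage_mk:
  fixes u :: "'p::prime_card mod_ring hfun"
  assumes lm: "l + m = CARD('p)" "0 < l" "0 < m"
    and J: "of_nat (Suc j) = (of_nat m :: 'p mod_ring)"
    and a: "a' \<in> PV (Suc j) n" "(hE ^^ m) a' = a"
    and b: "b' \<in> PV (Suc j) n" "(hE ^^ m) b' = b"
    and z: "z' \<in> PV (Suc (Suc j)) n" "(hE ^^ Suc m) z' = u + scal (inverse (of_nat l)) (hE w)"
    and w: "w' \<in> PV j n" "(hE ^^ (m - 1)) w' = w"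
  shows "\<exists>y\<in>PV (Suc j) (Suc n). (hE ^^ m) y = mk u a b w"
proof -
  have d: "of_nat m \<noteq> (0 :: 'p mod_ring)"
    using of_nat_mod_ring_eq_0[where 'p='p] lm by simp
  have "of_nat l + of_nat m = (0 :: 'p mod_ring)"
    unfolding of_nat_add[symmetric] lm by simp
  then have c: "of_nat l = - (of_nat m :: 'p mod_ring)"
    by (simp add: eq_neg_iff_add_eq_0)
  \<comment> \<open>In splitting coordinates the preimage must satisfy
    \<open>- E^(m+1) v / m = u + E w / l\<close> and \<open>m E^(m-1) y = w\<close>, which dictates
    these scalars. \<open>t\<close> translates \<open>y\<close> back into the coordinate of
    1.\<close>
  define v where "v = scal (- of_nat m) z'"
  define y where "y = scal (inverse (of_nat m)) w'"
  define t where "t = y - scal (inverse (of_nat m)) (hE v)"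
  have t: "t + scal (inverse (of_nat m)) (hE v) = y"
    by (simp add: t_def)
  have "mk t a' b' v \<in> PV (Suc j) (Suc n)"
  proof (rule PV_mkI)
    show "v \<in> PV (Suc (Suc j)) n"
      unfolding v_def by (intro PV_scal z)
    show "t + scal (inverse (of_nat (Suc j))) (hE v) \<in> PV j n"
      unfolding J t y_def by (intro PV_scal w)
  qed (use a b d J in auto)
  moreover have "(hE ^^ m) (mk t a' b' v) = mk u a b w"
  proof -
    have hw: "(hE ^^ m) w' = hE w"
      using lm w(2) by (metis Suc_diff_1 comp_apply funpow.simps(2))
    have "(hE ^^ m) y - scal (inverse (of_nat m)) ((hE ^^ Suc m) v)
        = scal (inverse (of_nat m)) (hE w) + (hE ^^ Suc m) z'"
      unfolding y_def v_def lin_hEn hw scal_simps(4) using d by (simp add: scal_minus_left)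
    also have "\<dots> = u"
      unfolding z(2) c by (simp add: scal_minus_left)
    finally have 1: "(hE ^^ m) y - scal (inverse (of_nat m)) ((hE ^^ Suc m) v) = u" .
    have 2: "scal (of_nat m) ((hE ^^ (m - 1)) y) = w"
      unfolding y_def lin_hEn w(2) scal_simps(4) using d by simp
    show ?thesis
      unfolding hE_pow_mk_split[OF d t[symmetric]] 1 2 a(2) b(2) ..
  qed
  ultimately show ?thesis by blast
qed

text \<open>In splitting coordinates \<open>E^l x = 0\<close> says that \<open>E^(l-1) z = 0\<close>
  and \<open>E^(l+1) w = 0\<close>, so the hypothesis passes to the neighbouring residues in lower
  genus. For \<open>l = 0\<close> it says that \<open>x = 0\<close>; for \<open>l = p\<close> the
  vector is its own preimage under \<open>E^0\<close>.\<close>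

lemma hE_pow_exact:
  fixes x :: "'p::prime_card mod_ring hfun"
  assumes "p = CARD('p)" "l \<le> p" "q \<ge> 1" "x \<in> PV (p * q + l) n" "(hE ^^ l) x = 0"
  shows "\<exists>y\<in>PV (p * (q + 2) - l) n. (hE ^^ (p - l)) y = x"
  using assms(2,4,5)
proof (induction n arbitrary: l x)
  case 0
  have "p \<ge> 2"
    using assms(1) prime_ge_2_nat[OF prime_card[where 'a='p]] by simp
  then have "p * q \<ge> 2"
    using mult_le_mono[of 2 p 1 q] \<open>q \<ge> 1\<close> by simp
  with PV_base[OF 0(2)] have "x = 0" by simp
  then have "0 \<in> PV j 0 \<and> (hE ^^ r) 0 = x" for j r
    by (simp only: lin_hEn PV_zero)
  then show ?case by blast
next
  case (Suc n)
  consider "l = 0" | "l = p" | "0 < l" "l < p"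
    using Suc.prems by linarith
  then show ?case
  proof cases
    case 1
    with Suc.prems have "x = 0" by simp
    then have "0 \<in> PV j (Suc n) \<and> (hE ^^ r) 0 = x" for j r
      by (simp only: lin_hEn PV_zero)
    then show ?thesis by blast
  next
    case 2
    with Suc.prems show ?thesis by (auto intro!: bexI[of _ x] simp: algebra_simps)
  next
    case 3
    note l = this
    define m where "m = p - l"
    define j where "j = p * q + (l - 1)"
    define i where "i = p * (q + 2) - Suc l"
    have J: "p * q + l = Suc j" "p * (q + 2) - l = Suc i" "p * q + Suc l = Suc (Suc j)"
      "p * (q + 2) - (l - 1) = Suc (Suc i)" "p - (l - 1) = Suc m" "p - Suc l = m - 1"
      using l by (auto simp: j_def i_def m_def algebra_simps)
    have c: "of_nat l \<noteq> (0 :: 'p mod_ring)"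
      using of_nat_mod_ring_eq_0[where 'p='p] l assms(1) by simp
    have cj: "of_nat (Suc j) = (of_nat l :: 'p mod_ring)"
      unfolding J(1)[symmetric] assms(1) by (rule of_nat_card_mult_add)
    then have cj0: "of_nat (Suc j) \<noteq> (0 :: 'p mod_ring)"
      using c by simp
    have "Suc i = p * (q + 1) + m"
      unfolding J(2)[symmetric] m_def using l by (auto simp: algebra_simps)
    then have ci: "of_nat (Suc i) = (of_nat m :: 'p mod_ring)"
      unfolding assms(1) by (simp only: of_nat_card_mult_add)
    obtain u a b w where x: "x = mk u a b w"
      using Suc.prems(2) unfolding J by (rule PV_cases)
    define z where "z = u + scal (inverse (of_nat l)) (hE w)"
    note D = PV_mkD[OF Suc.prems(2)[unfolded J x] cj0, unfolded cj, folded z_def]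
    from Suc.prems(3) have 0: "(hE ^^ l) z - scal (inverse (of_nat l)) ((hE ^^ Suc l) w) = 0"
      "(hE ^^ l) a = 0" "(hE ^^ l) b = 0" "scal (of_nat l) ((hE ^^ (l - 1)) z) = 0"
      unfolding x hE_pow_mk_split[OF c z_def] mk_eq_0 by blast+
    have "scal (inverse (of_nat l)) (scal (of_nat l) ((hE ^^ (l - 1)) z)) = 0"
      unfolding 0 by simp
    then have hz: "(hE ^^ (l - 1)) z = 0"
      unfolding scal_simps(4) using c by simp
    moreover have "(hE ^^ l) z = hE ((hE ^^ (l - 1)) z)"
      using l by (metis Suc_diff_1 comp_apply funpow.simps(2))
    ultimately have "(hE ^^ l) z = 0"
      by (simp only: lin_hE)
    then have "scal (of_nat l) (scal (inverse (of_nat l)) ((hE ^^ Suc l) w)) = 0"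
      using 0(1) by (simp del: funpow.simps scal_simps(4))
    then have hw: "(hE ^^ Suc l) w = 0"
      unfolding scal_simps(4) using c by (simp del: funpow.simps)
    obtain a' where a': "a' \<in> PV (Suc i) n" "(hE ^^ m) a' = a"
      using Suc.IH[of l a] l D(1) 0(2) unfolding J m_def by auto
    obtain b' where b': "b' \<in> PV (Suc i) n" "(hE ^^ m) b' = b"
      using Suc.IH[of l b] l D(2) 0(3) unfolding J m_def by auto
    have "\<exists>y\<in>PV (p * (q + 2) - (l - 1)) n. (hE ^^ (p - (l - 1))) y = z"
      using l D(5) hz by (intro Suc.IH) (auto simp: j_def)
    then obtain z' where z': "z' \<in> PV (Suc (Suc i)) n" "(hE ^^ Suc m) z' = z"
      unfolding J by blast
    have "\<exists>y\<in>PV (p * (q + 2) - Suc l) n. (hE ^^ (p - Suc l)) y = w"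
      using l D(3) hw unfolding J(3)[symmetric] by (intro Suc.IH) (simp_all del: funpow.simps)
    then obtain w' where w': "w' \<in> PV i n" "(hE ^^ (m - 1)) w' = w"
      unfolding J i_def by blast
    show ?thesis
      unfolding x J(2) m_def[symmetric]
      by (rule hE_pow_preimage_mk[OF _ _ _ ci a' b' z'[unfolded z_def] w'])
        (use l assms(1) in \<open>auto simp: m_def\<close>)
  qed
qed

text \<open>Orthogonality passes to the summands by pairing with each of them separately. It is
  assumed only for \<open>k < p\<close>, because at \<open>k = p\<close> the map is
  \<open>E^0\<close> from \<open>PV p n\<close> to itself and every vector is hit.\<close>

lemma hE_pow_radical:
  fixes x :: "'p::prime_card mod_ring hfun"
  assumes "p = CARD('p)" "k \<le> p" "x \<in> PV k n"
    and "k < p \<Longrightarrow> \<forall>y\<in>PV k n. hdot n x y = 0"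
  shows "\<exists>y\<in>PV (2 * p - k) n. (hE ^^ (p - k)) y = x"
  using assms(2-)
proof (induction n arbitrary: k x)
  case 0
  have "x = 0"
  proof (cases "k = 1")
    case True
    have "1 < p"
      using assms(1) prime_card[where 'a='p] prime_gt_1_nat by blast
    \<comment> \<open>In genus 0 there is one coordinate, of norm 1, so pairing \<open>x\<close>
      with itself detects it.\<close>
    have "hdot 0 x x = 0"
      using 0(2,3) True \<open>1 < p\<close> by blast
    then have "x [] = 0" by simp
    moreover have "x L = 0" if "L \<noteq> []" for L
    proof -
      obtain X where X: "x = red X" "homog k 0 X"
        using 0(2) by (auto simp: PV_def LV_def)
      then have "X L = 0"
        using that unfolding homog_def by auto
      then show ?thesis by (simp add: X fun_apply)
    qed
    ultimately have "x L = 0" for L by (cases "L = []") auto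
    then show ?thesis by (simp add: fun_eq_iff fun_apply)
  next
    case False
    with PV_base[OF 0(2)] show ?thesis by simp
  qed
  then have "0 \<in> PV j 0 \<and> (hE ^^ r) 0 = x" for j r
    by (simp only: lin_hEn PV_zero)
  then show ?case by blast
next
  case (Suc n)
  consider "k = 0" | "k = p" | "0 < k" "k < p"
    using Suc.prems by linarith
  then show ?case
  proof cases
    case 1
    with Suc.prems have "x = 0" by (auto dest: PV_0)
    then have "0 \<in> PV j (Suc n) \<and> (hE ^^ r) 0 = x" for j r
      by (simp only: lin_hEn PV_zero)
    then show ?thesis by blast
  next
    case 2
    with Suc.prems show ?thesis by (auto intro!: bexI[of _ x] simp: algebra_simps)
  next
    case 3
    note k = this
    define m where "m = p - k"
    define j where "j = k - 1"
    define i where "i = 2 * p - Suc k"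
    have J: "k = Suc j" "2 * p - k = Suc i" "2 * p - j = Suc (Suc i)" "p - j = Suc m"
      "p - Suc k = m - 1"
      using k by (auto simp: j_def i_def m_def algebra_simps)
    have c: "of_nat k \<noteq> (0 :: 'p mod_ring)"
      using of_nat_mod_ring_eq_0[where 'p='p] k assms(1) by simp
    have "Suc i = p * 1 + m"
      unfolding J(2)[symmetric] m_def using k by simp
    then have ci: "of_nat (Suc i) = (of_nat m :: 'p mod_ring)"
      unfolding assms(1) by (simp only: of_nat_card_mult_add)
    have xP: "x \<in> PV (Suc j) (Suc n)"
      using Suc.prems(2) J(1) by simp
    then obtain u a b w where x: "x = mk u a b w"
      by (rule PV_cases)
    have null: "hdot (Suc n) (mk u a b w) y = 0" if "y \<in> PV (Suc j) (Suc n)" for y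
      using Suc.prems(3) k that J(1) x by simp
    define z where "z = u + scal (inverse (of_nat k)) (hE w)"
    have c': "of_nat (Suc j) \<noteq> (0 :: 'p mod_ring)"
      using c J(1) by simp
    note D = PV_mkD[OF xP[unfolded x] c', folded J(1), folded z_def]
    note I = PV_mkI[OF c', folded J(1)]
    have "hdot n a y = 0" "hdot n b y = 0" if "y \<in> PV k n" for y
    proof -
      have "mk 0 y 0 0 \<in> PV (Suc j) (Suc n)" "mk 0 0 y 0 \<in> PV (Suc j) (Suc n)"
        unfolding J(1)[symmetric] using that by (auto intro!: I simp: lin_hE)
      from null[OF this(1)] null[OF this(2)] show "hdot n a y = 0" "hdot n b y = 0"
        unfolding hdot_mk by simp_all
    qed
    then obtain a' b' where a': "a' \<in> PV (Suc i) n" "(hE ^^ m) a' = a"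
      and b': "b' \<in> PV (Suc i) n" "(hE ^^ m) b' = b"
      using Suc.IH[of k a] Suc.IH[of k b] k D(1,2) unfolding J(2) m_def by auto
    have "\<exists>y\<in>PV (2 * p - j) n. (hE ^^ (p - j)) y = z"
    proof (rule Suc.IH)
      show "\<forall>y\<in>PV j n. hdot n z y = 0"
      proof
        fix y :: "'p mod_ring hfun" assume y: "y \<in> PV j n"
        then have "mk y 0 0 0 \<in> PV (Suc j) (Suc n)"
          unfolding J(1)[symmetric] by (intro I) (simp_all add: lin_hE)
        from null[OF this] have "hdot n u y = 0"
          unfolding hdot_mk by simp
        moreover have "hdot n (hE w) y = 0"
          unfolding hE_adjoint PV_hF[OF y] by simp
        ultimately show "hdot n z y = 0"
          unfolding z_def hdot_add_left hdot_scal_left by simp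
      qed
    qed (use k D in \<open>auto simp: j_def\<close>)
    then obtain z' where z': "z' \<in> PV (Suc (Suc i)) n" "(hE ^^ Suc m) z' = z"
      unfolding J(3,4) by blast
    have "\<exists>y\<in>PV (2 * p - Suc k) n. (hE ^^ (p - Suc k)) y = w"
    proof (rule Suc.IH)
      assume k': "Suc k < p"
      show "\<forall>y\<in>PV (Suc k) n. hdot n w y = 0"
      proof
        fix y :: "'p mod_ring hfun" assume y: "y \<in> PV (Suc k) n"
        \<comment> \<open>The test vector is the embedded copy of \<open>y\<close>. Since
          \<open>F u = - w\<close>, pairing with it gives \<open>(k + 1) / k\<close> times the
          pairing of \<open>w\<close> with \<open>y\<close>, an invertible factor for
          \<open>k + 1 < p\<close>. For \<open>k + 1 = p\<close> the induction hypothesis asks for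
          no orthogonality.\<close>
        then have "mk (- scal (inverse (of_nat k)) (hE y)) 0 0 y \<in> PV (Suc j) (Suc n)"
          unfolding J(1)[symmetric] by (intro I) simp_all
        from null[OF this] have "- (inverse (of_nat k) * hdot n u (hE y)) + hdot n w y = 0"
          unfolding hdot_mk scal_minus_left[symmetric] hdot_scal_right by simp
        moreover have "hdot n u (hE y) = - hdot n w y"
          by (metis D(4) hE_adjoint hdot_commute hdot_uminus_left)
        ultimately have "(inverse (of_nat k) + 1) * hdot n w y = 0"
          by (simp add: algebra_simps)
        moreover have "inverse (of_nat k) + 1 = (of_nat (Suc k) * inverse (of_nat k) :: 'p mod_ring)"
          using c by (simp add: algebra_simps)
        moreover have "of_nat (Suc k) \<noteq> (0 :: 'p mod_ring)"
          using of_nat_mod_ring_eq_0[where 'p='p, of "Suc k"] k' assms(1) by blast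
        ultimately show "hdot n w y = 0"
          using c by simp
      qed
    qed (use k D in auto)
    then obtain w' where w': "w' \<in> PV i n" "(hE ^^ (m - 1)) w' = w"
      unfolding J(5) i_def by blast
    show ?thesis
      unfolding x J(2) m_def[symmetric]
      by (rule hE_pow_preimage_mk[OF _ _ _ ci a' b' z'[unfolded z_def] w'])
        (use k assms(1) in \<open>auto simp: m_def\<close>)
  qed
qed


section \<open>Creation and annihilation operators\<close>

definition sg :: "nat \<Rightarrow> nat set \<Rightarrow> 'a::comm_ring_1" where
  "sg s S = (- 1) ^ card {t \<in> S. t < s}"

text \<open>Left exterior multiplication by \<open>e_s\<close>; \<open>an\<close> is its adjoint
  contraction. Sign computations are carried out through the anticommutation relations of the
  two.\<close>

definition cr :: "nat \<Rightarrow> 'a::comm_ring_1 ext \<Rightarrow> 'a ext" where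
  "cr s x = (\<lambda>S. if s \<in> S then sg s S * x (S - {s}) else 0)"

definition an :: "nat \<Rightarrow> 'a::comm_ring_1 ext \<Rightarrow> 'a ext" where
  "an s x = (\<lambda>S. if s \<in> S then 0 else sg s S * x (insert s S))"

lemma sg_insert: "t \<notin> S \<Longrightarrow> sg s (insert t S) = (if t < s then - sg s S else sg s S)"
proof -
  assume t: "t \<notin> S"
  have "{r \<in> insert t S. r < s} = (if t < s then insert t {r \<in> S. r < s} else {r \<in> S. r < s})"
    by auto
  moreover have "finite {r \<in> S. r < s}"
    by (rule finite_subset[of _ "{..<s}"]) auto
  ultimately show ?thesis
    using t by (auto simp: sg_def)
qed

lemma sg_remove:
  "t \<in> S \<Longrightarrow> sg s (S - {t}) = (if t < s then - sg s S else sg s S :: 'a::comm_ring_1)"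
  using sg_insert[where 'a='a, of t "S - {t}" s] by (auto simp: insert_absorb split: if_splits)

lemma sg_mult_self: "sg s S * sg s S = 1"
  by (simp add: sg_def flip: power_add)

lemma sg_mult_self_left: "sg s S * (sg s S * x) = x"
  by (simp add: sg_mult_self flip: mult.assoc)

lemma linop_cr: "linop (cr s)"
  by (rule linopI) (auto simp: cr_def fun_apply algebra_simps)

lemma linop_an: "linop (an s)"
  by (rule linopI) (auto simp: an_def fun_apply algebra_simps)

lemmas lin_cr = linop_simps[OF linop_cr]
lemmas lin_an = linop_simps[OF linop_an]

lemma cr_same: "cr s (cr s x) = 0"
  by (auto simp: cr_def fun_eq_iff fun_apply)

lemma cr_anticommute: "cr s (cr t x) = - cr t (cr s x)"
proof (cases "s = t")
  case False
  have "S - {s} - {t} = S - {t} - {s}" for S :: "nat set"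
    by auto
  with False show ?thesis
    by (auto simp: cr_def fun_eq_iff fun_apply sg_remove)
qed (simp add: cr_same)

lemma an_cr: "an s (cr t x) = (if s = t then x else 0) - cr t (an s x)"
proof (cases "s = t")
  case True
  have "insert s (S - {s}) = S" if "s \<in> S" for S :: "nat set"
    using that by auto
  with True show ?thesis
    by (auto simp: cr_def an_def fun_eq_iff fun_apply sg_remove sg_insert sg_mult_self_left)
next
  case False
  then have "insert s S - {t} = insert s (S - {t})" for S :: "nat set"
    by auto
  with False show ?thesis
    by (auto simp: cr_def an_def fun_eq_iff fun_apply sg_remove sg_insert)
qed

lemma red_cr: "red (cr s x) = cr s (red x)"
  by (auto simp: cr_def fun_eq_iff fun_apply sg_def)

lemma ext_space_add: "x \<in> ext_space g \<Longrightarrow> y \<in> ext_space g \<Longrightarrow> x + y \<in> ext_space g"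
  and ext_space_scal: "x \<in> ext_space g \<Longrightarrow> scal c x \<in> ext_space g"
  and ext_space_zero: "0 \<in> ext_space g"
  by (auto simp: ext_space_def fun_apply)

lemma ext_space_uminus: "x \<in> ext_space g \<Longrightarrow> - x \<in> ext_space g"
  by (auto simp: ext_space_def fun_apply)

lemma ext_space_sum: "(\<And>i. i \<in> I \<Longrightarrow> f i \<in> ext_space g) \<Longrightarrow> (\<Sum>i\<in>I. f i) \<in> ext_space g"
  by (induction I rule: infinite_finite_induct) (auto intro: ext_space_add ext_space_zero)

lemma ext_space_cr:
  assumes "x \<in> ext_space g" "s < 2 * g"
  shows "cr s x \<in> ext_space g"
proof -
  have "\<not> S - {s} \<subseteq> {..<2 * g}" if "\<not> S \<subseteq> {..<2 * g}" for S
    using that assms(2) by auto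
  then show ?thesis
    using assms(1) by (simp add: ext_space_def cr_def)
qed

lemma ext_space_an: "x \<in> ext_space g \<Longrightarrow> an s x \<in> ext_space g"
  by (simp add: ext_space_def an_def)

lemma ext_space_vac: "ext_basis {} \<in> ext_space g"
  by (auto simp: ext_space_def ext_basis_def)

lemma an_vac: "an s (ext_basis {}) = 0"
  by (auto simp: an_def ext_basis_def fun_eq_iff fun_apply)

lemma ext_inner_add_left: "ext_inner g (x + y) z = ext_inner g x z + ext_inner g y z"
  and ext_inner_add_right: "ext_inner g z (x + y) = ext_inner g z x + ext_inner g z y"
  and ext_inner_scal_left: "ext_inner g (scal c x) z = c * ext_inner g x z"
  and ext_inner_scal_right: "ext_inner g z (scal c x) = c * ext_inner g z x"
  by (simp_all add: ext_inner_def fun_apply algebra_simps sum.distrib sum_distrib_left)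

lemma ext_inner_zero: "ext_inner g 0 x = 0" "ext_inner g x 0 = 0"
  by (simp_all add: ext_inner_def fun_apply)

lemma ext_inner_uminus: "ext_inner g (- x) y = - ext_inner g x y" "ext_inner g x (- y) = - ext_inner g x y"
  by (simp_all add: ext_inner_def fun_apply sum_negf)

lemma ext_inner_diff: "ext_inner g (x - y) z = ext_inner g x z - ext_inner g y z"
  "ext_inner g z (x - y) = ext_inner g z x - ext_inner g z y"
  by (simp_all add: ext_inner_def fun_apply sum_subtractf algebra_simps)

lemma ext_inner_sum_left: "ext_inner g (\<Sum>i\<in>I. f i) y = (\<Sum>i\<in>I. ext_inner g (f i) y)"
  by (induction I rule: infinite_finite_induct) (auto simp: ext_inner_zero ext_inner_add_left)

lemma ext_inner_sum_right: "ext_inner g y (\<Sum>i\<in>I. f i) = (\<Sum>i\<in>I. ext_inner g y (f i))"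
  by (induction I rule: infinite_finite_induct) (auto simp: ext_inner_zero ext_inner_add_right)

lemmas ext_inner_simps = ext_inner_add_left ext_inner_add_right ext_inner_scal_left
  ext_inner_scal_right ext_inner_zero ext_inner_uminus ext_inner_diff ext_inner_sum_left
  ext_inner_sum_right

lemma ext_inner_commute: "ext_inner g x y = ext_inner g y x"
  by (simp add: ext_inner_def mult.commute)

lemma cr_adjoint:
  assumes "s < 2 * g"
  shows "ext_inner g (cr s x) y = ext_inner g x (an s y)"
proof -
  let ?P = "Pow {..<2 * g}"
  have "ext_inner g (cr s x) y = (\<Sum>S\<in>{S\<in>?P. s \<in> S}. sg s S * x (S - {s}) * y S)"
    unfolding ext_inner_def cr_def by (rule sum.mono_neutral_cong_right) auto
  also have "\<dots> = (\<Sum>S\<in>{S\<in>?P. s \<notin> S}. x S * (sg s S * y (insert s S)))"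
  proof (rule sum.reindex_bij_witness[of _ "insert s" "\<lambda>S. S - {s}"])
    fix S assume S: "S \<in> {S\<in>?P. s \<in> S}"
    then have "insert s (S - {s}) = S" by auto
    with S show "x (S - {s}) * (sg s (S - {s}) * y (insert s (S - {s}))) = sg s S * x (S - {s}) * y S"
      by (simp add: sg_remove mult_ac)
  qed (use assms in auto)
  also have "\<dots> = ext_inner g x (an s y)"
    unfolding ext_inner_def an_def by (rule sum.mono_neutral_cong_left) auto
  finally show ?thesis .
qed

lemma cr_adjoint_right: "s < 2 * g \<Longrightarrow> ext_inner g x (cr s y) = ext_inner g (an s x) y"
  by (simp add: cr_adjoint ext_inner_commute[of g x] ext_inner_commute[of g "an s x"])

lemma ext_inner_basis: "S \<subseteq> {..<2 * g} \<Longrightarrow> ext_inner g x (ext_basis S) = x S"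
proof -
  assume S: "S \<subseteq> {..<2 * g}"
  have "ext_inner g x (ext_basis S) = (\<Sum>T\<in>Pow {..<2 * g}. if S = T then x T else 0)"
    unfolding ext_inner_def by (rule sum.cong) (auto simp: ext_basis_def)
  also have "\<dots> = x S"
    using S by simp
  finally show ?thesis .
qed

lemma ext_basis_in_space: "S \<subseteq> {..<2 * g} \<Longrightarrow> ext_basis S \<in> ext_space g"
  by (auto simp: ext_space_def ext_basis_def)

lemma ext_space_eqI:
  assumes "x \<in> ext_space g" "y \<in> ext_space g"
    and "\<And>z. z \<in> ext_space g \<Longrightarrow> ext_inner g x z = ext_inner g y z"
  shows "x = y"
proof
  fix S
  show "x S = y S"
  proof (cases "S \<subseteq> {..<2 * g}")
    case True
    then show ?thesis
      using assms(3)[OF ext_basis_in_space[OF True]] by (simp add: ext_inner_basis)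
  next
    case False
    then show ?thesis
      using assms(1,2) by (auto simp: ext_space_def)
  qed
qed

lemma cr_ext_basis: "s \<notin> S \<Longrightarrow> cr s (ext_basis S) = scal (sg s S) (ext_basis (insert s S))"
proof
  fix T assume s: "s \<notin> S"
  have "s \<in> T \<and> T - {s} = S \<longleftrightarrow> T = insert s S"
    using s by auto
  then show "cr s (ext_basis S) T = scal (sg s S) (ext_basis (insert s S)) T"
    using s by (auto simp: cr_def ext_basis_def fun_apply sg_insert)
qed

lemma ext_space_expand:
  "x \<in> ext_space g \<Longrightarrow> x = (\<Sum>S\<in>Pow {..<2 * g}. scal (x S) (ext_basis S))"
proof
  fix T assume x: "x \<in> ext_space g"
  have "(\<Sum>S\<in>Pow {..<2 * g}. scal (x S) (ext_basis S)) T =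
      (\<Sum>S\<in>Pow {..<2 * g}. if T = S then x S else 0)"
    unfolding sum_fun_apply by (rule sum.cong) (auto simp: ext_basis_def fun_apply)
  also have "\<dots> = x T"
    using x by (auto simp: ext_space_def)
  finally show "x T = (\<Sum>S\<in>Pow {..<2 * g}. scal (x S) (ext_basis S)) T" ..
qed

text \<open>The exterior algebra is generated from 1 by creation operators, so an identity between
  linear maps reduces to how both sides pass one creation operator.\<close>

lemma ext_space_induct [consumes 1, case_names vac add scal cr]:
  fixes x :: "'a::comm_ring_1 ext"
  assumes "x \<in> ext_space g"
    and vac: "P (ext_basis {})"
    and add: "\<And>x y. x \<in> ext_space g \<Longrightarrow> y \<in> ext_space g \<Longrightarrow> P x \<Longrightarrow> P y \<Longrightarrow> P (x + y)"
    and scal: "\<And>c x. x \<in> ext_space g \<Longrightarrow> P x \<Longrightarrow> P (scal c x)"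
    and cr: "\<And>s x. s < 2 * g \<Longrightarrow> x \<in> ext_space g \<Longrightarrow> P x \<Longrightarrow> P (cr s x)"
  shows "P x"
proof -
  have basis: "P (ext_basis S)" if "S \<subseteq> {..<2 * g}" for S
  proof -
    have "finite S"
      using that finite_subset by auto
    then show ?thesis
      using that
    proof (induction S rule: finite_induct)
      case (insert s S)
      have "scal (sg s S) (cr s (ext_basis S)) = (ext_basis (insert s S) :: 'a ext)"
        unfolding cr_ext_basis[OF insert.hyps(2)] scal_simps(4) sg_mult_self scal_simps(3) ..
      moreover have "P (scal (sg s S) (cr s (ext_basis S)))"
        using insert by (intro scal cr ext_space_cr ext_basis_in_space) auto
      ultimately show ?case by simp
    qed (rule vac)
  qed
  have "P 0"
    using scal[OF ext_space_vac vac, of 0] by simp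
  then have "P (\<Sum>S\<in>A. scal (x S) (ext_basis S))" if "A \<subseteq> Pow {..<2 * g}" for A
    using that
  proof (induction A rule: infinite_finite_induct)
    case (insert S A)
    then have "P (scal (x S) (ext_basis S) + (\<Sum>S\<in>A. scal (x S) (ext_basis S)))"
      by (intro add scal ext_space_scal ext_space_sum ext_basis_in_space basis) auto
    then show ?case
      using insert.hyps by simp
  qed simp_all
  from this[of "Pow {..<2 * g}"] show ?thesis
    using ext_space_expand[OF assms(1)] by simp
qed


subsection \<open>The raising operator as a quadratic expression\<close>

text \<open>The shuffle counts the elements of the rest that are larger than \<open>s\<close> or
  \<open>t\<close>, the creation operators those that are smaller. For each of \<open>s\<close> and
  \<open>t\<close> the two counts add up to the cardinality of the rest, which occurs twice and
  drops out modulo 2.\<close>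

lemma shuffle_sign_pair:
  assumes "finite S" "s \<in> S" "t \<in> S" "s < t"
  shows "shuffle_sign (S - {s, t}) {s, t} = sg s S * (sg t (S - {s}) :: 'a::comm_ring_1)"
proof -
  define T where "T = S - {s, t}"
  have fin: "finite T" and S: "S = insert s (insert t T)" "s \<notin> T" "t \<notin> T"
    using assms by (auto simp: T_def)
  have part: "card {r \<in> T. r < v} + card {r \<in> T. v < r} = card T" if "v \<notin> T" for v
  proof -
    have "card ({r \<in> T. r < v} \<union> {r \<in> T. v < r}) = card {r \<in> T. r < v} + card {r \<in> T. v < r}"
      using fin by (intro card_Un_disjoint) auto
    moreover have "{r \<in> T. r < v} \<union> {r \<in> T. v < r} = T - {v}"
      by auto
    moreover have "T - {v} = T"
      using that by simp
    ultimately show ?thesis by simp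
  qed
  have "{(r, u). r \<in> T \<and> u \<in> {s, t} \<and> u < r} =
      (\<lambda>r. (r, s)) ` {r \<in> T. s < r} \<union> (\<lambda>r. (r, t)) ` {r \<in> T. t < r}"
    by auto
  also have "card \<dots> = card {r \<in> T. s < r} + card {r \<in> T. t < r}"
    using fin assms(4) by (subst card_Un_disjoint) (auto simp: card_image inj_on_def)
  finally have 1: "shuffle_sign T {s, t} = (- 1 :: 'a) ^ (card {r \<in> T. s < r} + card {r \<in> T. t < r})"
    by (simp add: shuffle_sign_def)
  have 2: "sg s S = (sg s T :: 'a)" "sg t (S - {s}) = (sg t T :: 'a)"
    using S assms(4) by (auto simp: sg_insert sg_remove)
  have 3: "(- 1 :: 'a) ^ (card {r \<in> T. v < r}) = (- 1) ^ card T * sg v T" if "v \<notin> T" for v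
  proof -
    have "(- 1) ^ card T * sg v T = (- 1 :: 'a) ^ (card {r \<in> T. v < r}) * (sg v T * sg v T)"
      by (simp add: sg_def power_add mult_ac flip: part[OF that])
    then show ?thesis
      by (simp add: sg_mult_self)
  qed
  have "(- 1 :: 'a) ^ card T * (- 1) ^ card T = 1"
    by (simp flip: power_add)
  then show ?thesis
    using 1 3[OF S(2)] 3[OF S(3)]
    by (simp add: 2 power_add T_def mult_ac)
qed

lemma omega_apply: "omega g U = (\<Sum>i<g. if U = {i, g + i} then 1 else 0 :: 'a::comm_ring_1)"
  unfolding omega_def
proof (rule sum.cong)
  fix i assume "i \<in> {..<g}"
  then have "{(t, u). t \<in> {i} \<and> u \<in> {g + i} \<and> u < t} = {}" by auto
  then have "shuffle_sign {i} {g + i} = (1 :: 'a)"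
    unfolding shuffle_sign_def by (simp only: card.empty power_0)
  moreover have "{i} \<inter> {g + i} = {}" "{i} \<union> {g + i} = {i, g + i}"
    using \<open>i \<in> {..<g}\<close> by auto
  ultimately have "wedge (ext_basis {i}) (ext_basis {g + i}) = (\<lambda>U. 1 * ext_basis {i, g + i} U :: 'a)"
    using wedge_ext_basis[of "{i}" "{g + i}", where 'a='a]
    by (simp only: finite.emptyI finite.insertI if_True simp_thms)
  then show "wedge (ext_basis {i}) (ext_basis {g + i}) U = (if U = {i, g + i} then 1 else 0 :: 'a)"
    by (simp add: ext_basis_def)
qed simp

definition pair :: "nat \<Rightarrow> nat \<Rightarrow> 'a::comm_ring_1 ext \<Rightarrow> 'a ext" where
  "pair g i x = cr i (cr (g + i) x)"

lemma linop_pair: "linop (pair g i)"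
  unfolding pair_def by (rule linop_comp[OF linop_cr linop_cr])

text \<open>\<open>E_op\<close> multiplies from the right, creation operators from the left; the
  orders agree because omega has even degree.\<close>

lemma E_op_eq_cr:
  assumes "x \<in> ext_space g"
  shows "E_op g x = (\<Sum>i<g. pair g i x)"
proof
  fix S
  have 1: "pair g i x S = (\<Sum>T\<in>Pow S. shuffle_sign T (S - T) * x T * (if S - T = {i, g + i} then 1 else 0))"
    if i: "i < g" for i
  proof (cases "finite S")
    case True
    have "(\<Sum>T\<in>Pow S. shuffle_sign T (S - T) * x T * (if S - T = {i, g + i} then 1 else 0))
        = (\<Sum>T\<in>Pow S. if S - {i, g + i} = T then
            (if {i, g + i} \<subseteq> S then shuffle_sign T {i, g + i} * x T else 0) else 0)"
    proof (rule sum.cong)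
      fix T assume "T \<in> Pow S"
      then have "S - T = {i, g + i} \<longleftrightarrow> S - {i, g + i} = T \<and> {i, g + i} \<subseteq> S"
        using double_diff[of T S S] double_diff[of "{i, g + i}" S S] by (metis Diff_subset PowD subset_refl)
      then show "shuffle_sign T (S - T) * x T * (if S - T = {i, g + i} then 1 else 0) =
          (if S - {i, g + i} = T then
            (if {i, g + i} \<subseteq> S then shuffle_sign T {i, g + i} * x T else 0) else 0)"
        by auto
    qed simp
    also have "\<dots> = (if {i, g + i} \<subseteq> S then shuffle_sign (S - {i, g + i}) {i, g + i} * x (S - {i, g + i}) else 0)"
      using True by (simp add: sum.delta')
    also have "\<dots> = pair g i x S"
    proof (cases "{i, g + i} \<subseteq> S")
      case True
      have "S - {i} - {g + i} = S - {i, g + i}" by auto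
      then show ?thesis
        using shuffle_sign_pair[OF \<open>finite S\<close>, where 'a='a, of i "g + i"] True i
        by (auto simp: pair_def cr_def mult_ac)
    qed (auto simp: pair_def cr_def)
    finally show ?thesis ..
  next
    case False
    \<comment> \<open>For infinite \<open>S\<close> the sum over \<open>Pow S\<close> is 0 by
      convention, and the support of \<open>x\<close> has to produce the same value.\<close>
    then have "\<not> S - {i} - {g + i} \<subseteq> {..<2 * g}"
      using finite_subset[of "S - {i} - {g + i}" "{..<2 * g}"] by auto
    then have "x (S - {i} - {g + i}) = 0"
      using assms by (simp add: ext_space_def)
    with False show ?thesis by (simp add: pair_def cr_def)
  qed
  have "E_op g x S = (\<Sum>T\<in>Pow S. \<Sum>i<g. shuffle_sign T (S - T) * x T * (if S - T = {i, g + i} then 1 else 0))"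
    unfolding E_op_def wedge_def omega_apply sum_distrib_left ..
  also have "\<dots> = (\<Sum>i<g. \<Sum>T\<in>Pow S. shuffle_sign T (S - T) * x T * (if S - T = {i, g + i} then 1 else 0))"
    by (rule sum.swap)
  also have "\<dots> = (\<Sum>i<g. pair g i x S)"
    by (rule sum.cong) (simp_all add: 1)
  finally show "E_op g x S = (\<Sum>i<g. pair g i x) S"
    by (simp add: sum_fun_apply)
qed


section \<open>Comparison with the handle model\<close>

text \<open>\<open>n\<close> counts the handles already in use while \<open>g\<close> stays fixed,
  so that the class b of handle \<open>n\<close> keeps its index \<open>g + n\<close> throughout an
  induction on \<open>n\<close>. The head of a word supplies the outermost creation
  operators.\<close>

primrec Phi :: "nat \<Rightarrow> nat \<Rightarrow> 'a::comm_ring_1 hfun \<Rightarrow> 'a ext" where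
  "Phi g 0 x = scal (x []) (ext_basis {})"
| "Phi g (Suc n) x = Phi g n (slice H0 x) + cr n (Phi g n (slice Ha x))
     + cr (g + n) (Phi g n (slice Hb x)) + pair g n (Phi g n (slice Hab x))"

lemma linop_Phi: "linop (Phi g n :: 'a::comm_ring_1 hfun \<Rightarrow> _)"
proof (induction n)
  case 0
  show ?case
    by (rule linopI) (auto simp: fun_apply algebra_simps)
next
  case (Suc n)
  have "linop (\<lambda>x :: 'a hfun. Phi g n (slice H0 x) + cr n (Phi g n (slice Ha x))
     + cr (g + n) (Phi g n (slice Hb x)) + pair g n (Phi g n (slice Hab x)))"
    by (intro linop_plus linop_comp[OF linop_cr] linop_comp[OF linop_pair]
        linop_comp[OF Suc linop_slice])
  then show ?case by simp
qed

lemmas lin_Phi = linop_simps[OF linop_Phi]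
lemmas lin_pair = linop_simps[OF linop_pair]

lemma red_Phi: "red (Phi g n x) = (Phi g n (red x) :: 'a::comm_ring_1 ext)"
proof (induction n arbitrary: x)
  case 0
  show ?case by (auto simp: fun_eq_iff fun_apply ext_basis_def)
next
  case (Suc n)
  have "red (Phi g n (slice c x)) = (Phi g n (slice c (red x)) :: 'a ext)" for c
  proof -
    have "red (slice c x) = (slice c (red x) :: 'a hfun)"
      by (simp add: fun_eq_iff fun_apply)
    then show ?thesis by (simp only: Suc)
  qed
  then show ?case
    by (simp add: red_simps red_cr pair_def)
qed

lemma ext_space_Phi: "n \<le> g \<Longrightarrow> Phi g n x \<in> ext_space g"
proof (induction n arbitrary: x)
  case (Suc n)
  then have "Phi g n (slice c x) \<in> ext_space g" for c by simp
  with Suc.prems show ?case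
    by (auto simp: pair_def intro!: ext_space_add ext_space_cr)
qed (auto intro: ext_space_scal ext_space_vac)

lemma an_Phi:
  "n \<le> g \<Longrightarrow> n \<le> s \<and> s < g \<or> g + n \<le> s \<Longrightarrow> an s (Phi g n x) = 0"
proof (induction n arbitrary: x)
  case (Suc n)
  then have "an s (Phi g n (slice c x)) = 0" for c by auto
  moreover have "s \<noteq> n" "s \<noteq> g + n"
    using Suc.prems by auto
  ultimately show ?case
    by (simp add: pair_def lin_an an_cr lin_cr)
qed (simp add: lin_an an_vac)

lemma ext_inner_Phi: "n \<le> g \<Longrightarrow> ext_inner g (Phi g n x) (Phi g n y) = hdot n x y"
proof (induction n arbitrary: x y)
  case 0
  have "ext_inner g (ext_basis {}) (ext_basis {}) = (1 :: 'a)"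
    by (subst ext_inner_basis) (simp_all add: ext_basis_def)
  then show ?case by (simp add: ext_inner_simps)
next
  case (Suc n)
  have IH: "ext_inner g (Phi g n (slice c x)) (Phi g n (slice d y)) = hdot n (slice c x) (slice d y)" for c d
    using Suc by simp
  have 0: "an n (Phi g n z) = 0" "an (g + n) (Phi g n z) = 0" for z :: "'a hfun"
    using Suc.prems by (simp_all add: an_Phi)
  have adj: "ext_inner g (cr n z) y = ext_inner g z (an n y)"
    "ext_inner g (cr (g + n) z) y = ext_inner g z (an (g + n) y)"
    "ext_inner g z (cr n y) = ext_inner g (an n z) y"
    "ext_inner g z (cr (g + n) y) = ext_inner g (an (g + n) z) y" for z y :: "'a ext"
    using Suc.prems by (simp_all add: cr_adjoint cr_adjoint_right)
  have "n \<noteq> g + n" "g + n \<noteq> n"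
    using Suc.prems by auto
  then show ?case
    by (simp add: pair_def ext_inner_simps adj(1,2) an_cr 0 lin_an lin_cr)
       (simp add: adj(3,4) 0 IH ext_inner_simps an_cr lin_cr)
qed

lemma pair_cr: "pair g i (cr s x) = cr s (pair g i x)"
  unfolding pair_def cr_anticommute[of "g + i" s] lin_cr cr_anticommute[of i s] by simp

lemma pair_commute: "pair g i (pair g j x) = pair g j (pair g i x)"
  unfolding pair_def[of g j] pair_cr ..

text \<open>On the first \<open>n\<close> handles \<open>hE\<close> is multiplication by the
  corresponding partial sum of omega, which is all of omega at \<open>n = g\<close>.\<close>

lemma sum_pair_Phi: "n \<le> g \<Longrightarrow> (\<Sum>i<n. pair g i (Phi g n x)) = Phi g n (hE x)"
proof (induction n arbitrary: x)
  case 0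
  then show ?case by simp
next
  case (Suc n)
  define P where "P y = (\<Sum>i<n. pair g i y)" for y :: "'a ext"
  have P: "P (y + z) = P y + P z" "P (cr s y) = cr s (P y)" "P (pair g n y) = pair g n (P y)"
    for y z s
    unfolding P_def
    by (simp_all add: lin_pair sum.distrib pair_cr lin_cr pair_commute[of g _ n])
  have IH: "P (Phi g n y) = Phi g n (hE y)" for y
    unfolding P_def using Suc by simp
  have n: "pair g n (cr n y) = 0" "pair g n (cr (g + n) y) = 0" "pair g n (pair g n y) = 0" for y :: "'a ext"
    by (simp_all add: pair_def cr_same lin_cr cr_anticommute[of "g + n" n])
  have s: "slice c (hE x) = hE (slice c x) + (if c = Hab then slice H0 x else 0)" for c
    by (simp add: fun_eq_iff fun_apply)
  have "(\<Sum>i<Suc n. pair g i (Phi g (Suc n) x)) = P (Phi g (Suc n) x) + pair g n (Phi g (Suc n) x)"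
    by (simp add: P_def)
  also have "\<dots> = Phi g n (hE (slice H0 x)) + cr n (Phi g n (hE (slice Ha x)))
      + cr (g + n) (Phi g n (hE (slice Hb x))) + pair g n (Phi g n (hE (slice Hab x)))
      + pair g n (Phi g n (slice H0 x))"
    unfolding Phi.simps P IH lin_pair n by (simp add: add_ac)
  also have "\<dots> = Phi g (Suc n) (hE x)"
    by (simp add: s lin_Phi lin_pair add_ac)
  finally show ?case .
qed

lemma E_op_Phi: "E_op g (Phi g g x) = Phi g g (hE x)"
  by (simp add: E_op_eq_cr ext_space_Phi sum_pair_Phi)

lemma E_op_pow_Phi: "(E_op g ^^ l) (Phi g g x) = Phi g g ((hE ^^ l) x)"
  by (induction l) (simp_all add: E_op_Phi)

text \<open>The image of \<open>Phi g g\<close> is thereby stable under creation operators. As it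
  contains 1, it is the whole exterior algebra.\<close>

lemma cr_Phi:
  "n \<le> g \<Longrightarrow> s < n \<or> g \<le> s \<and> s < g + n \<Longrightarrow> \<exists>y. cr s (Phi g n x) = Phi g n y"
proof (induction n arbitrary: x)
  case (Suc n)
  let ?u = "slice H0 x" and ?a = "slice Ha x" and ?b = "slice Hb x" and ?w = "slice Hab x"
  consider "s = n" | "s = g + n" | "s < n \<or> g \<le> s \<and> s < g + n"
    using Suc.prems by linarith
  then show ?case
  proof cases
    case 1
    have "cr s (Phi g (Suc n) x) = Phi g (Suc n) (mk 0 ?u 0 ?b)"
      by (simp add: 1 lin_cr lin_Phi lin_pair pair_def cr_same)
    then show ?thesis by blast
  next
    case 2
    have "cr s (Phi g (Suc n) x) = Phi g (Suc n) (mk 0 0 ?u (- ?a))"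
      by (simp add: 2 lin_cr lin_Phi pair_def cr_same cr_anticommute[of "g + n" n])
    then show ?thesis by blast
  next
    case 3
    have "\<exists>y. cr s (Phi g n (slice c x)) = Phi g n y" for c
      using Suc.IH Suc.prems 3 by simp
    then obtain f where f: "cr s (Phi g n (slice c x)) = Phi g n (f c)" for c
      by metis
    have "cr s (Phi g (Suc n) x) = Phi g (Suc n) (mk (f H0) (- f Ha) (- f Hb) (f Hab))"
      by (simp add: lin_cr lin_Phi f cr_anticommute[of s n] cr_anticommute[of s "g + n"]
          pair_cr[symmetric])
    then show ?thesis by blast
  qed
qed auto

lemma Phi_surj:
  assumes "x \<in> ext_space g"
  shows "\<exists>y. x = Phi g g y"
  using assms
proof (induction x rule: ext_space_induct)
  case vac
  have "\<exists>y. (ext_basis {} :: 'a ext) = Phi g n y" for n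
  proof (induction n)
    case 0
    show ?case by (rule exI[of _ "\<lambda>_. 1"]) simp
  next
    case (Suc n)
    then obtain y where "(ext_basis {} :: 'a ext) = Phi g n y" by blast
    then have "(ext_basis {} :: 'a ext) = Phi g (Suc n) (mk y 0 0 0)"
      by (simp add: lin_Phi lin_cr lin_pair)
    then show ?case by blast
  qed
  then show ?case .
next
  case (add x y)
  then show ?case by (metis linop_add[OF linop_Phi])
next
  case (scal c x)
  then show ?case by (metis linop_scal[OF linop_Phi])
next
  case (cr s x)
  then obtain y where y: "x = Phi g g y" by blast
  have "s < g \<or> g \<le> s \<and> s < g + g"
    using cr.hyps by linarith
  from cr_Phi[OF order_refl this] show ?case
    unfolding y by blast
qed

text \<open>Comes from the statement for \<open>E\<close> by adjunction: \<open>Phi g g\<close> is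
  surjective and preserves the inner product, which determines elements of the exterior
  algebra.\<close>

lemma hF_Phi: "F_op g (Phi g g x) = Phi g g (hF x)"
proof (rule ext_space_eqI)
  show "F_op g (Phi g g x) \<in> ext_space g"
    by (simp add: F_op_def ext_space_def)
  show "Phi g g (hF x) \<in> ext_space g"
    by (simp add: ext_space_Phi)
  fix z :: "'a ext" assume z: "z \<in> ext_space g"
  then obtain y where y: "z = Phi g g y"
    using Phi_surj by blast
  have "ext_inner g (F_op g (Phi g g x)) z = hdot g x (hE y)"
    unfolding F_op_adjoint[OF z] unfolding y E_op_Phi by (simp add: ext_inner_Phi)
  also have "\<dots> = hdot g (hF x) y"
    by (metis hE_adjoint hdot_commute)
  also have "\<dots> = ext_inner g (Phi g g (hF x)) z"
    by (simp add: y ext_inner_Phi)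
  finally show "ext_inner g (F_op g (Phi g g x)) z = ext_inner g (Phi g g (hF x)) z" .
qed

section \<open>Basis words, injectivity of the comparison map and degrees\<close>

definition hbasis :: "handle list \<Rightarrow> 'a::comm_ring_1 hfun" where
  "hbasis L = (\<lambda>L'. if L' = L then 1 else 0)"

lemma slice_hbasis: "slice c (hbasis (d # L)) = (if c = d then hbasis L else 0)"
  by (auto simp: hbasis_def fun_eq_iff fun_apply)

lemma hdot_hbasis: "length L = n \<Longrightarrow> hdot n x (hbasis L) = x L"
proof (induction n arbitrary: x L)
  case 0
  then show ?case by (simp add: hbasis_def)
next
  case (Suc n)
  then obtain c L' where L: "L = c # L'" "length L' = n"
    by (metis length_Suc_conv)
  have "hdot n (slice c x) (hbasis L') = slice c x L'"
    using Suc.IH L(2) .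
  then show ?case
    by (cases c) (simp_all add: L(1) slice_hbasis)
qed

lemma Phi_inject:
  assumes "Phi g g x = Phi g g y" "length L = g"
  shows "x L = y L"
  using assms by (metis ext_inner_Phi hdot_hbasis order_refl)

lemma Phi_nonzero:
  "n \<le> g \<Longrightarrow> Phi g n x S \<noteq> 0 \<Longrightarrow> finite S \<and> (\<exists>L. x L \<noteq> 0 \<and> length L = n \<and> hdeg L = card S)"
proof (induction n arbitrary: x S)
  case 0
  then show ?case
    by (intro conjI exI[of _ "[]"]) (auto simp: fun_apply ext_basis_def split: if_splits)
next
  case (Suc n)
  have cr: "s \<in> S \<and> y (S - {s}) \<noteq> 0" if "cr s y S \<noteq> 0" for s S and y :: "'a ext"
    using that by (auto simp: cr_def split: if_splits)
  have single: "finite S \<and> (\<exists>L. x L \<noteq> 0 \<and> length L = Suc n \<and> hdeg L = card S)"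
    if s: "cr s (Phi g n (slice c x)) S \<noteq> 0" "hwt c = 1" for s c
  proof -
    obtain L where L: "finite (S - {s})" "x (c # L) \<noteq> 0" "length L = n" "hdeg L = card (S - {s})"
      using Suc.IH[OF _ conjunct2[OF cr[OF s(1)]]] Suc.prems(1) by auto
    then have "finite S" by simp
    have "hdeg (c # L) = card S"
      using card.remove[OF \<open>finite S\<close> conjunct1[OF cr[OF s(1)]]] L(4)
      by (simp only: hdeg_simps s(2) plus_1_eq_Suc)
    with L(2,3) \<open>finite S\<close> show ?thesis
      by (intro conjI exI[of _ "c # L"]) (simp_all only: length_Cons simp_thms not_False_eq_True)
  qed
  have "\<not> (Phi g n (slice H0 x) S = 0 \<and> cr n (Phi g n (slice Ha x)) S = 0 \<and>
      cr (g + n) (Phi g n (slice Hb x)) S = 0 \<and> cr n (cr (g + n) (Phi g n (slice Hab x))) S = 0)"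
    using Suc.prems(2) by (auto simp: fun_apply pair_def)
  then consider "Phi g n (slice H0 x) S \<noteq> 0" | "cr n (Phi g n (slice Ha x)) S \<noteq> 0"
    | "cr (g + n) (Phi g n (slice Hb x)) S \<noteq> 0" | "cr n (cr (g + n) (Phi g n (slice Hab x))) S \<noteq> 0"
    by blast
  then show ?case
  proof cases
    case 1
    from Suc.IH[OF _ 1] Suc.prems(1) obtain L where
      "finite S" "slice H0 x L \<noteq> 0" "length L = n" "hdeg L = card S" by auto
    then show ?thesis by (intro conjI exI[of _ "H0 # L"]) auto
  next
    case 2
    from single[OF this] show ?thesis by simp
  next
    case 3
    from single[OF this] show ?thesis by simp
  next
    case 4
    note S = cr[OF 4] cr[OF conjunct2[OF cr[OF 4]]]
    from Suc.IH[OF _ conjunct2[OF S(2)]] Suc.prems(1) obtain L where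
      L: "finite (S - {n} - {g + n})" "slice Hab x L \<noteq> 0" "length L = n" "hdeg L = card (S - {n} - {g + n})" by auto
    then have fin: "finite S" "finite (S - {n})" by auto
    have "card S = Suc (card (S - {n}))" "card (S - {n}) = Suc (card (S - {n} - {g + n}))"
      using card.remove[OF fin(1) conjunct1[OF S(1)]] card.remove[OF fin(2) conjunct1[OF S(2)]] .
    with L have "hdeg (Hab # L) = card S"
      by (simp only: hdeg_simps hwt.simps)
    with L fin show ?thesis
      by (intro conjI exI[of _ "Hab # L"]) (simp_all only: slice_apply length_Cons simp_thms)
  qed
qed

lemma Phi_cong:
  "(\<And>L. length L = n \<Longrightarrow> x L = y L) \<Longrightarrow> Phi g n x = Phi g n y"
proof (induction n arbitrary: x y)
  case (Suc n)
  have "Phi g n (slice c x) = Phi g n (slice c y)" for c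
    by (rule Suc.IH) (simp add: Suc.prems)
  then show ?case
    by (simp only: Phi.simps)
qed simp

lemma V_int_eq: "V_int j g = Phi g g ` LV j g"
proof (intro equalityI subsetI)
  fix x assume x: "x \<in> V_int j g"
  show "x \<in> Phi g g ` LV j g"
  proof (cases "j \<le> g + 1")
    case False
    then have "x = 0"
      using x by (simp add: V_int_def zero_fun_def)
    then have "x = Phi g g 0"
      by (simp only: lin_Phi)
    then show ?thesis by (rule image_eqI[OF _ LV_zero])
  next
    case True
    then have *: "x \<in> ext_space g" "\<And>S. x S \<noteq> 0 \<Longrightarrow> card S = g + 1 - j" and F: "F_op g x = (\<lambda>_. 0)"
      using x by (simp_all add: V_int_def ext_deg_def)
    have F0: "F_op g x = 0"
      unfolding F zero_fun_def ..
    obtain y where y: "x = Phi g g y"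
      using Phi_surj[OF *(1)] by blast
    \<comment> \<open>\<open>Phi g g\<close> sees only words of length \<open>g\<close>, while
      \<open>homog\<close> requires all other coordinates to vanish.\<close>
    define z where "z L = (if length L = g then y L else 0)" for L
    have xz: "x = Phi g g z"
      unfolding y by (rule Phi_cong) (simp add: z_def)
    have "homog j g z"
      unfolding homog_def
    proof (intro allI impI)
      fix L assume L: "z L \<noteq> 0"
      then have len: "length L = g" by (auto simp: z_def split: if_splits)
      \<comment> \<open>A coordinate of \<open>z\<close> is read off by pairing with the image of a
        basis word, which is homogeneous of the weight of that word; so the degree of
        \<open>x\<close> bounds the words that occur.\<close>
      have "ext_inner g x (Phi g g (hbasis L)) = z L"
        by (simp add: xz ext_inner_Phi hdot_hbasis len)
      with L have "(\<Sum>S\<in>Pow {..<2 * g}. x S * Phi g g (hbasis L) S) \<noteq> 0"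
        by (simp add: ext_inner_def)
      then obtain S where "x S * Phi g g (hbasis L) S \<noteq> 0"
        by (rule sum.not_neutral_contains_not_neutral)
      then have S: "x S \<noteq> 0" "Phi g g (hbasis L) S \<noteq> (0 :: int)"
        by auto
      from Phi_nonzero[OF order_refl S(2)] obtain L' where
        "hbasis L L' \<noteq> (0 :: int)" "hdeg L' = card S" by blast
      then have "hdeg L = card S"
        by (simp add: hbasis_def split: if_splits)
      with *(2)[OF S(1)] have "hdeg L = g + 1 - j" by simp
      with len True show "length L = g \<and> hdeg L + j = g + 1" by simp
    qed
    moreover have "hF z = 0"
    proof
      fix L
      show "hF z L = 0 L"
      proof (cases "length L = g")
        case True
        have "Phi g g (hF z) = Phi g g 0"
          using F0 by (simp add: xz hF_Phi lin_Phi)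
        then show ?thesis by (rule Phi_inject) (rule True)
      next
        case False
        \<comment> \<open>\<open>hF\<close> preserves the length of words, so nothing appears
          outside length \<open>g\<close>.\<close>
        have "hF z L = 0" if "\<And>L'. length L' = length L \<Longrightarrow> z L' = 0" for z :: "int hfun"
          using that
        proof (induction L arbitrary: z)
          case (Cons c L)
          have "hF (slice c z) L = 0"
            by (rule Cons.IH) (simp add: Cons.prems)
          then show ?case by (simp add: Cons.prems)
        qed simp
        with False show ?thesis by (simp add: z_def zero_fun_apply)
      qed
    qed
    ultimately show ?thesis
      using xz by (auto simp: LV_def)
  qed
next
  fix x assume "x \<in> Phi g g ` LV j g"
  then obtain y where y: "x = Phi g g y" "homog j g y" "hF y = 0"
    by (auto simp: LV_def)
  have deg: "card S + j = g + 1" if S: "x S \<noteq> 0" for S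
  proof -
    obtain L where "y L \<noteq> 0" "hdeg L = card S"
      using Phi_nonzero[OF order_refl S[unfolded y(1)]] by blast
    with y(2) show ?thesis unfolding homog_def by metis
  qed
  have "F_op g x = 0"
    unfolding y(1) hF_Phi y(3) lin_Phi ..
  then have "F_op g x = (\<lambda>_. 0)"
    by (simp only: zero_fun_def)
  moreover have "x \<in> ext_space g"
    by (simp add: y ext_space_Phi)
  moreover have "x = (\<lambda>_. 0)" if "\<not> j \<le> g + 1"
  proof
    show "x S = 0" for S
      using deg[of S] that by (cases "x S = 0") auto
  qed
  moreover have "card S = g + 1 - j" if "x S \<noteq> 0" for S
    using deg[OF that] by simp
  ultimately show "x \<in> V_int j g"
    unfolding V_int_def ext_deg_def by (cases "j \<le> g + 1") simp_all
qed

lemma carrier_V_mod: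
  fixes P :: "'p::prime_card itself"
  shows "carrier (V_mod P j g) = Phi g g ` PV j g"
proof -
  have "reduce x = (red x :: 'p mod_ring ext)" for x
    by (simp add: reduce_def red_def)
  then show ?thesis
    by (simp add: V_mod_def V_int_eq PV_def image_image red_Phi)
qed


section \<open>The induced action on the exterior algebra\<close>

definition crv :: "nat \<Rightarrow> (nat \<Rightarrow> 'a) \<Rightarrow> 'a::comm_ring_1 ext \<Rightarrow> 'a ext" where
  "crv N v x = (\<Sum>i<N. scal (v i) (cr i x))"

definition anv :: "nat \<Rightarrow> (nat \<Rightarrow> 'a) \<Rightarrow> 'a::comm_ring_1 ext \<Rightarrow> 'a ext" where
  "anv N v x = (\<Sum>i<N. scal (v i) (an i x))"

lemma linop_crv: "linop (crv N v)"
  unfolding linop_def crv_def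
  by (auto simp: lin_cr scal_add sum.distrib fun_eq_iff sum_fun_apply fun_apply sum_distrib_left mult_ac)

lemma linop_anv: "linop (anv N v)"
  unfolding linop_def anv_def
  by (auto simp: lin_an scal_add sum.distrib fun_eq_iff sum_fun_apply fun_apply sum_distrib_left mult_ac)

lemmas lin_crv = linop_simps[OF linop_crv]
lemmas lin_anv = linop_simps[OF linop_anv]

lemma scal_sum: "scal c (\<Sum>i\<in>I. f i) = (\<Sum>i\<in>I. scal c (f i))"
  by (simp add: fun_eq_iff sum_fun_apply fun_apply sum_distrib_left)

lemma scal_sum_left: "scal (\<Sum>i\<in>I. f i) x = (\<Sum>i\<in>I. scal (f i) x)"
  by (simp add: fun_eq_iff sum_fun_apply fun_apply sum_distrib_right)

lemma cr_crv_anticommute: "cr i (crv N v x) = - crv N v (cr i x)"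
  unfolding crv_def lin_cr cr_anticommute[of i] scal_uminus sum_negf ..

lemma crv_anticommute: "crv N u (crv N v x) = - crv N v (crv N u x)"
proof -
  have "crv N u (crv N v x) = - (\<Sum>i<N. scal (u i) (crv N v (cr i x)))"
    unfolding crv_def[of N u] cr_crv_anticommute scal_uminus sum_negf ..
  also have "\<dots> = - crv N v (crv N u x)"
    unfolding crv_def[of N u] lin_crv ..
  finally show ?thesis .
qed

lemma crv_same: "crv N v (crv N v x) = 0"
proof (induction N)
  case (Suc N)
  have "crv (Suc N) v y = crv N v y + scal (v N) (cr N y)" for y
    by (simp add: crv_def)
  then show ?case
    by (simp add: lin_crv lin_cr Suc cr_crv_anticommute cr_same scal_uminus)
qed (simp add: crv_def)

lemma an_crv: "i < N \<Longrightarrow> an i (crv N v x) = scal (v i) x - crv N v (an i x)"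
proof -
  assume i: "i < N"
  have "an i (crv N v x) = (\<Sum>j<N. scal (v j) ((if i = j then x else 0) - cr j (an i x)))"
    unfolding crv_def lin_an an_cr ..
  also have "\<dots> = (\<Sum>j<N. scal (v j) (if i = j then x else 0)) - crv N v (an i x)"
    unfolding crv_def scal_diff sum_subtractf ..
  also have "(\<Sum>j<N. scal (v j) (if i = j then x else 0)) = (\<Sum>j<N. if i = j then scal (v j) x else 0)"
    by (rule sum.cong) simp_all
  also have "\<dots> = scal (v i) x"
    using i by simp
  finally show ?thesis .
qed

lemma anv_crv: "anv N w (crv N v x) = scal (\<Sum>i<N. w i * v i) x - crv N v (anv N w x)"
proof -
  have "anv N w (crv N v x) = (\<Sum>i<N. scal (w i) (scal (v i) x - crv N v (an i x)))"
    unfolding anv_def by (rule sum.cong) (simp_all add: an_crv)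
  also have "\<dots> = scal (\<Sum>i<N. w i * v i) x - (\<Sum>i<N. scal (w i) (crv N v (an i x)))"
    unfolding scal_diff sum_subtractf scal_simps(4) scal_sum_left ..
  also have "(\<Sum>i<N. scal (w i) (crv N v (an i x))) = crv N v (anv N w x)"
    unfolding anv_def lin_crv ..
  finally show ?thesis .
qed

lemma ext_space_crv: "x \<in> ext_space g \<Longrightarrow> crv (2 * g) v x \<in> ext_space g"
  unfolding crv_def by (intro ext_space_sum ext_space_scal ext_space_cr) auto

lemma ext_space_anv: "x \<in> ext_space g \<Longrightarrow> anv (2 * g) v x \<in> ext_space g"
  unfolding anv_def by (intro ext_space_sum ext_space_scal ext_space_an) auto

lemma anv_vac: "anv N v (ext_basis {}) = 0"
  by (simp add: anv_def an_vac)

definition mcol :: "int mat \<Rightarrow> nat \<Rightarrow> nat \<Rightarrow> 'a::comm_ring_1" where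
  "mcol A j = (\<lambda>i. of_int (A $$ (i, j)))"

lemma wedge_homology_image:
  assumes "x \<in> ext_space g"
  shows "wedge (homology_image g A j) x = (crv (2 * g) (mcol A j) x :: 'a::comm_ring_1 ext)"
proof
  fix S
  show "wedge (homology_image g A j) x S = crv (2 * g) (mcol A j) x S"
  proof (cases "finite S")
    case False
    have "cr i x S = 0" for i
    proof -
      have "\<not> S - {i} \<subseteq> {..<2 * g}"
        using False finite_subset[of "S - {i}" "{..<2 * g}"] by auto
      then show ?thesis
        using assms by (simp add: cr_def ext_space_def)
    qed
    then have "crv (2 * g) (mcol A j) x S = 0"
      by (simp add: crv_def sum_fun_apply fun_apply)
    with False show ?thesis by (simp add: wedge_def)
  next
    case True
    have sh: "shuffle_sign {i} (S - {i}) = (sg i S :: 'a)" for i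
    proof -
      have "{(t, u). t \<in> {i} \<and> u \<in> S - {i} \<and> u < t} = Pair i ` {t \<in> S. t < i}" by auto
      then show ?thesis
        unfolding shuffle_sign_def sg_def by (simp add: card_image inj_on_def)
    qed
    have "wedge (homology_image g A j) x S =
        (\<Sum>T\<in>Pow S. \<Sum>i<2 * g. of_int (A $$ (i, j)) *
          (if {i} = T then shuffle_sign T (S - T) * x (S - T) else 0))"
      unfolding wedge_def homology_image_def sum_distrib_left sum_distrib_right
      by (intro sum.cong refl) (auto simp: ext_basis_def)
    also have "\<dots> = (\<Sum>i<2 * g. \<Sum>T\<in>Pow S. of_int (A $$ (i, j)) *
          (if {i} = T then shuffle_sign T (S - T) * x (S - T) else 0))"
      by (rule sum.swap)
    also have "\<dots> = (\<Sum>i<2 * g. of_int (A $$ (i, j)) *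
          (\<Sum>T\<in>Pow S. if {i} = T then shuffle_sign T (S - T) * x (S - T) else 0))"
      unfolding sum_distrib_left ..
    also have "\<dots> = (\<Sum>i<2 * g. of_int (A $$ (i, j)) * cr i x S)"
      using True by (intro sum.cong refl) (simp add: sum.delta' cr_def sh)
    also have "\<dots> = crv (2 * g) (mcol A j) x S"
      by (simp add: crv_def sum_fun_apply fun_apply mcol_def)
    finally show ?thesis .
  qed
qed

definition wedge_cols :: "nat \<Rightarrow> int mat \<Rightarrow> nat list \<Rightarrow> 'a::comm_ring_1 ext" where
  "wedge_cols g A L = foldr (\<lambda>j. crv (2 * g) (mcol A j)) L (ext_basis {})"

lemma wedge_cols_simps [simp]:
  "wedge_cols g A [] = ext_basis {}"
  "wedge_cols g A (j # L) = crv (2 * g) (mcol A j) (wedge_cols g A L)"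
  by (simp_all add: wedge_cols_def)

lemma ext_space_wedge_cols: "wedge_cols g A L \<in> ext_space g"
  by (induction L) (auto intro: ext_space_vac ext_space_crv)

lemma foldr_wedge_eq: "foldr wedge (map (homology_image g A) L) (ext_basis {}) = wedge_cols g A L"
  by (induction L) (simp_all add: wedge_homology_image ext_space_wedge_cols)

lemma ext_act_eq:
  "ext_act g A x = (\<Sum>S\<in>Pow {..<2 * g}. scal (x S) (wedge_cols g A (sorted_list_of_set S)))"
  unfolding ext_act_def foldr_wedge_eq by (simp add: fun_eq_iff sum_fun_apply fun_apply)

lemma linop_ext_act: "linop (ext_act g A)"
  by (rule linopI)
    (simp_all add: ext_act_eq sum_fun_apply fun_apply algebra_simps sum.distrib sum_distrib_left)

lemmas lin_ext_act = linop_simps[OF linop_ext_act]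

lemma ext_act_ext_basis:
  assumes "S \<subseteq> {..<2 * g}"
  shows "ext_act g A (ext_basis S) = wedge_cols g A (sorted_list_of_set S)"
proof -
  have "ext_act g A (ext_basis S) =
      (\<Sum>T\<in>Pow {..<2 * g}. if S = T then wedge_cols g A (sorted_list_of_set T) else 0)"
    unfolding ext_act_eq by (rule sum.cong) (auto simp: ext_basis_def)
  then show ?thesis
    using assms by simp
qed

lemma wedge_cols_insort:
  "sorted L \<Longrightarrow> distinct L \<Longrightarrow> s \<notin> set L \<Longrightarrow>
    (wedge_cols g A (insort s L) :: 'a::comm_ring_1 ext) =
      scal (sg s (set L)) (crv (2 * g) (mcol A s) (wedge_cols g A L))"
proof (induction L)
  case Nil
  then show ?case by (simp add: sg_def)
next
  case (Cons a L)
  show ?case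
  proof (cases "s \<le> a")
    case True
    with Cons.prems have "{t \<in> set (a # L). t < s} = {}" by auto
    then have "sg s (set (a # L)) = (1 :: 'a)"
      unfolding sg_def by (simp only: card.empty power_0)
    with True show ?thesis by (simp del: list.set)
  next
    case False
    have "sg s (set (a # L)) = (- sg s (set L) :: 'a)"
      using Cons.prems False by (simp add: sg_insert)
    moreover have "(wedge_cols g A (insort s L) :: 'a ext) = scal (sg s (set L)) (crv (2 * g) (mcol A s) (wedge_cols g A L))"
      using Cons by simp
    ultimately show ?thesis
      using False
      by (simp add: lin_crv crv_anticommute[of _ "mcol A a"] scal_minus_left scal_uminus del: list.set(2))
  qed
qed

text \<open>This is multiplicativity, tested on generators: acting after multiplication by
  \<open>e_s\<close> is multiplication by the image of \<open>e_s\<close>. With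
  \<open>ext_space_induct\<close> it yields functoriality, adjoints and the form of
  transvections.\<close>

lemma ext_act_cr:
  fixes x :: "'a::comm_ring_1 ext"
  assumes "s < 2 * g" "x \<in> ext_space g"
  shows "ext_act g A (cr s x) = crv (2 * g) (mcol A s) (ext_act g A x)"
proof -
  have basis: "ext_act g A (cr s (ext_basis S) :: 'a ext) = crv (2 * g) (mcol A s) (ext_act g A (ext_basis S))"
    if S: "S \<subseteq> {..<2 * g}" for S
  proof -
    have W: "ext_act g A (ext_basis (insert s T) :: 'a ext) =
        scal (sg s T) (crv (2 * g) (mcol A s) (ext_act g A (ext_basis T)))"
      if "T \<subseteq> {..<2 * g}" "s \<notin> T" for T
    proof -
      have "finite T" "insert s T \<subseteq> {..<2 * g}"
        using that assms(1) finite_subset by auto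
      with that show ?thesis
        by (simp add: ext_act_ext_basis wedge_cols_insort)
    qed
    show ?thesis
    proof (cases "s \<in> S")
      case False
      then show ?thesis
        by (simp add: cr_ext_basis lin_ext_act W S sg_mult_self)
    next
      case True
      have "cr s (ext_basis S) = (0 :: 'a ext)"
        using True by (auto simp: cr_def ext_basis_def fun_eq_iff fun_apply)
      moreover have "S = insert s (S - {s})" "S - {s} \<subseteq> {..<2 * g}"
        using True S by auto
      then have "ext_act g A (ext_basis S :: 'a ext) =
          scal (sg s (S - {s})) (crv (2 * g) (mcol A s) (ext_act g A (ext_basis (S - {s}))))"
        using W[of "S - {s}"] by simp
      \<comment> \<open>Column \<open>s\<close> is already a factor of the image of
        \<open>e_S\<close>, so multiplying by it again gives 0, in agreement with
        \<open>e_s \<and> e_S = 0\<close>.\<close>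
      then have "crv (2 * g) (mcol A s) (ext_act g A (ext_basis S)) = (0 :: 'a ext)"
        by (simp add: lin_crv crv_same)
      ultimately show ?thesis
        by (simp add: lin_ext_act)
    qed
  qed
  have "ext_act g A (cr s x) = (\<Sum>S\<in>Pow {..<2 * g}. scal (x S) (ext_act g A (cr s (ext_basis S))))"
    by (subst ext_space_expand[OF assms(2)]) (simp only: lin_cr lin_ext_act)
  also have "\<dots> = (\<Sum>S\<in>Pow {..<2 * g}. scal (x S) (crv (2 * g) (mcol A s) (ext_act g A (ext_basis S))))"
    by (rule sum.cong) (simp_all add: basis)
  also have "\<dots> = crv (2 * g) (mcol A s) (ext_act g A x)"
    by (subst (2) ext_space_expand[OF assms(2)]) (simp only: lin_crv lin_ext_act)
  finally show ?thesis .
qed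

lemma ext_act_vac: "ext_act g A (ext_basis {}) = ext_basis {}"
  by (simp add: ext_act_ext_basis)

lemma ext_space_ext_act: "ext_act g A x \<in> ext_space g"
  unfolding ext_act_eq by (intro ext_space_sum ext_space_scal ext_space_wedge_cols)

lemma ext_act_crv:
  assumes "x \<in> ext_space g"
  shows "ext_act g A (crv (2 * g) v x) = crv (2 * g) (\<lambda>i. \<Sum>k<2 * g. mcol A k i * v k) (ext_act g A x)"
proof -
  have "ext_act g A (crv (2 * g) v x) = (\<Sum>k<2 * g. scal (v k) (crv (2 * g) (mcol A k) (ext_act g A x)))"
    unfolding crv_def[of _ v] lin_ext_act by (rule sum.cong) (simp_all add: ext_act_cr assms)
  also have "\<dots> = (\<Sum>k<2 * g. \<Sum>i<2 * g. scal (mcol A k i * v k) (cr i (ext_act g A x)))"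
    unfolding crv_def scal_sum by (simp add: mult.commute)
  also have "\<dots> = (\<Sum>i<2 * g. \<Sum>k<2 * g. scal (mcol A k i * v k) (cr i (ext_act g A x)))"
    by (rule sum.swap)
  finally show ?thesis
    unfolding crv_def scal_sum_left .
qed

lemma crv_cong: "(\<And>i. i < N \<Longrightarrow> v i = w i) \<Longrightarrow> crv N v x = crv N w x"
  by (simp add: crv_def)

lemma ext_act_mult:
  fixes x :: "'a::comm_ring_1 ext"
  assumes "A \<in> carrier_mat (2 * g) (2 * g)" "B \<in> carrier_mat (2 * g) (2 * g)" "x \<in> ext_space g"
  shows "ext_act g (A * B) x = ext_act g A (ext_act g B x)"
  using assms(3)
proof (induction x rule: ext_space_induct)
  case (cr s x)
  have "mcol (A * B) s i = (\<Sum>k<2 * g. mcol A k i * (mcol B s k :: 'a))" if "i < 2 * g" for i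
    using that cr.hyps(1) assms(1,2)
    by (simp add: mcol_def scalar_prod_def atLeast0LessThan)
  then show ?case
    unfolding ext_act_cr[OF cr.hyps] cr.IH ext_act_crv[OF ext_space_ext_act]
    by (rule crv_cong)
qed (simp_all add: lin_ext_act ext_act_vac)

lemma crv_one: "s < 2 * g \<Longrightarrow> crv (2 * g) (mcol (1\<^sub>m (2 * g)) s) x = cr s x"
proof -
  assume s: "s < 2 * g"
  have "crv (2 * g) (mcol (1\<^sub>m (2 * g)) s) x = (\<Sum>i<2 * g. if s = i then cr i x else 0)"
    unfolding crv_def using s by (intro sum.cong) (auto simp: mcol_def)
  then show ?thesis
    using s by simp
qed

lemma ext_act_one:
  fixes x :: "'a::comm_ring_1 ext"
  assumes "x \<in> ext_space g"
  shows "ext_act g (1\<^sub>m (2 * g)) x = x"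
  using assms
proof (induction x rule: ext_space_induct)
  case (cr s x)
  show ?case
    unfolding ext_act_cr[OF cr.hyps] cr.IH by (rule crv_one[OF cr.hyps(1)])
qed (simp_all add: lin_ext_act ext_act_vac)

lemma anv_cr: "s < N \<Longrightarrow> anv N w (cr s x) = scal (w s) x - cr s (anv N w x)"
proof -
  assume s: "s < N"
  have "anv N w (cr s x) = (\<Sum>i<N. scal (w i) ((if i = s then x else 0) - cr s (an i x)))"
    unfolding anv_def an_cr ..
  also have "\<dots> = (\<Sum>i<N. scal (w i) (if i = s then x else 0)) - cr s (anv N w x)"
    unfolding scal_diff sum_subtractf anv_def lin_cr ..
  also have "(\<Sum>i<N. scal (w i) (if i = s then x else 0)) = (\<Sum>i<N. if s = i then scal (w i) x else 0)"
    by (rule sum.cong) auto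
  also have "\<dots> = scal (w s) x"
    using s by simp
  finally show ?thesis .
qed

text \<open>Contraction is natural: a functional contracted after \<open>A\<close> is its pullback
  along \<open>A\<close> contracted before. Passing one creation operator produces the same scalar
  and the same sign on both sides.\<close>

lemma anv_ext_act:
  fixes x :: "'a::comm_ring_1 ext"
  assumes "x \<in> ext_space g"
  shows "anv (2 * g) w (ext_act g A x) = ext_act g A (anv (2 * g) (\<lambda>k. \<Sum>i<2 * g. mcol A k i * w i) x)"
  using assms
proof (induction x rule: ext_space_induct)
  case vac
  show ?case by (simp add: ext_act_vac anv_vac lin_ext_act)
next
  case (add x y)
  then show ?case by (simp add: lin_ext_act lin_anv)
next
  case (scal c x)
  then show ?case by (simp add: lin_ext_act lin_anv)
next
  case (cr s x)
  define w' where "w' k = (\<Sum>i<2 * g. mcol A k i * w i)" for k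
  have "anv (2 * g) w (ext_act g A (cr s x)) =
      scal (w' s) (ext_act g A x) - crv (2 * g) (mcol A s) (ext_act g A (anv (2 * g) w' x))"
  proof -
    have "(\<Sum>i<2 * g. w i * mcol A s i) = w' s"
      by (simp add: w'_def mult.commute)
    then show ?thesis
      unfolding ext_act_cr[OF cr.hyps] anv_crv cr.IH w'_def by simp
  qed
  also have "\<dots> = ext_act g A (scal (w' s) x - cr s (anv (2 * g) w' x))"
    unfolding lin_ext_act ext_act_cr[OF cr.hyps(1) ext_space_anv[OF cr.hyps(2)]] ..
  also have "scal (w' s) x - cr s (anv (2 * g) w' x) = anv (2 * g) w' (cr s x)"
    by (rule anv_cr[OF cr.hyps(1), symmetric])
  finally show ?case
    unfolding w'_def .
qed

section \<open>Adjoints of the induced action and its reduction modulo p\<close>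

lemma crv_adjoint: "ext_inner g (crv (2 * g) v x) y = ext_inner g x (anv (2 * g) v y)"
  unfolding crv_def anv_def ext_inner_simps by (rule sum.cong) (simp_all add: cr_adjoint)

text \<open>A creation operator in the first argument becomes contraction with a column of
  \<open>A\<close> in the second. By naturality of contraction this is contraction with a basis
  vector after the action of the transpose.\<close>

lemma ext_act_adjoint:
  fixes x y :: "'a::comm_ring_1 ext"
  assumes A: "A \<in> carrier_mat (2 * g) (2 * g)" and "x \<in> ext_space g" "y \<in> ext_space g"
  shows "ext_inner g (ext_act g A x) y = ext_inner g x (ext_act g (transpose_mat A) y)"
  using assms(2,3)
proof (induction x arbitrary: y rule: ext_space_induct)
  case vac
  have "ext_inner g (ext_act g B z) (ext_basis {}) = ext_inner g z (ext_basis {})"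
    if "z \<in> ext_space g" for B and z :: "'a ext"
    using that
  proof (induction z rule: ext_space_induct)
    case (cr s z)
    show ?case
      unfolding ext_act_cr[OF cr.hyps] crv_adjoint anv_vac
      using cr.hyps by (simp add: cr_adjoint an_vac ext_inner_zero)
  qed (simp_all add: ext_inner_simps ext_act_vac lin_ext_act)
  with vac show ?case
    by (metis ext_act_vac ext_inner_commute)
next
  case (add x z)
  then show ?case by (simp add: lin_ext_act ext_inner_simps)
next
  case (scal c x)
  then show ?case by (simp add: lin_ext_act ext_inner_simps)
next
  case (cr s x)
  have "ext_inner g (ext_act g A (cr s x)) y = ext_inner g (ext_act g A x) (anv (2 * g) (mcol A s) y)"
    unfolding ext_act_cr[OF cr.hyps] crv_adjoint ..
  also have "\<dots> = ext_inner g x (ext_act g (transpose_mat A) (anv (2 * g) (mcol A s) y))"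
    using cr.prems by (intro cr.IH ext_space_anv)
  \<comment> \<open>The pullback along the transpose of the functional dual to \<open>e_s\<close> is
    column \<open>s\<close> of \<open>A\<close>.\<close>
  also have "ext_act g (transpose_mat A) (anv (2 * g) (mcol A s) y) =
      an s (ext_act g (transpose_mat A) y)"
  proof -
    have "(\<Sum>i<2 * g. mcol (transpose_mat A) k i * (if s = i then 1 else 0)) = (mcol A s k :: 'a)"
      if "k < 2 * g" for k
    proof -
      have "(\<Sum>i<2 * g. mcol (transpose_mat A) k i * (if s = i then 1 else 0)) =
          (\<Sum>i<2 * g. if s = i then mcol (transpose_mat A) k i else 0 :: 'a)"
        by (rule sum.cong) auto
      also have "\<dots> = mcol A s k"
        using A that cr.hyps(1) by (simp add: mcol_def)
      finally show ?thesis .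
    qed
    then have "anv (2 * g) (\<lambda>k. \<Sum>i<2 * g. mcol (transpose_mat A) k i * (if s = i then 1 else 0)) y
        = anv (2 * g) (mcol A s) y"
      by (simp add: anv_def)
    moreover have "anv (2 * g) (\<lambda>i. if s = i then 1 else 0) z = an s z" for z :: "'a ext"
    proof -
      have "anv (2 * g) (\<lambda>i. if s = i then 1 else 0) z = (\<Sum>i<2 * g. if s = i then an i z else 0)"
        unfolding anv_def by (rule sum.cong) auto
      then show ?thesis using cr.hyps(1) by simp
    qed
    ultimately show ?thesis
      using anv_ext_act[OF cr.prems, of "\<lambda>i. if s = i then 1 else 0" "transpose_mat A"] by simp
  qed
  also have "ext_inner g x (an s (ext_act g (transpose_mat A) y)) =
      ext_inner g (cr s x) (ext_act g (transpose_mat A) y)"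
    using cr.hyps(1) by (simp add: cr_adjoint)
  finally show ?case .
qed

lemma ext_act_red:
  assumes "x \<in> ext_space g"
  shows "ext_act g A (red x) = (red (ext_act g A x) :: 'a::comm_ring_1 ext)"
proof -
  have R: "red (crv N (mcol A s) y) = (crv N (mcol A s) (red y) :: 'a ext)" for N s y
  proof -
    have "red (\<Sum>i<N. f i) = (\<Sum>i<N. red (f i) :: 'a ext)" for f :: "nat \<Rightarrow> int ext"
      by (simp add: fun_eq_iff sum_fun_apply fun_apply)
    then show ?thesis
      by (simp add: crv_def red_simps red_cr mcol_def)
  qed
  have "(red y :: 'a ext) \<in> ext_space g" if "y \<in> ext_space g" for y
    using that by (auto simp: ext_space_def fun_apply)
  note sp = this
  have "red (ext_basis {}) = (ext_basis {} :: 'a ext)"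
    by (auto simp: ext_basis_def fun_eq_iff fun_apply)
  with assms show ?thesis
  proof (induction x rule: ext_space_induct)
    case (cr s x)
    then show ?case
      by (simp add: red_cr ext_act_cr sp R)
  qed (simp_all add: red_simps lin_ext_act ext_act_vac)
qed


section \<open>The integral symplectic group\<close>

lemma sum_lessThan_add: "(\<Sum>k<m + n. f k) = (\<Sum>k<m. f k) + (\<Sum>k<n. f (m + k :: nat))"
  for f :: "nat \<Rightarrow> 'b::comm_monoid_add"
  by (induction n) (simp_all add: add.assoc)

lemma sum_lessThan_double: "(\<Sum>k<2 * n. f k) = (\<Sum>k<n. f k) + (\<Sum>k<n. f (n + k :: nat))"
  for f :: "nat \<Rightarrow> 'b::comm_monoid_add"
  using sum_lessThan_add[of f n n] by (simp add: mult_2)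

lemma symp_form_carrier [simp]: "symp_form g \<in> carrier_mat (2 * g) (2 * g)"
  using four_block_carrier_mat[of "0\<^sub>m g g :: int mat" g g "0\<^sub>m g g" g g "1\<^sub>m g" "- 1\<^sub>m g"]
  by (simp add: symp_form_def mult_2)

lemma symp_form_dim [simp]: "dim_row (symp_form g) = 2 * g" "dim_col (symp_form g) = 2 * g"
  using symp_form_carrier[of g] by (auto simp del: symp_form_carrier)

lemma symp_form_index:
  "k < 2 * g \<Longrightarrow> l < 2 * g \<Longrightarrow> symp_form g $$ (k, l) =
    (if k < g then if l = g + k then 1 else 0 else if k = g + l then - 1 else 0)"
  unfolding symp_form_def by auto

lemma symp_form_mult:
  assumes "k < 2 * g"
  shows "(\<Sum>l<2 * g. symp_form g $$ (k, l) * y l) = (if k < g then y (g + k) else - y (k - g))"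
proof (cases "k < g")
  case True
  have "(\<Sum>l<2 * g. symp_form g $$ (k, l) * y l) = (\<Sum>l<2 * g. if g + k = l then y l else 0)"
    using assms True by (intro sum.cong) (auto simp: symp_form_index)
  with True show ?thesis by simp
next
  case False
  have "(\<Sum>l<2 * g. symp_form g $$ (k, l) * y l) = (\<Sum>l<2 * g. if k - g = l then - y l else 0)"
    using assms False by (intro sum.cong) (auto simp: symp_form_index)
  with False assms show ?thesis by simp
qed

lemma index_mult_symp_form:
  assumes X: "X \<in> carrier_mat (2 * g) (2 * g)" and st: "s < 2 * g" "t < 2 * g"
  shows "(X * symp_form g * transpose_mat X) $$ (s, t) =
    (\<Sum>i<g. X $$ (s, i) * X $$ (t, g + i) - X $$ (s, g + i) * X $$ (t, i))"
proof -
  have "X * symp_form g * transpose_mat X = X * (symp_form g * transpose_mat X)"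
    using X by (intro assoc_mult_mat) auto
  also have "\<dots> $$ (s, t) = (\<Sum>k<2 * g. X $$ (s, k) * (\<Sum>l<2 * g. symp_form g $$ (k, l) * X $$ (t, l)))"
    using X st symp_form_carrier[of g] by (auto simp: scalar_prod_def atLeast0LessThan intro!: sum.cong)
  also have "\<dots> = (\<Sum>k<2 * g. X $$ (s, k) * (if k < g then X $$ (t, g + k) else - X $$ (t, k - g)))"
    by (rule sum.cong) (simp_all add: symp_form_mult)
  also have "\<dots> = (\<Sum>i<g. X $$ (s, i) * X $$ (t, g + i)) + (\<Sum>i<g. - (X $$ (s, g + i) * X $$ (t, i)))"
    unfolding sum_lessThan_double by simp
  finally show ?thesis
    by (simp add: sum_subtractf sum_negf)
qed

lemma symp_form_square: "symp_form g * symp_form g = - 1\<^sub>m (2 * g)"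
proof (rule eq_matI)
  fix i j assume ij: "i < dim_row (- 1\<^sub>m (2 * g) :: int mat)" "j < dim_col (- 1\<^sub>m (2 * g) :: int mat)"
  then have "(symp_form g * symp_form g) $$ (i, j) = (\<Sum>l<2 * g. symp_form g $$ (i, l) * symp_form g $$ (l, j))"
    using symp_form_carrier[of g] by (auto simp: scalar_prod_def atLeast0LessThan)
  also have "\<dots> = (if i < g then symp_form g $$ (g + i, j) else - symp_form g $$ (i - g, j))"
    using ij by (simp add: symp_form_mult)
  also have "\<dots> = (- 1\<^sub>m (2 * g)) $$ (i, j)"
    using ij by (auto simp: symp_form_index)
  finally show "(symp_form g * symp_form g) $$ (i, j) = (- 1\<^sub>m (2 * g)) $$ (i, j)" .
qed (use symp_form_carrier[of g] in auto)

text \<open>A one-sided inverse of a square matrix over a field is two-sided, and the integers embed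
  into the rationals.\<close>

lemma int_mat_left_right_inverse:
  fixes A B :: "int mat"
  assumes A: "A \<in> carrier_mat n n" and B: "B \<in> carrier_mat n n" and BA: "B * A = 1\<^sub>m n"
  shows "A * B = 1\<^sub>m n"
proof -
  let ?r = "map_mat (of_int :: int \<Rightarrow> rat)"
  have "?r B * ?r A = 1\<^sub>m n"
    using of_int_hom.mat_hom_mult[OF B A, where 'a=rat] BA by (simp add: of_int_hom.mat_hom_one)
  then have "?r A * ?r B = 1\<^sub>m n"
    using A B by (intro mat_mult_left_right_inverse[of "?r B"]) auto
  then have "?r (A * B) = ?r (1\<^sub>m n)"
    using of_int_hom.mat_hom_mult[OF A B, where 'a=rat] by (simp add: of_int_hom.mat_hom_one)
  then show ?thesis
    by (rule of_int_hom.mat_hom_inj)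
qed

lemma carrier_Sp: "A \<in> carrier (Sp g) \<longleftrightarrow>
    A \<in> carrier_mat (2 * g) (2 * g) \<and> transpose_mat A * symp_form g * A = symp_form g"
  by (simp add: Sp_def)

text \<open>Multiplying \<open>A^T J A = J\<close> by \<open>J\<close> on the left and using
  \<open>J^2 = - 1\<close> shows that this is a left inverse of \<open>A\<close>.\<close>

definition sp_inv :: "nat \<Rightarrow> int mat \<Rightarrow> int mat" where
  "sp_inv g A = - (symp_form g * transpose_mat A * symp_form g)"

lemma
  assumes "A \<in> carrier (Sp g)"
  shows sp_inv_carrier_mat: "sp_inv g A \<in> carrier_mat (2 * g) (2 * g)"
    and sp_inv_left: "sp_inv g A * A = 1\<^sub>m (2 * g)"
    and sp_inv_right: "A * sp_inv g A = 1\<^sub>m (2 * g)"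
    and Sp_transpose_form: "A * symp_form g * transpose_mat A = symp_form g"
proof -
  let ?J = "symp_form g" and ?n = "2 * g"
  have A: "A \<in> carrier_mat ?n ?n" and AJ: "transpose_mat A * ?J * A = ?J"
    using assms by (auto simp: carrier_Sp)
  note J = symp_form_carrier[of g]
  have At: "transpose_mat A \<in> carrier_mat ?n ?n" using A by simp
  note mat = assoc_mult_mat[of _ ?n ?n _ ?n _ ?n] mult_carrier_mat[of _ ?n ?n _ ?n]
  show B: "sp_inv g A \<in> carrier_mat ?n ?n"
    unfolding sp_inv_def using J At by (simp add: mat(2))
  have "sp_inv g A * A = - (?J * transpose_mat A * ?J * A)"
    unfolding sp_inv_def using J At A by (simp add: mat(2))
  also have "?J * transpose_mat A * ?J * A = ?J * (transpose_mat A * ?J * A)"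
    using J At A by (simp add: mat)
  also have "- \<dots> = 1\<^sub>m ?n"
    unfolding AJ symp_form_square by (rule uminus_uminus_mat)
  finally show 1: "sp_inv g A * A = 1\<^sub>m ?n" .
  show 2: "A * sp_inv g A = 1\<^sub>m ?n"
    by (rule int_mat_left_right_inverse[OF A B 1])
  have "- (A * ?J * transpose_mat A * ?J) = 1\<^sub>m ?n"
    using 2 unfolding sp_inv_def using J At A by (simp add: mat)
  then have "- (A * ?J * transpose_mat A * ?J) * ?J = ?J"
    using J by simp
  then have "- (A * ?J * transpose_mat A * (?J * ?J)) = ?J"
    using J At A by (simp add: mat)
  then show "A * ?J * transpose_mat A = ?J"
    unfolding symp_form_square using J At A by (simp add: mat)
qed

lemma Sp_transpose: "A \<in> carrier (Sp g) \<Longrightarrow> transpose_mat A \<in> carrier (Sp g)"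
  using Sp_transpose_form[of A g] by (simp add: carrier_Sp)

lemma Sp_simps [simp]: "\<one>\<^bsub>Sp g\<^esub> = 1\<^sub>m (2 * g)" "A \<otimes>\<^bsub>Sp g\<^esub> B = A * B"
  by (simp_all add: Sp_def)

lemma Sp_mult:
  assumes "A \<in> carrier (Sp g)" "B \<in> carrier (Sp g)"
  shows "A * B \<in> carrier (Sp g)"
proof -
  let ?J = "symp_form g" and ?n = "2 * g"
  note J = symp_form_carrier[of g]
  have A: "A \<in> carrier_mat ?n ?n" "transpose_mat A * ?J * A = ?J"
    and B: "B \<in> carrier_mat ?n ?n" "transpose_mat B * ?J * B = ?J"
    using assms by (auto simp: carrier_Sp)
  have t: "transpose_mat A \<in> carrier_mat ?n ?n" "transpose_mat B \<in> carrier_mat ?n ?n"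
    using A B by auto
  have "transpose_mat (A * B) * ?J * (A * B) = transpose_mat B * (transpose_mat A * ?J * A) * B"
    using A(1) B(1) t J by (simp add: transpose_mult[OF A(1) B(1)] assoc_mult_mat[of _ ?n ?n _ ?n _ ?n]
        mult_carrier_mat[of _ ?n ?n _ ?n])
  then show ?thesis
    using A B by (simp add: carrier_Sp mult_carrier_mat[of _ ?n ?n _ ?n])
qed

lemma Sp_one: "1\<^sub>m (2 * g) \<in> carrier (Sp g)"
  by (simp add: carrier_Sp left_mult_one_mat[OF symp_form_carrier]
      right_mult_one_mat[OF symp_form_carrier])

lemma Sp_inv:
  assumes "A \<in> carrier (Sp g)"
  shows "sp_inv g A \<in> carrier (Sp g)"
proof -
  let ?J = "symp_form g" and ?n = "2 * g" and ?B = "sp_inv g A"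
  note J = symp_form_carrier[of g]
  have A: "A \<in> carrier_mat ?n ?n" "transpose_mat A * ?J * A = ?J"
    using assms by (auto simp: carrier_Sp)
  note B = sp_inv_carrier_mat[OF assms]
  have t: "transpose_mat A \<in> carrier_mat ?n ?n" "transpose_mat ?B \<in> carrier_mat ?n ?n"
    using A B by auto
  have "transpose_mat ?B * ?J * ?B = transpose_mat ?B * (transpose_mat A * ?J * A) * ?B"
    by (simp only: A(2))
  also have "\<dots> = transpose_mat ?B * transpose_mat A * ?J * (A * ?B)"
    using A(1) B t J by (simp add: assoc_mult_mat[of _ ?n ?n _ ?n _ ?n] mult_carrier_mat[of _ ?n ?n _ ?n])
  also have "transpose_mat ?B * transpose_mat A = 1\<^sub>m ?n"
    using transpose_mult[OF A(1) B] sp_inv_right[OF assms] by simp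
  finally have "transpose_mat ?B * ?J * ?B = ?J"
    unfolding sp_inv_right[OF assms] left_mult_one_mat[OF J] right_mult_one_mat[OF J] .
  with B show ?thesis
    unfolding carrier_Sp by blast
qed

lemma group_Sp: "group (Sp g)"
proof (rule groupI)
  fix A B C assume "A \<in> carrier (Sp g)" "B \<in> carrier (Sp g)" "C \<in> carrier (Sp g)"
  then show "A \<otimes>\<^bsub>Sp g\<^esub> B \<otimes>\<^bsub>Sp g\<^esub> C = A \<otimes>\<^bsub>Sp g\<^esub> (B \<otimes>\<^bsub>Sp g\<^esub> C)"
    by (simp add: carrier_Sp assoc_mult_mat[of _ "2 * g" "2 * g" _ "2 * g" _ "2 * g"])
next
  fix A assume "A \<in> carrier (Sp g)"
  then show "\<exists>B\<in>carrier (Sp g). B \<otimes>\<^bsub>Sp g\<^esub> A = \<one>\<^bsub>Sp g\<^esub>"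
    by (intro bexI[of _ "sp_inv g A"]) (simp_all add: Sp_inv sp_inv_left)
next
  fix A assume "A \<in> carrier (Sp g)"
  then have "A \<in> carrier_mat (2 * g) (2 * g)"
    by (simp add: carrier_Sp)
  then show "\<one>\<^bsub>Sp g\<^esub> \<otimes>\<^bsub>Sp g\<^esub> A = A"
    by simp
qed (simp_all add: Sp_mult Sp_one)


subsection \<open>Compatibility with the raising and lowering operators\<close>

text \<open>Antisymmetry turns twice the transformed omega into a sum over all ordered pairs
  \<open>(s, t)\<close>, whose coefficients form the matrix \<open>A J A^T\<close>. Doubling avoids
  a restriction to \<open>s < t\<close>.\<close>

lemma double_sum_crv:
  fixes x :: "int ext"
  assumes "A \<in> carrier_mat (2 * g) (2 * g)" "A * symp_form g * transpose_mat A = symp_form g"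
  shows "scal 2 (\<Sum>i<g. crv (2 * g) (mcol A i) (crv (2 * g) (mcol A (g + i)) x)) =
    (\<Sum>s<2 * g. \<Sum>t<2 * g. scal (symp_form g $$ (s, t)) (cr s (cr t x)))"
proof -
  let ?C = "\<lambda>v. crv (2 * g) v"
  have e: "?C u (?C v x) = (\<Sum>s<2 * g. \<Sum>t<2 * g. scal (u s * v t) (cr s (cr t x)))" for u v
    unfolding crv_def lin_cr scal_sum by simp
  have "scal 2 (?C u (?C v x)) = ?C u (?C v x) - ?C v (?C u x)" for u v
    using crv_anticommute[of "2 * g" u v x] by (simp add: fun_eq_iff fun_apply)
  moreover have "scal a y - scal b y = scal (a - b) y" for a b and y :: "int ext"
    by (simp add: fun_eq_iff fun_apply algebra_simps)
  ultimately have "scal 2 (?C u (?C v x)) =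
      (\<Sum>s<2 * g. \<Sum>t<2 * g. scal (u s * v t - v s * u t) (cr s (cr t x)))" for u v
    unfolding e by (simp only: sum_subtractf[symmetric])
  then have "scal 2 (\<Sum>i<g. ?C (mcol A i) (?C (mcol A (g + i)) x)) =
      (\<Sum>i<g. \<Sum>s<2 * g. \<Sum>t<2 * g.
        scal (A $$ (s, i) * A $$ (t, g + i) - A $$ (s, g + i) * A $$ (t, i)) (cr s (cr t x)))"
    unfolding scal_sum by (simp add: mcol_def)
  also have "\<dots> = (\<Sum>s<2 * g. \<Sum>i<g. \<Sum>t<2 * g.
        scal (A $$ (s, i) * A $$ (t, g + i) - A $$ (s, g + i) * A $$ (t, i)) (cr s (cr t x)))"
    by (rule sum.swap)
  also have "\<dots> = (\<Sum>s<2 * g. \<Sum>t<2 * g. \<Sum>i<g.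
        scal (A $$ (s, i) * A $$ (t, g + i) - A $$ (s, g + i) * A $$ (t, i)) (cr s (cr t x)))"
    by (rule sum.cong[OF refl], rule sum.swap)
  also have "\<dots> = (\<Sum>s<2 * g. \<Sum>t<2 * g. scal (symp_form g $$ (s, t)) (cr s (cr t x)))"
    unfolding scal_sum_left[symmetric]
    by (intro sum.cong refl) (simp add: index_mult_symp_form[OF assms(1), symmetric] assms(2))
  finally show ?thesis .
qed

text \<open>The doubled expression depends on \<open>A\<close> only through
  \<open>A J A^T = J\<close>, so it agrees with that for the identity matrix. Working over the
  integers allows the factor 2 to be cancelled; the statement modulo p is obtained by
  reduction.\<close>

lemma E_op_ext_act:
  fixes x :: "int ext"
  assumes "A \<in> carrier (Sp g)" "x \<in> ext_space g"
  shows "E_op g (ext_act g A x) = ext_act g A (E_op g x)"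
proof -
  let ?y = "ext_act g A x"
  have y: "?y \<in> ext_space g" by (rule ext_space_ext_act)
  have "ext_act g A (pair g i x) = crv (2 * g) (mcol A i) (crv (2 * g) (mcol A (g + i)) ?y)"
    if "i < g" for i
    using that assms(2) by (simp add: pair_def ext_act_cr ext_space_cr)
  then have "ext_act g A (E_op g x) = (\<Sum>i<g. crv (2 * g) (mcol A i) (crv (2 * g) (mcol A (g + i)) ?y))"
    by (simp add: E_op_eq_cr[OF assms(2)] lin_ext_act)
  then have "scal 2 (ext_act g A (E_op g x)) =
      (\<Sum>s<2 * g. \<Sum>t<2 * g. scal (symp_form g $$ (s, t)) (cr s (cr t ?y)))"
    using assms(1) Sp_transpose_form[OF assms(1)] by (simp add: double_sum_crv carrier_Sp)
  also have "\<dots> = scal 2 (\<Sum>i<g. crv (2 * g) (mcol (1\<^sub>m (2 * g)) i)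
      (crv (2 * g) (mcol (1\<^sub>m (2 * g)) (g + i)) ?y))"
    using symp_form_carrier[of g] by (intro double_sum_crv[symmetric]) auto
  also have "\<dots> = scal 2 (E_op g ?y)"
    by (simp add: E_op_eq_cr[OF y] crv_one pair_def)
  finally show ?thesis
    by (simp add: fun_eq_iff fun_apply)
qed

lemma ext_space_E_op: "x \<in> ext_space g \<Longrightarrow> E_op g x \<in> ext_space g"
  unfolding E_op_eq_cr pair_def by (intro ext_space_sum ext_space_cr) auto

lemma ext_space_F_op: "F_op g x \<in> ext_space g"
  by (simp add: F_op_def ext_space_def)

text \<open>The adjoint of the action of \<open>A\<close> is the action of its transpose, which is
  again symplectic; so the statement is dual to the one for \<open>E\<close>.\<close>

lemma F_op_ext_act:
  fixes x :: "int ext"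
  assumes "A \<in> carrier (Sp g)" "x \<in> ext_space g"
  shows "F_op g (ext_act g A x) = ext_act g A (F_op g x)"
proof (rule ext_space_eqI[OF ext_space_F_op ext_space_ext_act])
  fix z :: "int ext" assume z: "z \<in> ext_space g"
  have A: "A \<in> carrier_mat (2 * g) (2 * g)"
    using assms(1) by (simp add: carrier_Sp)
  have "ext_inner g (F_op g (ext_act g A x)) z = ext_inner g (ext_act g A x) (E_op g z)"
    by (rule F_op_adjoint[OF z])
  also have "\<dots> = ext_inner g x (E_op g (ext_act g (transpose_mat A) z))"
    using assms z by (simp add: ext_act_adjoint[OF A] ext_space_E_op E_op_ext_act Sp_transpose)
  also have "\<dots> = ext_inner g (F_op g x) (ext_act g (transpose_mat A) z)"
    by (rule F_op_adjoint[OF ext_space_ext_act, symmetric])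
  also have "\<dots> = ext_inner g (ext_act g A (F_op g x)) z"
    using z by (simp add: ext_act_adjoint[OF A] ext_space_F_op)
  finally show "ext_inner g (F_op g (ext_act g A x)) z = ext_inner g (ext_act g A (F_op g x)) z" .
qed

section \<open>Degrees and stability of the integral kernels under the symplectic group\<close>

lemma ext_spaceD: "x \<in> ext_space g \<Longrightarrow> x S \<noteq> 0 \<Longrightarrow> S \<subseteq> {..<2 * g}"
  by (auto simp: ext_space_def)

lemma wedge_cols_degree: "wedge_cols g A L S \<noteq> (0 :: 'a::comm_ring_1) \<Longrightarrow> card S = length L"
proof (induction L arbitrary: S)
  case Nil
  then show ?case by (auto simp: ext_basis_def split: if_splits)
next
  case (Cons j L)
  from Cons.prems have "(\<Sum>i<2 * g. mcol A j i * cr i (wedge_cols g A L) S) \<noteq> (0 :: 'a)"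
    by (simp add: crv_def sum_fun_apply fun_apply)
  then obtain i where "mcol A j i * cr i (wedge_cols g A L) S \<noteq> (0 :: 'a)"
    by (rule sum.not_neutral_contains_not_neutral)
  then have "cr i (wedge_cols g A L) S \<noteq> (0 :: 'a)" by auto
  then have i: "i \<in> S" "wedge_cols g A L (S - {i}) \<noteq> (0 :: 'a)"
    by (auto simp: cr_def split: if_splits)
  have "finite (S - {i})"
    by (rule finite_subset[OF ext_spaceD[OF ext_space_wedge_cols i(2)]]) simp
  then have "finite S" by simp
  with i Cons.IH[OF i(2)] show ?case
    using card.remove[of S i] by (simp only: length_Cons)
qed

lemma ext_act_degree:
  fixes x :: "'a::comm_ring_1 ext"
  assumes "ext_act g A x S \<noteq> 0"
  shows "\<exists>T. x T \<noteq> 0 \<and> card T = card S"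
proof -
  from assms have "(\<Sum>T\<in>Pow {..<2 * g}. x T * wedge_cols g A (sorted_list_of_set T) S) \<noteq> 0"
    by (simp add: ext_act_eq sum_fun_apply fun_apply)
  then obtain T where "x T * wedge_cols g A (sorted_list_of_set T) S \<noteq> 0"
    by (rule sum.not_neutral_contains_not_neutral)
  then have "x T \<noteq> 0" "wedge_cols g A (sorted_list_of_set T) S \<noteq> (0 :: 'a)"
    by auto
  with wedge_cols_degree[OF this(2)] show ?thesis
    by (metis length_sorted_list_of_set)
qed

lemma V_int_ext_space: "x \<in> V_int k g \<Longrightarrow> x \<in> ext_space g"
  by (auto simp: V_int_def ext_deg_def ext_space_def split: if_splits)

lemma ext_act_V_int:
  assumes A: "A \<in> carrier (Sp g)" and x: "x \<in> V_int k g"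
  shows "ext_act g A x \<in> V_int k g"
proof (cases "k \<le> g + 1")
  case True
  then have *: "\<And>S. x S \<noteq> 0 \<Longrightarrow> card S = g + 1 - k" and F: "F_op g x = (\<lambda>_. 0)"
    using x by (simp_all add: V_int_def ext_deg_def)
  have "F_op g (ext_act g A x) = ext_act g A 0"
    unfolding F_op_ext_act[OF A V_int_ext_space[OF x]] F zero_fun_def ..
  then have "F_op g (ext_act g A x) = (\<lambda>_. 0)"
    unfolding lin_ext_act by (simp only: zero_fun_def)
  moreover have "card S = g + 1 - k" if "ext_act g A x S \<noteq> 0" for S
    using ext_act_degree[OF that] * by metis
  ultimately show ?thesis
    using True by (simp add: V_int_def ext_deg_def ext_space_ext_act)
next
  case False
  then have "x = 0"
    using x by (simp add: V_int_def zero_fun_def)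
  then have "ext_act g A x = 0"
    by (simp only: lin_ext_act)
  with False show ?thesis
    by (simp add: V_int_def zero_fun_def)
qed


subsection \<open>Transvections\<close>

text \<open>The value of the symplectic form on the pair of \<open>v\<close> and the basis vector
  with index \<open>j\<close>; the transvection adds \<open>v\<close> times this functional.\<close>

definition tv_dual :: "nat \<Rightarrow> (nat \<Rightarrow> int) \<Rightarrow> nat \<Rightarrow> int" where
  "tv_dual g v j = (if j < g then - v (g + j) else v (j - g))"

definition transvection :: "nat \<Rightarrow> (nat \<Rightarrow> int) \<Rightarrow> int mat" where
  "transvection g v = mat (2 * g) (2 * g) (\<lambda>(i, j). (if i = j then 1 else 0) + v i * tv_dual g v j)"

lemma transvection_Sp: "transvection g v \<in> carrier (Sp g)"
proof -
  let ?T = "transvection g v" and ?w = "tv_dual g v"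
  have T: "?T \<in> carrier_mat (2 * g) (2 * g)"
    by (simp add: transvection_def)
  \<comment> \<open>The second factor is written as a double transpose so that the entry formula for
    \<open>X J X^T\<close> applies with \<open>X\<close> the transpose of the transvection.\<close>
  have "transpose_mat ?T * symp_form g * transpose_mat (transpose_mat ?T) = symp_form g"
  proof (rule eq_matI)
    fix s t assume "s < dim_row (symp_form g)" "t < dim_col (symp_form g)"
    then have st: "s < 2 * g" "t < 2 * g"
      using symp_form_carrier[of g] by auto
    have d1: "(\<Sum>i<g. (if i = s then f i else 0) - (if g + i = s then h i else 0)) =
        (if s < g then f s else - h (s - g))"
      if "s < 2 * g" for s and f h :: "nat \<Rightarrow> int"
    proof (cases "s < g")
      case True
      then have "(\<Sum>i<g. (if i = s then f i else 0) - (if g + i = s then h i else 0)) =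
          (\<Sum>i<g. if s = i then f i else 0)"
        by (intro sum.cong) auto
      with True show ?thesis by simp
    next
      case False
      then have "(\<Sum>i<g. (if i = s then f i else 0) - (if g + i = s then h i else 0)) =
          (\<Sum>i<g. if s - g = i then - h i else 0)"
        by (intro sum.cong) auto
      with False that show ?thesis by simp
    qed
    have "(transpose_mat ?T * symp_form g * transpose_mat (transpose_mat ?T)) $$ (s, t) =
        (\<Sum>i<g. ?T $$ (i, s) * ?T $$ (g + i, t) - ?T $$ (g + i, s) * ?T $$ (i, t))"
      using T st by (subst index_mult_symp_form) auto
    also have "\<dots> = (\<Sum>i<g. ((if i = s then 1 else 0) + v i * ?w s) * ((if g + i = t then 1 else 0) + v (g + i) * ?w t)
        - ((if g + i = s then 1 else 0) + v (g + i) * ?w s) * ((if i = t then 1 else 0) + v i * ?w t))"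
      using st by (intro sum.cong) (auto simp: transvection_def)
    also have "\<dots> = (\<Sum>i<g. (if i = s then (if g + i = t then 1 else 0) else 0) -
          (if g + i = s then (if i = t then 1 else 0) else 0))
        + ?w t * (\<Sum>i<g. (if i = s then v (g + i) else 0) - (if g + i = s then v i else 0))
        - ?w s * (\<Sum>i<g. (if i = t then v (g + i) else 0) - (if g + i = t then v i else 0))"
      unfolding sum_distrib_left sum.distrib[symmetric] sum_subtractf[symmetric]
      by (rule sum.cong) (auto simp: algebra_simps)
    also have "\<dots> = symp_form g $$ (s, t)"
      unfolding d1[OF st(1)] d1[OF st(2)] using st by (auto simp: symp_form_index tv_dual_def)
    finally show "(transpose_mat ?T * symp_form g * transpose_mat (transpose_mat ?T)) $$ (s, t) = symp_form g $$ (s, t)" .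
  qed (use T symp_form_carrier[of g] in auto)
  with T show ?thesis
    by (simp add: carrier_Sp)
qed

text \<open>A term using the correction in two factors contains \<open>v \<and> v = 0\<close>, so
  only the constant and linear terms survive. The formula is exact over every commutative
  ring.\<close>

lemma ext_act_transvection:
  fixes x :: "'a::comm_ring_1 ext"
  assumes "x \<in> ext_space g"
  shows "ext_act g (transvection g v) x =
    x + crv (2 * g) (\<lambda>i. of_int (v i)) (anv (2 * g) (\<lambda>j. of_int (tv_dual g v j)) x)"
  using assms
proof (induction x rule: ext_space_induct)
  case vac
  show ?case by (simp add: ext_act_vac anv_vac lin_crv)
next
  case (add x y)
  then show ?case by (simp add: lin_ext_act lin_anv lin_crv)
next
  case (scal c x)
  then show ?case by (simp add: lin_ext_act lin_anv lin_crv scal_add)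
next
  case (cr s x)
  let ?v = "\<lambda>i. of_int (v i) :: 'a" and ?w = "\<lambda>j. of_int (tv_dual g v j) :: 'a"
  have "crv (2 * g) (mcol (transvection g v) s) y = cr s y + scal (?w s) (crv (2 * g) ?v y)" for y
  proof -
    have "crv (2 * g) (mcol (transvection g v) s) y =
        (\<Sum>i<2 * g. (if s = i then cr i y else 0) + scal (?w s) (scal (?v i) (cr i y)))"
      unfolding crv_def using cr.hyps(1)
      by (intro sum.cong) (auto simp: mcol_def transvection_def fun_eq_iff fun_apply algebra_simps)
    then show ?thesis
      using cr.hyps(1) unfolding sum.distrib scal_sum[symmetric] crv_def by simp
  qed
  then show ?case
    unfolding ext_act_cr[OF cr.hyps] cr.IH anv_cr[OF cr.hyps(1)]
    by (simp add: lin_crv lin_cr crv_same cr_crv_anticommute scal_diff)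
qed


section \<open>Root vectors of the symplectic Lie algebra in the handle model\<close>

definition hlift :: "('a::comm_ring_1 hfun \<Rightarrow> 'a hfun) \<Rightarrow> 'a hfun \<Rightarrow> 'a hfun" where
  "hlift T x = mk (T (slice H0 x)) (T (slice Ha x)) (T (slice Hb x)) (T (slice Hab x))"

definition hN :: "'a::comm_ring_1 hfun \<Rightarrow> 'a hfun" where
  "hN x = mk 0 (slice Hb x) 0 0"

definition hN' :: "'a::comm_ring_1 hfun \<Rightarrow> 'a hfun" where
  "hN' x = mk 0 0 (slice Ha x) 0"

definition hB :: "'a::comm_ring_1 hfun \<Rightarrow> 'a hfun" where
  "hB x = mk (mk 0 0 (slice H0 (slice Ha x)) (- slice Ha (slice Ha x))) 0
     (mk (slice Ha (slice H0 x)) 0 (slice Hab (slice H0 x) - slice H0 (slice Hab x)) (slice Ha (slice Hab x)))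
     (mk (slice Ha (slice Ha x)) 0 (slice Hab (slice Ha x)) 0)"

text \<open>
  In terms of derivations, \<open>hN\<close> is \<open>b \<mapsto> a\<close> and \<open>hN'\<close> is \<open>a \<mapsto> b\<close> on the first handle,
  and \<open>hB\<close> is \<open>a\<^sub>1 \<mapsto> b\<^sub>2, a\<^sub>2 \<mapsto> b\<^sub>1\<close> on the first two handles.
\<close>

inductive hop :: "nat \<Rightarrow> ('a::comm_ring_1 hfun \<Rightarrow> 'a hfun) \<Rightarrow> bool" where
  hop_id: "hop n (\<lambda>x. x)"
| hop_comp: "hop n S \<Longrightarrow> hop n T \<Longrightarrow> hop n (\<lambda>x. S (T x))"
| hop_N: "hop (Suc n) hN"
| hop_N': "hop (Suc n) hN'"
| hop_B: "hop (Suc (Suc n)) hB"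
| hop_lift: "hop n T \<Longrightarrow> hop (Suc n) (hlift T)"

lemma linop_hlift: "linop T \<Longrightarrow> linop (hlift T)"
  unfolding linop_def hlift_def by (simp add: linop_simps[OF linop_slice] mk_simps)

lemma linop_hN: "linop hN" and linop_hN': "linop hN'"
  unfolding linop_def hN_def hN'_def by (simp_all add: linop_simps[OF linop_slice] mk_simps)

lemma linop_hB: "linop hB"
  unfolding linop_def hB_def
  by (simp add: linop_simps[OF linop_slice] mk_simps scal_diff scal_uminus)

lemma linop_hop: "hop n T \<Longrightarrow> linop T"
  by (induction rule: hop.induct)
    (auto intro: linop_id linop_comp linop_hN linop_hN' linop_hB linop_hlift)

text \<open>The comparison map determines coordinates only on words of length \<open>n\<close>; with
  this support condition it becomes injective.\<close>

definition hsupp :: "nat \<Rightarrow> 'a::comm_ring_1 hfun \<Rightarrow> bool" where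
  "hsupp n x \<longleftrightarrow> (\<forall>L. x L \<noteq> 0 \<longrightarrow> length L = n)"

lemma hsupp_mk: "hsupp (Suc n) (mk u a b w) \<longleftrightarrow> hsupp n u \<and> hsupp n a \<and> hsupp n b \<and> hsupp n w"
  (is "?l = ?r")
proof
  assume h: ?l
  have "mk u a b w (c # L) \<noteq> 0 \<longrightarrow> length L = n" for c L
    using h unfolding hsupp_def by fastforce
  from this[of H0] this[of Ha] this[of Hb] this[of Hab] show ?r
    unfolding hsupp_def by auto
next
  assume ?r
  then show ?l
    unfolding hsupp_def by (auto simp: mk_def split: list.splits handle.splits)
qed

lemma hsupp_slice: "hsupp (Suc n) x \<Longrightarrow> hsupp n (slice c x)"
  unfolding hsupp_def by fastforce

lemma hsupp_zero: "hsupp n 0"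
  by (simp add: hsupp_def fun_apply)

lemma hsupp_uminus: "hsupp n x \<Longrightarrow> hsupp n (- x)"
  by (simp add: hsupp_def fun_apply)

lemma hsupp_diff: "hsupp n x \<Longrightarrow> hsupp n y \<Longrightarrow> hsupp n (x - y)"
  unfolding hsupp_def by (metis diff_self minus_apply diff_zero)

lemma hsupp_hop: "hop n T \<Longrightarrow> hsupp n x \<Longrightarrow> hsupp n (T x)"
proof (induction arbitrary: x rule: hop.induct)
  case (hop_lift n T)
  have "hsupp n (T (slice c x))" for c
    by (rule hop_lift.IH[OF hsupp_slice[OF hop_lift.prems]])
  then show ?case
    by (simp add: hlift_def hsupp_mk)
qed (simp_all add: hN_def hN'_def hB_def hsupp_mk hsupp_slice hsupp_zero hsupp_uminus hsupp_diff)

text \<open>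
  Every root vector acts through transvections \<open>t\<close>, because \<open>t - 1\<close> is a product of a creation
  operator and an annihilation operator.
\<close>

lemma Phi_hN: "Suc n \<le> g \<Longrightarrow> Phi g (Suc n) (hN x) = cr n (an (g + n) (Phi g (Suc n) x))"
  by (simp add: hN_def pair_def lin_Phi lin_cr lin_an an_cr an_Phi cr_same)

lemma Phi_hN': "Suc n \<le> g \<Longrightarrow> Phi g (Suc n) (hN' x) = cr (g + n) (an n (Phi g (Suc n) x))"
  by (simp add: hN'_def pair_def lin_Phi lin_cr lin_an an_cr an_Phi cr_same)

lemma Phi_hB:
  assumes "Suc (Suc n) \<le> g"
  shows "Phi g (Suc (Suc n)) (hB x) =
    cr (g + Suc n) (an n (Phi g (Suc (Suc n)) x)) + cr (g + n) (an (Suc n) (Phi g (Suc (Suc n)) x))"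
proof -
  have z: "an n (Phi g n y) = 0" "an (Suc n) (Phi g n y) = 0" for y :: "'a hfun"
    using assms by (simp_all add: an_Phi)
  have a: "cr (g + Suc n) (cr (g + n) y) = - cr (g + n) (cr (g + Suc n) y)"
    "cr (g + Suc n) (cr (Suc n) y) = - cr (Suc n) (cr (g + Suc n) y)"
    "cr (g + Suc n) (cr n y) = - cr n (cr (g + Suc n) y)"
    "cr (g + n) (cr (Suc n) y) = - cr (Suc n) (cr (g + n) y)"
    "cr (g + n) (cr n y) = - cr n (cr (g + n) y)"
    "cr (Suc n) (cr n y) = - cr n (cr (Suc n) y)" for y :: "'a ext"
    by (rule cr_anticommute)+
  have ne: "n \<noteq> g + n" "n \<noteq> g + Suc n" "Suc n \<noteq> g + n" "Suc n \<noteq> g + Suc n"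
    using assms by auto
  have l: "an n (cr n y) = y - cr n (an n y)" "an (Suc n) (cr (Suc n) y) = y - cr (Suc n) (an (Suc n) y)"
    "an n (cr (Suc n) y) = - cr (Suc n) (an n y)" "an (Suc n) (cr n y) = - cr n (an (Suc n) y)"
    "an n (cr (g + n) y) = - cr (g + n) (an n y)" "an n (cr (g + Suc n) y) = - cr (g + Suc n) (an n y)"
    "an (Suc n) (cr (g + n) y) = - cr (g + n) (an (Suc n) y)"
    "an (Suc n) (cr (g + Suc n) y) = - cr (g + Suc n) (an (Suc n) y)" for y :: "'a ext"
    using ne by (simp_all add: an_cr del: add_Suc_right)
  show ?thesis
    by (simp only: Phi.simps hB_def slice_mk pair_def lin_Phi lin_cr lin_an l z a cr_same
        add_0_left add_0_right diff_0_right minus_zero minus_minus linop_zero[OF linop_slice])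
      (simp add: algebra_simps)
qed

lemma Phi_hlift:
  assumes "\<And>x. Phi g n (T x) = D (Phi g n x)" "linop D"
    and "\<And>x. D (cr n x) = cr n (D x)" "\<And>x. D (cr (g + n) x) = cr (g + n) (D x)"
  shows "Phi g (Suc n) (hlift T x) = D (Phi g (Suc n) x)"
  by (simp add: hlift_def assms(1,3,4) linop_add[OF assms(2)] pair_def)

text \<open>Closure under addition and negation, without scalars, lets the same notion serve for
  integral lattices, for sets of integral vectors defined through their reductions, and for
  submodules modulo p.\<close>

definition sp_stable :: "nat \<Rightarrow> 'a::comm_ring_1 ext set \<Rightarrow> bool" where
  "sp_stable g W \<longleftrightarrow> W \<subseteq> ext_space g \<and> (\<forall>x\<in>W. \<forall>y\<in>W. x + y \<in> W) \<and> (\<forall>x\<in>W. - x \<in> W)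
     \<and> (\<forall>A\<in>carrier (Sp g). \<forall>x\<in>W. ext_act g A x \<in> W)"

lemma sp_stable_diff: "sp_stable g W \<Longrightarrow> x \<in> W \<Longrightarrow> y \<in> W \<Longrightarrow> x - y \<in> W"
  unfolding sp_stable_def by (metis add_uminus_conv_diff)

lemma crv_delta:
  assumes "s < N" "\<And>i. i < N \<Longrightarrow> v i = (if i = s then c else 0)"
  shows "crv N v x = scal c (cr s x)" and "anv N v x = scal c (an s x)"
proof -
  have "crv N v x = (\<Sum>i<N. if s = i then scal c (cr i x) else 0)"
    unfolding crv_def using assms(2) by (intro sum.cong) auto
  then show "crv N v x = scal c (cr s x)"
    using assms(1) by simp
  have "anv N v x = (\<Sum>i<N. if s = i then scal c (an i x) else 0)"
    unfolding anv_def using assms(2) by (intro sum.cong) auto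
  then show "anv N v x = scal c (an s x)"
    using assms(1) by simp
qed

lemma crv_delta2:
  assumes "s < N" "t < N" "\<And>i. i < N \<Longrightarrow> v i = (if i = s then c else 0) + (if i = t then c else 0)"
  shows "crv N v x = scal c (cr s x + cr t x)" and "anv N v x = scal c (an s x + an t x)"
proof -
  have "crv N v x = (\<Sum>i<N. (if s = i then scal c (cr i x) else 0) + (if t = i then scal c (cr i x) else 0))"
    unfolding crv_def using assms(3)
    by (intro sum.cong) (auto simp: fun_eq_iff fun_apply algebra_simps)
  then show "crv N v x = scal c (cr s x + cr t x)"
    using assms(1,2) by (simp add: sum.distrib scal_add)
  have "anv N v x = (\<Sum>i<N. (if s = i then scal c (an i x) else 0) + (if t = i then scal c (an i x) else 0))"
    unfolding anv_def using assms(3)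
    by (intro sum.cong) (auto simp: fun_eq_iff fun_apply algebra_simps)
  then show "anv N v x = scal c (an s x + an t x)"
    using assms(1,2) by (simp add: sum.distrib scal_add)
qed

lemma sp_stable_transvection:
  fixes W :: "'a::comm_ring_1 ext set"
  assumes W: "sp_stable g W" and x: "x \<in> W"
  shows "crv (2 * g) (\<lambda>i. of_int (v i)) (anv (2 * g) (\<lambda>j. of_int (tv_dual g v j)) x) \<in> W"
proof -
  have "x \<in> ext_space g" "ext_act g (transvection g v) x \<in> W"
    using W x transvection_Sp by (auto simp: sp_stable_def)
  then show ?thesis
    using sp_stable_diff[OF W _ x, of "ext_act g (transvection g v) x"]
    by (simp add: ext_act_transvection)
qed

lemma sp_stable_N:
  fixes W :: "'a::comm_ring_1 ext set"
  assumes W: "sp_stable g W" and x: "x \<in> W" and n: "n < g"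
  shows "cr n (an (g + n) x) \<in> W"
proof -
  define v :: "nat \<Rightarrow> int" where "v i = (if i = n then 1 else 0)" for i
  have c: "crv (2 * g) (\<lambda>i. of_int (v i)) y = cr n y" for y :: "'a ext"
    using n by (subst crv_delta(1)[of n _ _ 1]) (auto simp: v_def)
  have a: "anv (2 * g) (\<lambda>j. of_int (tv_dual g v j)) y = an (g + n) y" for y :: "'a ext"
    using n by (subst crv_delta(2)[of "g + n" _ _ 1]) (auto simp: v_def tv_dual_def)
  show ?thesis
    using sp_stable_transvection[OF W x, of v] by (simp add: c a)
qed

lemma sp_stable_N':
  fixes W :: "'a::comm_ring_1 ext set"
  assumes W: "sp_stable g W" and x: "x \<in> W" and n: "n < g"
  shows "cr (g + n) (an n x) \<in> W"
proof -
  define v :: "nat \<Rightarrow> int" where "v i = (if i = g + n then 1 else 0)" for i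
  have c: "crv (2 * g) (\<lambda>i. of_int (v i)) y = cr (g + n) y" for y :: "'a ext"
    using n by (subst crv_delta(1)[of "g + n" _ _ 1]) (auto simp: v_def)
  have a: "anv (2 * g) (\<lambda>j. of_int (tv_dual g v j)) y = scal (- 1) (an n y)" for y :: "'a ext"
    using n by (subst crv_delta(2)[of n _ _ "- 1"]) (auto simp: v_def tv_dual_def)
  have "- cr (g + n) (an n x) \<in> W"
    using sp_stable_transvection[OF W x, of v] by (simp add: c a lin_cr scal_minus_left)
  moreover have "- y \<in> W" if "y \<in> W" for y
    using W that by (auto simp: sp_stable_def)
  ultimately show ?thesis
    by fastforce
qed

text \<open>Polarisation: the rank one operator of the sum of two classes b, minus those of the two
  classes, leaves the mixed terms. The dual functional contributes the global sign.\<close>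

lemma sp_stable_B:
  fixes W :: "'a::comm_ring_1 ext set"
  assumes W: "sp_stable g W" and x: "x \<in> W" and n: "Suc n < g"
  shows "cr (g + Suc n) (an n x) + cr (g + n) (an (Suc n) x) \<in> W"
proof -
  define v :: "nat \<Rightarrow> int" where "v i = (if i = g + n then 1 else 0) + (if i = g + Suc n then 1 else 0)" for i
  have c: "crv (2 * g) (\<lambda>i. of_int (v i)) y = cr (g + n) y + cr (g + Suc n) y" for y :: "'a ext"
    using n by (subst crv_delta2(1)[of "g + n" _ "g + Suc n" _ 1]) (auto simp: v_def)
  have a: "anv (2 * g) (\<lambda>j. of_int (tv_dual g v j)) y = scal (- 1) (an n y + an (Suc n) y)" for y :: "'a ext"
    using n by (subst crv_delta2(2)[of n _ "Suc n" _ "- 1"]) (auto simp: v_def tv_dual_def)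
  define y where "y = crv (2 * g) (\<lambda>i. of_int (v i)) (anv (2 * g) (\<lambda>j. of_int (tv_dual g v j)) x)"
  have "- y - cr (g + n) (an n x) - cr (g + Suc n) (an (Suc n) x)
      = cr (g + Suc n) (an n x) + cr (g + n) (an (Suc n) x)"
    by (simp add: y_def c a lin_cr scal_minus_left)
  moreover have "- y \<in> W"
    using sp_stable_transvection[OF W x, of v] W by (auto simp: sp_stable_def y_def)
  then have "- y - cr (g + n) (an n x) - cr (g + Suc n) (an (Suc n) x) \<in> W"
    using n by (intro sp_stable_diff[OF W] sp_stable_N'[OF W x]) auto
  ultimately show ?thesis by metis
qed

lemma hop_realize:
  fixes T :: "'a::comm_ring_1 hfun \<Rightarrow> 'a hfun"
  assumes "hop n T" "n \<le> g" and W: "sp_stable g W"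
  shows "\<exists>D. (\<forall>x. Phi g n (T x) = D (Phi g n x)) \<and> linop D
    \<and> (\<forall>s x. n \<le> s \<and> s < g \<or> g + n \<le> s \<longrightarrow> D (cr s x) = cr s (D x)) \<and> (\<forall>x\<in>W. D x \<in> W)"
  using assms(1,2)
proof (induction rule: hop.induct)
  case (hop_id n)
  show ?case
    by (rule exI[of _ "\<lambda>x. x"]) (simp add: linop_id)
next
  case (hop_comp n S T)
  then obtain D1 D2 where
    1: "\<And>x. Phi g n (S x) = D1 (Phi g n x)" "linop D1"
      "\<And>s x. n \<le> s \<and> s < g \<or> g + n \<le> s \<Longrightarrow> D1 (cr s x) = cr s (D1 x)" "\<And>x. x \<in> W \<Longrightarrow> D1 x \<in> W"
    and 2: "\<And>x. Phi g n (T x) = D2 (Phi g n x)" "linop D2"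
      "\<And>s x. n \<le> s \<and> s < g \<or> g + n \<le> s \<Longrightarrow> D2 (cr s x) = cr s (D2 x)" "\<And>x. x \<in> W \<Longrightarrow> D2 x \<in> W"
    by metis
  show ?case
    by (rule exI[of _ "\<lambda>x. D1 (D2 x)"]) (simp add: 1 2 linop_comp)
next
  case (hop_N n)
  have "linop (\<lambda>x. cr n (an (g + n) x))"
    by (rule linop_comp[OF linop_cr linop_an])
  moreover have "cr n (an (g + n) (cr s x)) = cr s (cr n (an (g + n) x))"
    if "Suc n \<le> s \<and> s < g \<or> g + Suc n \<le> s" for s and x :: "'a ext"
  proof -
    have "s \<noteq> g + n" using that hop_N by auto
    then show ?thesis
      by (simp add: an_cr lin_cr cr_anticommute[of n s])
  qed
  ultimately show ?case
    using hop_N sp_stable_N[OF W]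
    by (intro exI[of _ "\<lambda>x. cr n (an (g + n) x)"]) (simp add: Phi_hN del: Phi.simps)
next
  case (hop_N' n)
  have "linop (\<lambda>x. cr (g + n) (an n x))"
    by (rule linop_comp[OF linop_cr linop_an])
  moreover have "cr (g + n) (an n (cr s x)) = cr s (cr (g + n) (an n x))"
    if "Suc n \<le> s \<and> s < g \<or> g + Suc n \<le> s" for s and x :: "'a ext"
  proof -
    have "s \<noteq> n" using that hop_N' by auto
    then show ?thesis
      by (simp add: an_cr lin_cr cr_anticommute[of "g + n" s])
  qed
  ultimately show ?case
    using hop_N' sp_stable_N'[OF W]
    by (intro exI[of _ "\<lambda>x. cr (g + n) (an n x)"]) (simp add: Phi_hN' del: Phi.simps)
next
  case (hop_B n)
  have "linop (\<lambda>x. cr (g + Suc n) (an n x) + cr (g + n) (an (Suc n) x))"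
    by (intro linop_plus linop_comp[OF linop_cr linop_an])
  moreover have "cr (g + Suc n) (an n (cr s x)) + cr (g + n) (an (Suc n) (cr s x))
      = cr s (cr (g + Suc n) (an n x) + cr (g + n) (an (Suc n) x))"
    if "Suc (Suc n) \<le> s \<and> s < g \<or> g + Suc (Suc n) \<le> s" for s and x :: "'a ext"
  proof -
    have "s \<noteq> n" "s \<noteq> Suc n" using that hop_B by auto
    then show ?thesis
      by (simp add: an_cr lin_cr cr_anticommute[of "g + n" s] cr_anticommute[of "Suc (g + n)" s])
  qed
  ultimately show ?case
    using hop_B sp_stable_B[OF W]
    by (intro exI[of _ "\<lambda>x. cr (g + Suc n) (an n x) + cr (g + n) (an (Suc n) x)"])
      (simp add: Phi_hB del: Phi.simps add_Suc_right)
next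
  case (hop_lift n T)
  then obtain D where D: "\<And>x. Phi g n (T x) = D (Phi g n x)" "linop D"
      "\<And>s x. n \<le> s \<and> s < g \<or> g + n \<le> s \<Longrightarrow> D (cr s x) = cr s (D x)" "\<forall>x\<in>W. D x \<in> W"
    by (metis Suc_leD)
  have "Phi g (Suc n) (hlift T x) = D (Phi g (Suc n) x)" for x
    using hop_lift.prems by (intro Phi_hlift D) auto
  moreover have "D (cr s x) = cr s (D x)" if "Suc n \<le> s \<and> s < g \<or> g + Suc n \<le> s" for s x
    using that by (intro D(3)) auto
  ultimately show ?case
    using D(2,4) by blast
qed

lemma hop_stable:
  assumes "hop g T" "sp_stable g W" "Phi g g x \<in> W"
  shows "Phi g g (T x) \<in> W"
  using hop_realize[OF assms(1) order_refl assms(2)] assms(3) by metis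

lemma sp_stable_V_int: "sp_stable g (V_int k g)"
  unfolding sp_stable_def
proof (intro conjI ballI)
  show "V_int k g \<subseteq> ext_space g"
    using V_int_ext_space by blast
  fix x assume x: "x \<in> V_int k g"
  then obtain X where X: "x = Phi g g X" "X \<in> LV k g"
    by (auto simp: V_int_eq)
  show "- x \<in> V_int k g"
    unfolding V_int_eq by (rule image_eqI[OF _ LV_uminus[OF X(2)]]) (simp add: X lin_Phi)
  show "ext_act g A x \<in> V_int k g" if "A \<in> carrier (Sp g)" for A
    by (rule ext_act_V_int[OF that x])
  fix y assume "y \<in> V_int k g"
  then obtain Y where Y: "y = Phi g g Y" "Y \<in> LV k g"
    by (auto simp: V_int_eq)
  show "x + y \<in> V_int k g"
    unfolding V_int_eq by (rule image_eqI[OF _ LV_add[OF X(2) Y(2)]]) (simp add: X Y lin_Phi)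
qed

lemma LV_hsupp: "x \<in> LV k n \<Longrightarrow> hsupp n x"
  by (auto simp: LV_def homog_def hsupp_def)

text \<open>Stability is inherited from the symplectic action on \<open>V_int\<close> instead of
  being computed with \<open>hF\<close>; the support conditions permit the transfer back to
  words.\<close>

lemma hop_LV:
  assumes "hop g T" "X \<in> LV k g"
  shows "T X \<in> LV k g"
proof -
  have "Phi g g X \<in> V_int k g"
    using assms(2) by (auto simp: V_int_eq)
  then have "Phi g g (T X) \<in> V_int k g"
    by (rule hop_stable[OF assms(1) sp_stable_V_int])
  then obtain Y where Y: "Phi g g (T X) = Phi g g Y" "Y \<in> LV k g"
    by (auto simp: V_int_eq)
  have "T X L = Y L" for L
  proof (cases "length L = g")
    case True
    then show ?thesis by (rule Phi_inject[OF Y(1)])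
  next
    case False
    then show ?thesis
      using hsupp_hop[OF assms(1) LV_hsupp[OF assms(2)]] LV_hsupp[OF Y(2)]
      unfolding hsupp_def by metis
  qed
  then have "T X = Y" by (rule ext)
  with Y(2) show ?thesis by simp
qed


section \<open>Generation by a highest weight vector\<close>

definition hclosed :: "nat \<Rightarrow> 'a::comm_ring_1 hfun set \<Rightarrow> bool" where
  "hclosed n G \<longleftrightarrow> (\<forall>T x. hop n T \<longrightarrow> x \<in> G \<longrightarrow> T x \<in> G)"

lemma hclosedD: "hclosed n G \<Longrightarrow> hop n T \<Longrightarrow> x \<in> G \<Longrightarrow> T x \<in> G"
  by (auto simp: hclosed_def)

lemma hop_zero: "hop n T \<Longrightarrow> T 0 = 0"
  by (rule linop_zero[OF linop_hop])

lemma mk_uminus: "- mk u a b w = mk (- u) (- a) (- b) (- w)"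
  by (rule mk_eqI) (auto simp: fun_eq_iff fun_apply)

lemma hlift_mk: "hlift T (mk u a b w) = mk (T u) (T a) (T b) (T w)"
  by (simp add: hlift_def)

lemma hclosed_slice:
  fixes G :: "'a::comm_ring_1 hfun set"
  assumes "hclosed (Suc n) G"
  shows "hclosed n {y. mk y 0 0 0 \<in> G}" "hclosed n {y. mk 0 y 0 0 \<in> G}"
    "hclosed n {y. \<exists>r. mk r 0 0 y \<in> G}"
proof -
  have *: "hlift T x \<in> G" if "hop n T" "x \<in> G" for T x
    using hclosedD[OF assms hop_lift[OF that(1)] that(2)] .
  show "hclosed n {y. mk y 0 0 0 \<in> G}"
    unfolding hclosed_def using *[of _ "mk _ 0 0 0"] by (auto simp: hlift_mk hop_zero)
  show "hclosed n {y. mk 0 y 0 0 \<in> G}"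
    unfolding hclosed_def using *[of _ "mk 0 _ 0 0"] by (auto simp: hlift_mk hop_zero)
  show "hclosed n {y. \<exists>r. mk r 0 0 y \<in> G}"
    unfolding hclosed_def
  proof (intro allI impI)
    fix T :: "'a hfun \<Rightarrow> 'a hfun" and y assume T: "hop n T" and "y \<in> {y. \<exists>r. mk r 0 0 y \<in> G}"
    then obtain r where "mk r 0 0 y \<in> G" by blast
    from *[OF T this] have "mk (T r) 0 0 (T y) \<in> G"
      by (simp add: hlift_mk hop_zero[OF T])
    then show "T y \<in> {y. \<exists>r. mk r 0 0 y \<in> G}" by blast
  qed
qed

lemma hbasis_Cons_Nil: "hbasis (c # L) [] = 0"
  by (simp add: hbasis_def)

lemma hbasis_Cons:
  "hbasis (H0 # L) = mk (hbasis L) 0 0 0" "hbasis (Ha # L) = mk 0 (hbasis L) 0 0"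
  "hbasis (Hb # L) = mk 0 0 (hbasis L) 0" "hbasis (Hab # L) = mk 0 0 0 (hbasis L)"
  by (rule mk_eqI; simp add: slice_hbasis hbasis_Cons_Nil)+

text \<open>The commutator of \<open>hN\<close> and \<open>hB\<close> moves \<open>a\<close> from the second handle to the first.\<close>

lemma hbasis_move:
  assumes "hclosed n G" "hbasis (replicate r H0 @ Ha # Z) \<in> G" "n = r + Suc (length Z)"
  shows "hbasis (Ha # replicate r H0 @ Z) \<in> G"
  using assms
proof (induction r arbitrary: n G)
  case (Suc r)
  define m where "m = r + length Z"
  have n: "n = Suc (Suc m)"
    using Suc.prems(3) by (simp add: m_def)
  have "hbasis (Ha # replicate r H0 @ Z) \<in> {y. mk y 0 0 0 \<in> G}"
  proof (rule Suc.IH)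
    show "hclosed (Suc m) {y. mk y 0 0 0 \<in> G}"
      using Suc.prems(1) unfolding n by (rule hclosed_slice)
    show "hbasis (replicate r H0 @ Ha # Z) \<in> {y. mk y 0 0 0 \<in> G}"
      using Suc.prems(2) by (simp add: hbasis_Cons)
  qed (simp add: m_def)
  then have 1: "mk (mk 0 (hbasis (replicate r H0 @ Z)) 0 0) 0 0 0 \<in> G"
    by (simp add: hbasis_Cons)
  \<comment> \<open>On 1 \<otimes> a the operator \<open>hB\<close> gives b \<otimes> 1, which
    \<open>hN\<close> turns into a \<otimes> 1. The other term of the commutator is 0, since the
    first handle carries 1.\<close>
  have "hN (hB x) \<in> G" if "x \<in> G" for x
    using hclosedD[OF Suc.prems(1)[unfolded n] hop_N] hclosedD[OF Suc.prems(1)[unfolded n] hop_B] that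
    by blast
  from this[OF 1] have "mk 0 (mk (hbasis (replicate r H0 @ Z)) 0 0 0) 0 0 \<in> G"
    by (simp add: hN_def hB_def linop_zero[OF linop_slice] mk_simps)
  then show ?case
    by (simp add: hbasis_Cons)
qed simp

lemma hF_hbasis: "Hab \<notin> set L \<Longrightarrow> hF (hbasis L) = 0"
proof (induction L)
  case Nil
  have "hF_at L (hbasis [] :: 'a hfun) = 0 \<and> hF_at L (\<lambda>_. 0 :: 'a) = 0" for L
    by (induction L) (auto simp: hbasis_def slice_def)
  then show ?case by (simp add: hF_def fun_eq_iff fun_apply)
next
  case (Cons c L)
  then show ?case
    by (cases c) (auto simp: hbasis_Cons hF_mk lin_hF)
qed

lemma hdeg_append [simp]: "hdeg (L @ L') = hdeg L + hdeg L'"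
  by (simp add: hdeg_def)

lemma hdeg_replicate [simp]: "hdeg (replicate n c) = n * hwt c"
  by (simp add: hdeg_def sum_list_replicate)

lemma LV_highest_weight:
  assumes "m + j = n + 1" "j \<ge> 1"
  shows "hbasis (replicate (n - m) H0 @ replicate m Ha) \<in> LV j n"
proof -
  have "Hab \<notin> set (replicate (n - m) H0 @ replicate m Ha)"
    by auto
  then have "hF (hbasis (replicate (n - m) H0 @ replicate m Ha) :: int hfun) = 0"
    by (rule hF_hbasis)
  moreover have "homog j n (hbasis (replicate (n - m) H0 @ replicate m Ha) :: int hfun)"
    unfolding homog_def hbasis_def using assms by auto
  ultimately show ?thesis
    by (simp add: LV_def)
qed

lemma LV_too_high: "x \<in> LV j n \<Longrightarrow> j > n + 1 \<Longrightarrow> x = 0"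
proof
  fix L assume "x \<in> LV j n" "j > n + 1"
  then show "x L = 0 L"
    unfolding LV_def homog_def zero_fun_apply by (cases "x L = 0") auto
qed

text \<open>The coordinates in the first handle give a filtration that is matched step by step, so
  nothing has to be divided. The slices of \<open>G\<close> at 1, a and a \<and> b are again stable,
  and moving none, one or two of the factors a to the front shows that each contains the highest
  weight vector of its own index, as long as that index does not force the module to be 0.\<close>

lemma LV_generated:
  assumes "G \<subseteq> LV j n" "\<And>x y. x \<in> G \<Longrightarrow> y \<in> G \<Longrightarrow> x + y \<in> G" "\<And>x. x \<in> G \<Longrightarrow> - x \<in> G"
    and "hclosed n G" "m + j = n + 1" "j \<ge> 1"
    and "hbasis (replicate (n - m) H0 @ replicate m Ha) \<in> G"
  shows "LV j n \<subseteq> G"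
  using assms
proof (induction n arbitrary: j m G)
  case 0
  then have j: "j = 1" "m = 0" by auto
  have b: "hbasis [] \<in> G" using 0 j by simp
  have z: "scal 0 (hbasis []) \<in> G"
    using 0(2)[OF b 0(3)[OF b]] by simp
  have nat: "scal (int i) (hbasis []) \<in> G" for i
  proof (induction i)
    case (Suc i)
    have "scal (int (Suc i)) (hbasis []) = hbasis [] + scal (int i) (hbasis [])"
      by (simp add: fun_eq_iff fun_apply algebra_simps)
    then show ?case
      using 0(2)[OF b Suc] by simp
  qed (use z in simp)
  have all: "scal i (hbasis []) \<in> G" for i
  proof (cases "i \<ge> 0")
    case True
    then show ?thesis using nat[of "nat i"] by simp
  next
    case False
    then show ?thesis using 0(3)[OF nat[of "nat (- i)"]] by (simp add: scal_minus_left)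
  qed
  show ?case
  proof
    fix x assume "x \<in> LV j 0"
    then have "x L = scal (x []) (hbasis []) L" for L
      using LV_hsupp[of x j 0] unfolding hsupp_def by (auto simp: fun_apply hbasis_def)
    then have "x = scal (x []) (hbasis [])" by (rule ext)
    then show "x \<in> G" using all by metis
  qed
next
  case (Suc n)
  note G = Suc.prems(1) and add = Suc.prems(2) and neg = Suc.prems(3) and cl = Suc.prems(4)
    and gen = Suc.prems(7)
  obtain i where j: "j = Suc i"
    using Suc.prems(6) by (cases j) auto
  have zero: "0 \<in> G"
    using add[OF gen neg[OF gen]] by simp
  define GU where "GU = {y. mk y 0 0 0 \<in> G}"
  define GA where "GA = {y. mk 0 y 0 0 \<in> G}"
  \<comment> \<open>The coordinate of 1 is left free: membership in the kernel forces
    \<open>hF r = - y\<close>, so it cannot be asked to vanish.\<close>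
  define GW where "GW = {y. \<exists>r. mk r 0 0 y \<in> G}"
  have cls: "hclosed n GU" "hclosed n GA" "hclosed n GW"
    unfolding GU_def GA_def GW_def by (rule hclosed_slice[OF cl])+
  have sub: "GU \<subseteq> LV i n" "GA \<subseteq> LV j n" "GW \<subseteq> LV (Suc j) n"
  proof -
    have G': "mk u a b w \<in> LV (Suc i) (Suc n)" if "mk u a b w \<in> G" for u a b w
      using that G unfolding j by blast
    show "GU \<subseteq> LV i n"
    proof
      fix y assume "y \<in> GU"
      then have "mk y 0 0 0 \<in> LV (Suc i) (Suc n)" by (simp add: GU_def G')
      then have "homog i n y" "hF y = 0" by (simp_all add: LV_mk)
      then show "y \<in> LV i n" by (simp add: LV_def)
    qed
    show "GA \<subseteq> LV j n"
    proof
      fix y assume "y \<in> GA"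
      then have "mk 0 y 0 0 \<in> LV (Suc i) (Suc n)" by (simp add: GA_def G')
      then show "y \<in> LV j n" by (simp add: LV_mk j)
    qed
    show "GW \<subseteq> LV (Suc j) n"
    proof
      fix y assume "y \<in> GW"
      then obtain r where "mk r 0 0 y \<in> G" by (auto simp: GW_def)
      from G'[OF this] show "y \<in> LV (Suc j) n" by (simp add: LV_mk j)
    qed
  qed
  have adds: "x + y \<in> GU" if "x \<in> GU" "y \<in> GU" for x y
    using add[of "mk x 0 0 0" "mk y 0 0 0"] that by (simp add: GU_def mk_simps)
  have negs: "- x \<in> GU" if "x \<in> GU" for x
    using neg[of "mk x 0 0 0"] that by (simp add: GU_def mk_uminus)
  have adda: "x + y \<in> GA" if "x \<in> GA" "y \<in> GA" for x y
    using add[of "mk 0 x 0 0" "mk 0 y 0 0"] that by (simp add: GA_def mk_simps)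
  have nega: "- x \<in> GA" if "x \<in> GA" for x
    using neg[of "mk 0 x 0 0"] that by (simp add: GA_def mk_uminus)
  have addw: "x + y \<in> GW" if "x \<in> GW" "y \<in> GW" for x y
  proof -
    from that obtain r r' where "mk r 0 0 x \<in> G" "mk r' 0 0 y \<in> G" by (auto simp: GW_def)
    from add[OF this] show ?thesis by (auto simp: GW_def mk_simps)
  qed
  have negw: "- x \<in> GW" if "x \<in> GW" for x
  proof -
    from that obtain r where "mk r 0 0 x \<in> G" by (auto simp: GW_def)
    from neg[OF this] show ?thesis
      by (auto simp: GW_def mk_uminus)
  qed
  define r where "r = Suc n - m"
  have rm: "r + m = Suc n"
    using Suc.prems by (simp add: r_def)
  have A: "hbasis (replicate r H0 @ replicate (m - 1) Ha) \<in> GA" if "m \<ge> 1"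
  proof -
    have "replicate m Ha = Ha # replicate (m - 1) Ha"
      using that by (cases m) auto
    then have "hbasis (Ha # replicate r H0 @ replicate (m - 1) Ha) \<in> G"
      using gen rm that by (intro hbasis_move[OF cl]) (auto simp: r_def)
    then show ?thesis by (simp add: GA_def hbasis_Cons)
  qed
  have LA: "LV j n \<subseteq> GA"
  proof (cases "m \<ge> 1")
    case True
    then have "n - (m - 1) = r" "(m - 1) + j = n + 1"
      using rm Suc.prems by auto
    then show ?thesis
      using A[OF True] by (intro Suc.IH[OF sub(2) adda nega cls(2), of "m - 1"] Suc.prems) auto
  next
    case False
    then have "j > n + 1" using Suc.prems by simp
    then have "LV j n \<subseteq> {0}" using LV_too_high by blast
    then show ?thesis using zero by (auto simp: GA_def mk_simps)
  qed
  have LU: "LV i n \<subseteq> GU"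
  proof (cases "i \<ge> 1")
    case True
    then have mn: "m \<le> n" using Suc.prems j by simp
    then have "replicate r H0 = H0 # replicate (n - m) H0"
      by (simp add: r_def Suc_diff_le)
    then have "hbasis (replicate (n - m) H0 @ replicate m Ha) \<in> GU"
      using gen by (simp add: GU_def r_def[symmetric] hbasis_Cons)
    then show ?thesis
      using Suc.prems j True by (intro Suc.IH[OF sub(1) adds negs cls(1), of m]) auto
  next
    case False
    then have "i = 0" by simp
    then have "LV i n \<subseteq> {0}" using LV_0 by auto
    then show ?thesis using zero by (auto simp: GU_def mk_simps)
  qed
  have LW: "LV (Suc j) n \<subseteq> GW"
  proof (cases "m \<ge> 2")
    case True
    then obtain n' where n': "n = Suc n'"
      using rm Suc.prems j by (cases n) auto
    define Z where "Z = replicate r H0 @ replicate (m - 2) Ha"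
    have Z: "length Z = n'"
      using rm True n' by (simp add: Z_def)
    have "replicate (m - 1) Ha = Ha # replicate (m - 2) Ha"
    proof -
      have "m - 1 = Suc (m - 2)" using True by simp
      then show ?thesis by (simp only: replicate_Suc)
    qed
    then have "hbasis (Ha # Z) \<in> GA"
      unfolding Z_def using A True rm by (intro hbasis_move[OF cls(2)]) auto
    then have "mk 0 (mk 0 (hbasis Z) 0 0) 0 0 \<in> G"
      by (simp add: GA_def hbasis_Cons)
    \<comment> \<open>On a \<otimes> a the operator \<open>hB\<close> yields (a \<and> b) \<otimes>
      1 - 1 \<otimes> (a \<and> b), which puts a word with \<open>m - 2\<close> factors a behind a
      \<and> b.\<close>
    from hclosedD[OF cl[unfolded n'] hop_B this]
    have "mk (mk 0 0 0 (- hbasis Z)) 0 0 (mk (hbasis Z) 0 0 0) \<in> G"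
      by (simp add: hB_def linop_zero[OF linop_slice] mk_simps)
    then have "hbasis (H0 # Z) \<in> GW"
      by (auto simp: GW_def hbasis_Cons)
    moreover have "replicate (n - (m - 2)) H0 = H0 # replicate r H0"
    proof -
      have "n - (m - 2) = Suc r" using rm True by simp
      then show ?thesis by simp
    qed
    ultimately have "hbasis (replicate (n - (m - 2)) H0 @ replicate (m - 2) Ha) \<in> GW"
      by (simp add: Z_def)
    then show ?thesis
      using Suc.prems True by (intro Suc.IH[OF sub(3) addw negw cls(3), of "m - 2"]) auto
  next
    case False
    then have "Suc j > n + 1" using Suc.prems by simp
    then have "LV (Suc j) n \<subseteq> {0}" using LV_too_high by blast
    moreover have "mk 0 0 0 0 \<in> G" using zero by (simp add: mk_simps)
    ultimately show ?thesis by (auto simp: GW_def)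
  qed
  show ?case
  proof
    fix x assume "x \<in> LV j (Suc n)"
    then obtain u a b w where x: "x = mk u a b w" "homog i n u" "hF u = - w"
      "a \<in> LV j n" "b \<in> LV j n" "w \<in> LV (Suc j) n"
      unfolding j by (rule LV_cases)
    have a: "mk 0 a 0 0 \<in> G" and b: "mk 0 b 0 0 \<in> G"
      using LA x by (auto simp: GA_def)
    from hclosedD[OF cl hop_N' b] have b': "mk 0 0 b 0 \<in> G"
      by (simp add: hN'_def)
    \<comment> \<open>\<open>t\<close> and \<open>u\<close> have the same image under
      \<open>F\<close>, so their difference lies in \<open>LV i n\<close> and can be corrected by
      the slice at 1.\<close>
    obtain t where t: "mk t 0 0 w \<in> G"
      using LW x by (auto simp: GW_def)
    then have "mk t 0 0 w \<in> LV (Suc i) (Suc n)"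
      using G j by auto
    then have t': "homog i n t" "hF t = - w"
      by (auto simp: LV_mk)
    have "homog i n (u + scal (- 1) t)"
      by (intro homog_add homog_scal x t')
    moreover have "hF (u + scal (- 1) t) = 0"
      unfolding lin_hF(1,2) x(3) t'(2) by (simp add: scal_minus_left)
    ultimately have "u + scal (- 1) t \<in> LV i n"
      by (simp only: LV_def mem_Collect_eq conj_absorb)
    then have "mk (u + scal (- 1) t) 0 0 0 \<in> G"
      using LU by (auto simp: GU_def)
    from add[OF add[OF this a] add[OF b' t]] show "x \<in> G"
      by (simp add: mk_simps x scal_minus_left)
  qed
qed


section \<open>Irreducibility\<close>

text \<open>
  The products \<open>hN hN'\<close> project to the words with a given entry \<open>a\<close>; composing them projects to a
  highest weight vector.
\<close>

lemma hop_projection: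
  "\<exists>T. hop (r + m) T \<and> (\<forall>(x :: 'a::comm_ring_1 hfun) L. length L = r + m \<longrightarrow>
    T x L = (if drop r L = replicate m Ha then x L else 0))"
proof (induction r)
  case 0
  show ?case
  proof (induction m)
    case 0
    show ?case
      by (rule exI[of _ "\<lambda>x. x"]) (auto intro: hop_id)
  next
    case (Suc m)
    then obtain T where T: "hop m T"
      "\<And>(x :: 'a hfun) L. length L = m \<Longrightarrow> T x L = (if L = replicate m Ha then x L else 0)"
      by auto
    have "hop (Suc m) (\<lambda>x. hlift T (hN (hN' x)))"
      by (intro hop_comp[OF hop_lift[OF T(1)] hop_comp[OF hop_N hop_N']])
    moreover have "hlift T (hN (hN' x)) L = (if L = replicate (Suc m) Ha then x L else 0)"
      if "length L = Suc m" for x :: "'a hfun" and L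
    proof -
      obtain c L' where L: "L = c # L'" "length L' = m"
        using \<open>length L = Suc m\<close> by (metis length_Suc_conv)
      have "hlift T (hN (hN' x)) = mk 0 (T (slice Ha x)) 0 0"
        by (simp add: hN_def hN'_def hlift_mk hop_zero[OF T(1)])
      then show ?thesis
        by (cases c) (simp_all add: L T(2) fun_apply)
    qed
    ultimately show ?case
      by (intro exI[of _ "\<lambda>x. hlift T (hN (hN' x))"]) simp
  qed
next
  case (Suc r)
  then obtain T where T: "hop (r + m) T"
    "\<And>(x :: 'a hfun) L. length L = r + m \<Longrightarrow> T x L = (if drop r L = replicate m Ha then x L else 0)"
    by auto
  have "hlift T x L = (if drop (Suc r) L = replicate m Ha then x L else 0)"
    if "length L = Suc r + m" for x :: "'a hfun" and L
  proof -
    obtain c L' where L: "L = c # L'" "length L' = r + m"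
      using \<open>length L = Suc r + m\<close> by (metis add_Suc length_Suc_conv)
    then show ?thesis
      by (cases c) (simp_all add: hlift_def T(2))
  qed
  with hop_lift[OF T(1)] show ?case
    by (intro exI[of _ "hlift T"]) simp
qed

lemma hdeg_eq_0: "hdeg L = 0 \<Longrightarrow> L = replicate (length L) H0"
proof (induction L)
  case (Cons c L)
  then show ?case by (cases c) auto
qed simp

lemma ext_space_red: "x \<in> ext_space g \<Longrightarrow> red x \<in> ext_space g"
  by (auto simp: ext_space_def fun_apply)

lemma hclosed_LV_stable:
  assumes "sp_stable g W"
  shows "hclosed g {X \<in> LV k g. Phi g g X \<in> W}"
  unfolding hclosed_def using hop_LV hop_stable[OF _ assms] by blast

lemma sp_stable_generated:
  assumes W: "sp_stable g W" and mk: "m + k = g + 1" "k \<ge> 1"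
    and v: "Phi g g (hbasis (replicate (g - m) H0 @ replicate m Ha)) \<in> W"
  shows "V_int k g \<subseteq> W"
proof -
  define G where "G = {X \<in> LV k g. Phi g g X \<in> W}"
  have "LV k g \<subseteq> G"
  proof (rule LV_generated[OF _ _ _ _ mk])
    show "hclosed g G"
      unfolding G_def by (rule hclosed_LV_stable[OF W])
    show "hbasis (replicate (g - m) H0 @ replicate m Ha) \<in> G"
      using v LV_highest_weight[OF mk] by (simp add: G_def)
    show "x + y \<in> G" if "x \<in> G" "y \<in> G" for x y
      using that W by (auto simp: G_def LV_add lin_Phi sp_stable_def)
    show "- x \<in> G" if "x \<in> G" for x
      using that W by (auto simp: G_def LV_uminus lin_Phi sp_stable_def)
  qed (auto simp: G_def)
  then show ?thesis
    by (auto simp: V_int_eq G_def)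
qed

lemma V_mod_simps:
  fixes P :: "'p::prime_card itself"
  shows "carrier (V_mod P k g) = red ` V_int k g" "zero (V_mod P k g) = 0"
    "add (V_mod P k g) = (+)" "Module.module.smult (V_mod P k g) = scal"
proof -
  have "reduce x = (red x :: 'p mod_ring ext)" for x
    by (simp add: reduce_def red_def)
  then show "carrier (V_mod P k g) = red ` V_int k g"
    by (simp add: V_mod_def)
qed (simp_all add: V_mod_def fun_eq_iff fun_apply)

text \<open>The integral generation result is used twice: a submodule orthogonal to the highest
  weight vector is orthogonal to everything, and a submodule containing it is everything. In
  between, a projection by root vectors extracts the highest weight vector from a vector not
  orthogonal to it.\<close>

lemma V_mod_submodule_full:
  fixes P :: "'p::prime_card itself"
  assumes k: "k \<ge> 1"
    and WV: "W \<subseteq> carrier (V_mod P k g)"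
    and add: "\<And>x y. x \<in> W \<Longrightarrow> y \<in> W \<Longrightarrow> x + y \<in> W"
    and scal: "\<And>c x. x \<in> W \<Longrightarrow> scal c x \<in> W"
    and act: "\<And>A x. A \<in> carrier (Sp g) \<Longrightarrow> x \<in> W \<Longrightarrow> ext_act g A x \<in> W"
    and null: "\<not> W \<subseteq> V_null P k g"
  shows "W = carrier (V_mod P k g)"
proof -
  have neg: "- x \<in> W" if "x \<in> W" for x
    using scal[OF that, of "- 1"] by (simp add: scal_minus_left)
  have W_space: "x \<in> ext_space g" if "x \<in> W" for x
    using that WV by (auto simp: V_mod_simps intro: ext_space_red V_int_ext_space)
  have W: "sp_stable g W"
    using add neg act W_space by (auto simp: sp_stable_def)
  obtain w0 where w0: "w0 \<in> W" "w0 \<notin> V_null P k g"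
    using null by blast
  obtain m where m: "m + k = g + 1"
  proof (cases "k \<le> g + 1")
    case True
    then show ?thesis using that[of "g + 1 - k"] by simp
  next
    case False
    then have "V_int k g = {0}"
      by (simp add: V_int_def zero_fun_def)
    then have "w0 = 0"
      using w0(1) WV by (auto simp: V_mod_simps red_simps)
    then have "w0 \<in> V_null P k g"
      using w0(1) WV by (auto simp: V_null_def ext_inner_zero)
    with w0(2) show ?thesis by simp
  qed
  define L0 where "L0 = replicate (g - m) H0 @ replicate m Ha"
  define v :: "int ext" where "v = Phi g g (hbasis L0)"
  have L0: "length L0 = g"
    using m k by (simp add: L0_def)
  have "\<exists>w\<in>W. ext_inner g w (red v) \<noteq> 0"
  proof (rule ccontr)
    assume neg: "\<not> (\<exists>w\<in>W. ext_inner g w (red v) \<noteq> 0)"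
    \<comment> \<open>The integral vectors whose reductions are orthogonal to \<open>W\<close>. This
      set is stable because the adjoint of a symplectic matrix is symplectic and preserves
      \<open>W\<close>.\<close>
    define Q where "Q = {y \<in> ext_space g. \<forall>w\<in>W. ext_inner g w (red y) = 0}"
    have "sp_stable g Q"
      unfolding sp_stable_def
    proof (intro conjI ballI)
      show "Q \<subseteq> ext_space g" by (auto simp: Q_def)
      show "x + y \<in> Q" if "x \<in> Q" "y \<in> Q" for x y
        using that by (auto simp: Q_def ext_space_add red_simps ext_inner_simps)
      show "- x \<in> Q" if "x \<in> Q" for x
        using that by (auto simp: Q_def ext_space_uminus red_simps ext_inner_simps)
      show "ext_act g A x \<in> Q" if A: "A \<in> carrier (Sp g)" and x: "x \<in> Q" for A x
      proof -
        have xs: "x \<in> ext_space g" using x by (simp add: Q_def)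
        have "ext_inner g w (red (ext_act g A x)) = 0" if w: "w \<in> W" for w
        proof -
          have At: "transpose_mat A \<in> carrier_mat (2 * g) (2 * g)"
            using A by (simp add: carrier_Sp)
          have "ext_inner g w (red (ext_act g A x)) = ext_inner g w (ext_act g (transpose_mat (transpose_mat A)) (red x))"
            by (simp add: ext_act_red[OF xs])
          also have "\<dots> = ext_inner g (ext_act g (transpose_mat A) w) (red x)"
            by (rule ext_act_adjoint[OF At W_space[OF w] ext_space_red[OF xs], symmetric])
          also have "\<dots> = 0"
            using x act[OF Sp_transpose[OF A] w] by (simp add: Q_def)
          finally show ?thesis .
        qed
        then show ?thesis
          by (simp add: Q_def ext_space_ext_act)
      qed
    qed
    moreover have "v \<in> Q"
      using neg by (auto simp: Q_def v_def ext_space_Phi)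
    ultimately have "V_int k g \<subseteq> Q"
      unfolding v_def L0_def by (rule sp_stable_generated[OF _ m k])
    then have "w0 \<in> V_null P k g"
      using w0(1) WV by (auto simp: V_null_def V_mod_simps Q_def)
    with w0(2) show False by simp
  qed
  then obtain w where w: "w \<in> W" "ext_inner g w (red v) \<noteq> 0" by blast
  obtain X where X: "w = red (Phi g g X)" "X \<in> LV k g"
    using w(1) WV by (auto simp: V_mod_simps V_int_eq)
  define x :: "'p mod_ring hfun" where "x = red X"
  have wx: "w = Phi g g x"
    by (simp add: X x_def red_Phi)
  have rb: "red (hbasis L0) = (hbasis L0 :: 'p mod_ring hfun)"
    by (auto simp: hbasis_def fun_eq_iff fun_apply)
  have rv: "red v = (Phi g g (hbasis L0) :: 'p mod_ring ext)"
    by (simp add: v_def red_Phi rb)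
  have x0: "x L0 \<noteq> 0"
    using w(2) by (simp add: wx rv ext_inner_Phi hdot_hbasis L0)
  have xh: "homog k g x"
    using X(2) by (simp add: x_def homog_red LV_def)
  have gm: "g - m + m = g"
    using m k by simp
  obtain T where T: "hop (g - m + m) T"
    "\<And>(x :: 'p mod_ring hfun) L. length L = g - m + m \<Longrightarrow>
      T x L = (if drop (g - m) L = replicate m Ha then x L else 0)"
    using hop_projection[of "g - m" m] by blast
  have "Phi g g (T x) \<in> W"
    using hop_stable[OF T(1)[unfolded gm] W] w(1) wx by simp
  also have "Phi g g (T x) = Phi g g (scal (x L0) (hbasis L0))"
  proof (rule Phi_cong)
    fix L :: "handle list" assume L: "length L = g"
    show "T x L = scal (x L0) (hbasis L0) L"
    proof (cases "drop (g - m) L = replicate m Ha \<and> x L \<noteq> 0")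
      case True
      \<comment> \<open>The last \<open>m\<close> letters already account for the whole degree, so
        all others are \<open>H0\<close>: homogeneity completes what the projection leaves
        undetermined.\<close>
      then have "hdeg L = m"
        using xh m by (auto simp: homog_def)
      moreover have "hdeg L = hdeg (take (g - m) L) + hdeg (drop (g - m) L)"
        by (metis append_take_drop_id hdeg_append)
      ultimately have "hdeg (take (g - m) L) = 0"
        using True by simp
      then have "take (g - m) L = replicate (g - m) H0"
        using hdeg_eq_0[of "take (g - m) L"] L by simp
      then have "L = L0"
        using True unfolding L0_def by (metis append_take_drop_id)
      then show ?thesis
        using T(2)[of L x] L gm True by (simp add: fun_apply hbasis_def)
    next
      case False
      then have "T x L = 0"
        using T(2)[of L x] L gm by auto
      moreover have "scal (x L0) (hbasis L0) L = 0"
        using False x0 by (auto simp: fun_apply hbasis_def L0_def)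
      ultimately show ?thesis by simp
    qed
  qed
  finally have "Phi g g (scal (x L0) (hbasis L0)) \<in> W" .
  then have "scal (x L0) (red v) \<in> W"
    by (simp add: lin_Phi rv)
  then have "scal (inverse (x L0)) (scal (x L0) (red v)) \<in> W"
    by (rule scal)
  moreover have "scal (inverse (x L0)) (scal (x L0) (red v)) = (red v :: 'p mod_ring ext)"
    unfolding scal_simps(4) using x0 by simp
  ultimately have rvW: "red v \<in> W"
    by simp
  \<comment> \<open>Generation is a statement about integral vectors, so it is applied to the
    preimage of \<open>W\<close> under reduction.\<close>
  define Q where "Q = {y \<in> ext_space g. red y \<in> W}"
  have "sp_stable g Q"
    unfolding sp_stable_def Q_def
    by (auto simp: ext_space_add ext_space_uminus red_simps add neg ext_space_ext_act
        ext_act_red[symmetric] act)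
  moreover have "v \<in> Q"
    using rvW by (simp add: Q_def v_def ext_space_Phi)
  ultimately have "V_int k g \<subseteq> Q"
    unfolding v_def L0_def by (rule sp_stable_generated[OF _ m k])
  then have "carrier (V_mod P k g) \<subseteq> W"
    by (auto simp: V_mod_simps Q_def)
  with WV show ?thesis by blast
qed


section \<open>Quotient modules\<close>

lemma submodule_abelian_subgroup:
  assumes "Module.module R M" "Module.submodule N R M"
  shows "abelian_subgroup N M"
  using assms
  by (intro abelian_subgroupI3 additive_subgroup.intro)
    (auto dest: Module.submodule.axioms(1) Module.module.axioms(2))

text \<open>All members of the union coincide, because \<open>f\<close> sends elements differing by
  \<open>N\<close> to elements differing by \<open>N\<close>.\<close>

lemma induced_on_coset:
  assumes N: "abelian_subgroup N M" and x: "x \<in> carrier M"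
    and f: "\<And>y. y \<in> carrier M \<Longrightarrow> f y \<in> carrier M"
      "\<And>y z. y \<in> carrier M \<Longrightarrow> z \<in> carrier M \<Longrightarrow> f (y \<oplus>\<^bsub>M\<^esub> z) = f y \<oplus>\<^bsub>M\<^esub> f z"
      "\<And>y. y \<in> N \<Longrightarrow> f y \<in> N"
  shows "induced_on_cosets M N f (N +>\<^bsub>M\<^esub> x) = N +>\<^bsub>M\<^esub> f x"
proof -
  interpret abelian_subgroup N M by (rule N)
  have "N +>\<^bsub>M\<^esub> f y = N +>\<^bsub>M\<^esub> f x" if y: "y \<in> N +>\<^bsub>M\<^esub> x" for y
  proof -
    obtain n where n: "n \<in> N" "y = n \<oplus>\<^bsub>M\<^esub> x"
      using y by (auto simp: a_r_coset_def')
    then have "f y = f n \<oplus>\<^bsub>M\<^esub> f x"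
      using f(2) x a_Hcarr by blast
    then have "f y \<in> N +>\<^bsub>M\<^esub> f x"
      using f(3)[OF n(1)] by (auto simp: a_r_coset_def')
    then show ?thesis
      using a_repr_independence[OF _ f(1)[OF x] a_subgroup] by metis
  qed
  moreover have "x \<in> N +>\<^bsub>M\<^esub> x"
    by (rule a_rcos_self[OF x])
  ultimately show ?thesis
    unfolding induced_on_cosets_def by blast
qed

lemma quotient_module_simps:
  "carrier (quotient_module M N) = a_rcosets\<^bsub>M\<^esub> N" "zero (quotient_module M N) = N"
  "add (quotient_module M N) = set_add M"
  "Module.module.smult (quotient_module M N) = (\<lambda>c. induced_on_cosets M N (\<lambda>x. c \<odot>\<^bsub>M\<^esub> x))"
  by (simp_all add: quotient_module_def)

lemma quotient_smult:
  assumes M: "Module.module R M" and N: "Module.submodule N R M"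
    and "c \<in> carrier R" "x \<in> carrier M"
  shows "c \<odot>\<^bsub>quotient_module M N\<^esub> (N +>\<^bsub>M\<^esub> x) = N +>\<^bsub>M\<^esub> (c \<odot>\<^bsub>M\<^esub> x)"
  unfolding quotient_module_simps
  using assms Module.submodule.smult_closed[OF N] Module.module.smult_closed[OF M]
    Module.module.smult_r_distr[OF M]
  by (intro induced_on_coset submodule_abelian_subgroup[OF M N]) auto

lemma module_quotient:
  assumes M: "Module.module R M" and N: "Module.submodule N R M"
  shows "Module.module R (quotient_module M N)"
proof -
  let ?Q = "quotient_module M N"
  interpret M: Module.module R M by (rule M)
  interpret N: abelian_subgroup N M by (rule submodule_abelian_subgroup[OF M N])
  have car: "\<exists>x\<in>carrier M. C = N +>\<^bsub>M\<^esub> x" if "C \<in> carrier (?Q)" for C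
    using that by (auto simp: quotient_module_simps A_RCOSETS_def')
  have inc: "N +>\<^bsub>M\<^esub> x \<in> carrier (?Q)" if "x \<in> carrier M" for x
    using that by (auto simp: quotient_module_simps A_RCOSETS_def')
  note sm = quotient_smult[OF M N]
  have ad: "(N +>\<^bsub>M\<^esub> x) \<oplus>\<^bsub>?Q\<^esub> (N +>\<^bsub>M\<^esub> y) = N +>\<^bsub>M\<^esub> (x \<oplus>\<^bsub>M\<^esub> y)"
    if "x \<in> carrier M" "y \<in> carrier M" for x y
    using N.a_rcos_sum[OF that] by (simp add: quotient_module_simps)
  show ?thesis
  proof (rule Module.moduleI)
    show "cring R" ..
    show "abelian_group (?Q)"
    proof (rule abelian_groupI)
      fix C assume C: "C \<in> carrier (?Q)"
      show "\<zero>\<^bsub>?Q\<^esub> \<oplus>\<^bsub>?Q\<^esub> C = C"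
        using N.rcosets_add_eq C by (simp add: quotient_module_simps)
      obtain x where x: "x \<in> carrier M" "C = N +>\<^bsub>M\<^esub> x"
        using car[OF C] by blast
      have "N +>\<^bsub>M\<^esub> \<zero>\<^bsub>M\<^esub> = N"
        using N.a_rcos_const[OF N.zero_closed] .
      then show "\<exists>D\<in>carrier (?Q). D \<oplus>\<^bsub>?Q\<^esub> C = \<zero>\<^bsub>?Q\<^esub>"
        using x by (intro bexI[of _ "N +>\<^bsub>M\<^esub> (\<ominus>\<^bsub>M\<^esub> x)"])
          (simp_all add: ad inc M.l_neg quotient_module_simps(2))
    next
      show "\<zero>\<^bsub>?Q\<^esub> \<in> carrier (?Q)"
        using N.a_subgroup_in_rcosets by (simp add: quotient_module_simps)
    next
      fix C D assume "C \<in> carrier (?Q)" "D \<in> carrier (?Q)"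
      then show "C \<oplus>\<^bsub>?Q\<^esub> D \<in> carrier (?Q)"
        "C \<oplus>\<^bsub>?Q\<^esub> D = D \<oplus>\<^bsub>?Q\<^esub> C"
        using car[of C] car[of D] by (auto simp: ad inc M.a_comm)
    next
      fix B C D assume "B \<in> carrier (?Q)" "C \<in> carrier (?Q)"
        "D \<in> carrier (?Q)"
      then show "B \<oplus>\<^bsub>?Q\<^esub> C \<oplus>\<^bsub>?Q\<^esub> D =
          B \<oplus>\<^bsub>?Q\<^esub> (C \<oplus>\<^bsub>?Q\<^esub> D)"
        using car[of B] car[of C] car[of D] by (auto simp: ad M.a_assoc)
    qed
  next
    fix a C assume "a \<in> carrier R" "C \<in> carrier (?Q)"
    then show "a \<odot>\<^bsub>?Q\<^esub> C \<in> carrier (?Q)"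
      using car[of C] by (auto simp: sm inc)
  next
    fix a b C assume "a \<in> carrier R" "b \<in> carrier R" "C \<in> carrier (?Q)"
    then show "(a \<oplus>\<^bsub>R\<^esub> b) \<odot>\<^bsub>?Q\<^esub> C =
        a \<odot>\<^bsub>?Q\<^esub> C \<oplus>\<^bsub>?Q\<^esub> b \<odot>\<^bsub>?Q\<^esub> C"
      using car[of C] by (auto simp: sm ad M.smult_l_distr)
  next
    fix a C D assume "a \<in> carrier R" "C \<in> carrier (?Q)" "D \<in> carrier (?Q)"
    then show "a \<odot>\<^bsub>?Q\<^esub> (C \<oplus>\<^bsub>?Q\<^esub> D) =
        a \<odot>\<^bsub>?Q\<^esub> C \<oplus>\<^bsub>?Q\<^esub> a \<odot>\<^bsub>?Q\<^esub> D"
      using car[of C] car[of D] by (auto simp: sm ad M.smult_r_distr)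
  next
    fix a b C assume "a \<in> carrier R" "b \<in> carrier R" "C \<in> carrier (?Q)"
    then show "(a \<otimes>\<^bsub>R\<^esub> b) \<odot>\<^bsub>?Q\<^esub> C =
        a \<odot>\<^bsub>?Q\<^esub> (b \<odot>\<^bsub>?Q\<^esub> C)"
      using car[of C] by (auto simp: sm M.smult_assoc1)
  next
    fix C assume "C \<in> carrier (?Q)"
    then show "\<one>\<^bsub>R\<^esub> \<odot>\<^bsub>?Q\<^esub> C = C"
      using car[of C] by (auto simp: sm)
  qed
qed


section \<open>The modules of the resolution\<close>

lemma Phi_zero_iff:
  assumes "hsupp g x"
  shows "Phi g g x = 0 \<longleftrightarrow> x = 0"
proof
  assume "Phi g g x = 0"
  then have 0: "Phi g g x = Phi g g 0"
    by (simp only: lin_Phi)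
  have "x L = 0 L" for L
    using Phi_inject[OF 0, of L] assms unfolding hsupp_def by (cases "length L = g") (auto simp: fun_apply)
  then show "x = 0" by (rule ext)
qed (simp only: lin_Phi)

lemma PV_hsupp: "x \<in> PV j n \<Longrightarrow> hsupp n x"
proof -
  assume "x \<in> PV j n"
  then obtain X where X: "x = red X" "X \<in> LV j n"
    by (auto simp: PV_def)
  have "X L \<noteq> 0" if "x L \<noteq> 0" for L
    using that by (auto simp: X(1) fun_apply)
  then show ?thesis
    using LV_hsupp[OF X(2)] by (auto simp: hsupp_def)
qed

lemma linop_E_op: "linop (E_op g)"
  by (rule linopI) (simp_all add: E_op_def wedge_def fun_apply algebra_simps sum.distrib sum_distrib_left)

lemma E_op_red: "x \<in> ext_space g \<Longrightarrow> E_op g (red x) = red (E_op g x)"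
proof -
  assume x: "x \<in> ext_space g"
  obtain y where y: "x = Phi g g y"
    using Phi_surj[OF x] by blast
  show ?thesis
    unfolding y red_Phi E_op_Phi red_hE ..
qed

lemma E_op_pow_red:
  assumes "x \<in> ext_space g"
  shows "(E_op g ^^ l) (red x) = red ((E_op g ^^ l) x)" "(E_op g ^^ l) x \<in> ext_space g"
proof -
  have "(E_op g ^^ l) (red x) = red ((E_op g ^^ l) x) \<and> (E_op g ^^ l) x \<in> ext_space g"
    by (induction l) (simp_all add: assms E_op_red ext_space_E_op)
  then show "(E_op g ^^ l) (red x) = red ((E_op g ^^ l) x)" "(E_op g ^^ l) x \<in> ext_space g"
    by auto
qed

lemma E_op_pow_ext_act:
  fixes x :: "int ext"
  assumes "A \<in> carrier (Sp g)" "x \<in> ext_space g"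
  shows "(E_op g ^^ l) (ext_act g A x) = ext_act g A ((E_op g ^^ l) x)"
  by (induction l) (simp_all add: E_op_ext_act[OF assms(1) E_op_pow_red(2)[OF assms(2)]])

section \<open>Module structures and symplectic actions on the terms and on the quotient\<close>

context
  fixes P :: "'p::prime_card itself" and g :: nat
begin

abbreviation "V k \<equiv> carrier (V_mod P k g)"

lemma V_mod_closed:
  "0 \<in> V k"
  "x \<in> V k \<Longrightarrow> y \<in> V k \<Longrightarrow> x + y \<in> V k"
  "x \<in> V k \<Longrightarrow> scal c x \<in> V k"
  "x \<in> V k \<Longrightarrow> - x \<in> V k"
proof -
  show "0 \<in> V k"
    unfolding carrier_V_mod by (rule image_eqI[OF _ PV_zero]) (simp only: lin_Phi)
  show "x + y \<in> V k" if "x \<in> V k" "y \<in> V k"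
    using that unfolding carrier_V_mod by (auto simp: lin_Phi[symmetric] intro!: imageI PV_add)
  show *: "scal c x \<in> V k" if "x \<in> V k" for c x
    using that unfolding carrier_V_mod by (auto simp: lin_Phi[symmetric] intro!: imageI PV_scal)
  show "- x \<in> V k" if "x \<in> V k"
    using *[OF that, of "- 1"] by (simp add: scal_minus_left)
qed

lemma V_mod_ext_space: "x \<in> V k \<Longrightarrow> x \<in> ext_space g"
  unfolding carrier_V_mod by (auto simp: ext_space_Phi)

lemma V_mod_ext_act:
  "A \<in> carrier (Sp g) \<Longrightarrow> x \<in> V k \<Longrightarrow> ext_act g A x \<in> V k"
  unfolding V_mod_simps using ext_act_V_int V_int_ext_space
  by (auto simp: ext_act_red intro!: imageI)

lemma module_V_mod: "Module.module class_ring (V_mod P k g)"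
proof (rule Module.moduleI)
  show "cring (class_ring :: 'p mod_ring ring)"
    by (rule class_cring.cring_axioms)
  show "abelian_group (V_mod P k g)"
  proof (rule abelian_groupI)
    fix x assume "x \<in> V k"
    then show "\<exists>y\<in>V k. y \<oplus>\<^bsub>V_mod P k g\<^esub> x = \<zero>\<^bsub>V_mod P k g\<^esub>"
      by (intro bexI[of _ "- x"]) (simp_all add: V_mod_simps(2,3) V_mod_closed)
  qed (simp_all add: V_mod_simps(2,3) V_mod_closed add_ac)
qed (simp_all add: V_mod_simps(3,4) V_mod_closed scal_add fun_eq_iff fun_apply algebra_simps)

lemma group_module_V_mod: "group_module (Sp g) class_ring (V_mod P k g) (ext_act g)"
  unfolding group_module_def LinearCombinations.module_hom_def
proof (intro conjI ballI CollectI allI impI)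
  show "group (Sp g)" by (rule group_Sp)
  show "Module.module class_ring (V_mod P k g)" by (rule module_V_mod)
  fix A assume A: "A \<in> carrier (Sp g)"
  then show "ext_act g A \<in> V k \<rightarrow> V k"
    by (auto simp: V_mod_ext_act)
  show "ext_act g A (x \<oplus>\<^bsub>V_mod P k g\<^esub> y) = ext_act g A x \<oplus>\<^bsub>V_mod P k g\<^esub> ext_act g A y" for x y
    by (simp add: V_mod_simps(3) lin_ext_act)
  show "ext_act g A (c \<odot>\<^bsub>V_mod P k g\<^esub> x) = c \<odot>\<^bsub>V_mod P k g\<^esub> ext_act g A x" for c x
    by (simp add: V_mod_simps(4) lin_ext_act)
  show "ext_act g (A \<otimes>\<^bsub>Sp g\<^esub> B) x = ext_act g A (ext_act g B x)"
    if "B \<in> carrier (Sp g)" "x \<in> V k" for B x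
    using A that by (simp add: ext_act_mult carrier_Sp V_mod_ext_space)
next
  show "ext_act g \<one>\<^bsub>Sp g\<^esub> x = x" if "x \<in> V k" for x
    using that by (simp add: ext_act_one V_mod_ext_space)
qed

lemma V_null_closed:
  "0 \<in> V_null P k g" "x \<in> V_null P k g \<Longrightarrow> y \<in> V_null P k g \<Longrightarrow> x + y \<in> V_null P k g"
  "x \<in> V_null P k g \<Longrightarrow> scal c x \<in> V_null P k g" "x \<in> V_null P k g \<Longrightarrow> - x \<in> V_null P k g"
  by (auto simp: V_null_def V_mod_closed ext_inner_simps)

lemma V_null_ext_act:
  assumes A: "A \<in> carrier (Sp g)" and x: "x \<in> V_null P k g"
  shows "ext_act g A x \<in> V_null P k g"
proof -
  have xV: "x \<in> V k"
    using x by (simp add: V_null_def)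
  have "ext_inner g (ext_act g A x) y = 0" if y: "y \<in> V k" for y
  proof -
    have "ext_inner g (ext_act g A x) y = ext_inner g x (ext_act g (transpose_mat A) y)"
      using A by (intro ext_act_adjoint V_mod_ext_space[OF xV] V_mod_ext_space[OF y]) (simp add: carrier_Sp)
    also have "\<dots> = 0"
      using x V_mod_ext_act[OF Sp_transpose[OF A] y] by (simp add: V_null_def)
    finally show ?thesis .
  qed
  then show ?thesis
    using V_mod_ext_act[OF A xV] by (simp add: V_null_def)
qed

lemma a_inv_V_mod: "x \<in> V k \<Longrightarrow> \<ominus>\<^bsub>V_mod P k g\<^esub> x = - x"
  by (rule abelian_group.minus_equality[OF Module.module.axioms(2)[OF module_V_mod]])
    (simp_all add: V_mod_simps(2,3) V_mod_closed)

lemma submodule_V_null: "Module.submodule (V_null P k g) class_ring (V_mod P k g)"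
proof (rule Module.module.submoduleI[OF module_V_mod])
  show sub: "V_null P k g \<subseteq> V k"
    by (auto simp: V_null_def)
  show "\<ominus>\<^bsub>V_mod P k g\<^esub> x \<in> V_null P k g" if "x \<in> V_null P k g" for x
    using that sub by (auto simp: a_inv_V_mod V_null_closed)
qed (simp_all add: V_mod_simps(2,3,4) V_null_closed)

lemmas V_null_subgroup = submodule_abelian_subgroup[OF module_V_mod submodule_V_null]

lemma module_Vbar: "Module.module class_ring (Vbar_mod P k g)"
  unfolding Vbar_mod_def by (rule module_quotient[OF module_V_mod submodule_V_null])

lemma Vbar_carrier: "carrier (Vbar_mod P k g) = Vbar_proj P k g ` V k"
  by (auto simp: Vbar_mod_def Vbar_proj_def quotient_module_simps A_RCOSETS_def')

lemma Vbar_simps: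
  "\<zero>\<^bsub>Vbar_mod P k g\<^esub> = V_null P k g"
  "x \<in> V k \<Longrightarrow> y \<in> V k \<Longrightarrow>
    Vbar_proj P k g x \<oplus>\<^bsub>Vbar_mod P k g\<^esub> Vbar_proj P k g y = Vbar_proj P k g (x + y)"
  "x \<in> V k \<Longrightarrow> c \<odot>\<^bsub>Vbar_mod P k g\<^esub> Vbar_proj P k g x = Vbar_proj P k g (scal c x)"
proof -
  show "\<zero>\<^bsub>Vbar_mod P k g\<^esub> = V_null P k g"
    by (simp add: Vbar_mod_def quotient_module_simps)
  show "Vbar_proj P k g x \<oplus>\<^bsub>Vbar_mod P k g\<^esub> Vbar_proj P k g y = Vbar_proj P k g (x + y)"
    if "x \<in> V k" "y \<in> V k"
    using abelian_subgroup.a_rcos_sum[OF V_null_subgroup that]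
    by (simp add: Vbar_mod_def Vbar_proj_def quotient_module_simps V_mod_simps(3))
  show "c \<odot>\<^bsub>Vbar_mod P k g\<^esub> Vbar_proj P k g x = Vbar_proj P k g (scal c x)"
    if "x \<in> V k"
    using quotient_smult[OF module_V_mod submodule_V_null _ that, of c]
    by (simp add: Vbar_mod_def Vbar_proj_def V_mod_simps(4))
qed

lemma Vbar_act_proj:
  assumes "A \<in> carrier (Sp g)" "x \<in> V k"
  shows "Vbar_act P k g A (Vbar_proj P k g x) = Vbar_proj P k g (ext_act g A x)"
  unfolding Vbar_act_def Vbar_proj_def using assms
  by (intro induced_on_coset V_null_subgroup)
    (auto simp: V_mod_ext_act V_null_ext_act V_mod_simps(3) lin_ext_act)

lemma Vbar_proj_eq_zero:
  assumes "x \<in> V k"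
  shows "Vbar_proj P k g x = V_null P k g \<longleftrightarrow> x \<in> V_null P k g"
proof -
  interpret abelian_subgroup "V_null P k g" "V_mod P k g"
    by (rule V_null_subgroup)
  show ?thesis
    unfolding Vbar_proj_def
  proof
    assume "V_null P k g +>\<^bsub>V_mod P k g\<^esub> x = V_null P k g"
    then show "x \<in> V_null P k g"
      using a_rcos_self[OF assms] by simp
  next
    assume "x \<in> V_null P k g"
    then show "V_null P k g +>\<^bsub>V_mod P k g\<^esub> x = V_null P k g"
      using a_rcos_const by simp
  qed
qed

lemma group_module_Vbar: "group_module (Sp g) class_ring (Vbar_mod P k g) (Vbar_act P k g)"
  unfolding group_module_def LinearCombinations.module_hom_def
proof (intro conjI ballI CollectI allI impI)
  note cl = V_mod_ext_act V_mod_closed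
  show "group (Sp g)" by (rule group_Sp)
  show "Module.module class_ring (Vbar_mod P k g)" by (rule module_Vbar)
  fix A assume A: "A \<in> carrier (Sp g)"
  show "Vbar_act P k g A \<in> carrier (Vbar_mod P k g) \<rightarrow> carrier (Vbar_mod P k g)"
    using A by (auto simp: Vbar_carrier Vbar_act_proj cl)
  show "Vbar_act P k g A (C \<oplus>\<^bsub>Vbar_mod P k g\<^esub> D) =
      Vbar_act P k g A C \<oplus>\<^bsub>Vbar_mod P k g\<^esub> Vbar_act P k g A D"
    if "C \<in> carrier (Vbar_mod P k g) \<and> D \<in> carrier (Vbar_mod P k g)" for C D
    using that A by (auto simp: Vbar_carrier Vbar_act_proj Vbar_simps cl lin_ext_act)
  show "Vbar_act P k g A (c \<odot>\<^bsub>Vbar_mod P k g\<^esub> C) = c \<odot>\<^bsub>Vbar_mod P k g\<^esub> Vbar_act P k g A C"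
    if "c \<in> carrier class_ring \<and> C \<in> carrier (Vbar_mod P k g)" for c C
    using that A by (auto simp: Vbar_carrier Vbar_act_proj Vbar_simps cl lin_ext_act)
  fix B C assume "B \<in> carrier (Sp g)" "C \<in> carrier (Vbar_mod P k g)"
  with A show "Vbar_act P k g (A \<otimes>\<^bsub>Sp g\<^esub> B) C = Vbar_act P k g A (Vbar_act P k g B C)"
    by (auto simp: Vbar_carrier Vbar_act_proj cl Sp_mult)
      (auto simp: ext_act_mult carrier_Sp V_mod_ext_space)
next
  fix C assume "C \<in> carrier (Vbar_mod P k g)"
  then show "Vbar_act P k g \<one>\<^bsub>Sp g\<^esub> C = C"
    by (auto simp: Vbar_carrier Vbar_act_proj Sp_one ext_act_one V_mod_ext_space)
qed

lemma mod_hom_Vbar_proj: "mod_hom class_ring (V_mod P k g) (Vbar_mod P k g) (Vbar_proj P k g)"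
  unfolding mod_hom_def mod_hom_axioms_def LinearCombinations.module_hom_def
  using module_V_mod module_Vbar
  by (auto simp: Vbar_carrier Vbar_simps V_mod_simps(3,4))

lemma group_module_hom_Vbar_proj:
  "group_module_hom (Sp g) class_ring (V_mod P k g) (ext_act g)
     (Vbar_mod P k g) (Vbar_act P k g) (Vbar_proj P k g)"
  unfolding group_module_hom_def
  using group_module_V_mod group_module_Vbar mod_hom_Vbar_proj Vbar_act_proj by auto

text \<open>A submodule is pulled back along the projection. Its preimage is either contained in the
  null space or, by \<open>V_mod_submodule_full\<close>, the whole module.\<close>

lemma irreducible_Vbar:
  assumes k: "k \<ge> 1" and nz: "carrier (Vbar_mod P k g) \<noteq> {\<zero>\<^bsub>Vbar_mod P k g\<^esub>}"
  shows "irreducible_group_module (Sp g) class_ring (Vbar_mod P k g) (Vbar_act P k g)"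
  unfolding irreducible_group_module_def
proof (intro conjI allI impI)
  show "group_module (Sp g) class_ring (Vbar_mod P k g) (Vbar_act P k g)"
    by (rule group_module_Vbar)
  show "carrier (Vbar_mod P k g) \<noteq> {\<zero>\<^bsub>Vbar_mod P k g\<^esub>}"
    by (rule nz)
  fix W assume "Module.submodule W class_ring (Vbar_mod P k g) \<and>
      (\<forall>A\<in>carrier (Sp g). Vbar_act P k g A ` W \<subseteq> W)"
  then have W: "Module.submodule W class_ring (Vbar_mod P k g)"
    and act: "\<And>A C. A \<in> carrier (Sp g) \<Longrightarrow> C \<in> W \<Longrightarrow> Vbar_act P k g A C \<in> W"
    by auto
  note Wcl = Module.module.submoduleE[OF module_Vbar W]
  define W' where "W' = {x \<in> V k. Vbar_proj P k g x \<in> W}"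
  show "W = {\<zero>\<^bsub>Vbar_mod P k g\<^esub>} \<or> W = carrier (Vbar_mod P k g)"
  proof (cases "W' \<subseteq> V_null P k g")
    case True
    have "C = V_null P k g" if "C \<in> W" for C
    proof -
      have "C \<in> Vbar_proj P k g ` V k"
        using that Wcl(1) unfolding Vbar_carrier by blast
      then obtain x where x: "x \<in> V k" "C = Vbar_proj P k g x"
        by blast
      with that have "x \<in> W'" by (simp add: W'_def)
      with True have "x \<in> V_null P k g" by blast
      then show ?thesis
        using Vbar_proj_eq_zero[OF x(1)] x(2) by simp
    qed
    then show ?thesis
      using Wcl(2) by (auto simp: Vbar_simps)
  next
    case False
    have "W' = V k"
    proof (rule V_mod_submodule_full[OF k _ _ _ _ False])
      show "W' \<subseteq> V k" by (auto simp: W'_def)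
      show "x + y \<in> W'" if "x \<in> W'" "y \<in> W'" for x y
        using that Wcl(5) by (auto simp: W'_def V_mod_closed Vbar_simps(2)[symmetric])
      show "scal c x \<in> W'" if "x \<in> W'" for c x
        using that Wcl(4)[of c] by (auto simp: W'_def V_mod_closed Vbar_simps(3)[symmetric])
      show "ext_act g A x \<in> W'" if "A \<in> carrier (Sp g)" "x \<in> W'" for A x
        using that act by (auto simp: W'_def V_mod_ext_act Vbar_act_proj[symmetric])
    qed
    then have "carrier (Vbar_mod P k g) \<subseteq> W"
      by (auto simp: Vbar_carrier W'_def)
    then show ?thesis
      using Wcl(1) by blast
  qed
qed

end

section \<open>Assembling the resolution from residues and exponents\<close>

definition res_exp :: "nat \<Rightarrow> nat \<Rightarrow> nat \<Rightarrow> nat" where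
  "res_exp p k i = (if even i then k else p - k)"

text \<open>Together with \<open>res_map_eq\<close> this makes the two parities uniform: each map is
  \<open>E\<close> to the power of the residue by which its source index exceeds a multiple of
  p.\<close>

lemma res_index_eq: "k \<le> p \<Longrightarrow> res_index p k i = p * i + res_exp p k i"
  by (auto simp: res_index_def res_exp_def algebra_simps)

lemma res_map_eq: "res_map p k i g = E_op g ^^ res_exp p k (Suc i)"
  by (simp add: res_map_def res_exp_def)

lemma res_index_diff: "k \<le> p \<Longrightarrow> res_index p k i = p * (i + 1) - res_exp p k (Suc i)"
  by (auto simp: res_index_def res_exp_def algebra_simps)

lemma res_exp_add: "k \<le> p \<Longrightarrow> res_exp p k i + res_exp p k (Suc i) = p"
  and res_exp_le: "k \<le> p \<Longrightarrow> res_exp p k i \<le> p"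
  by (simp_all add: res_exp_def)

context
  fixes p k g :: nat and P :: "'p::prime_card itself"
  assumes p: "p = CARD('p)" and k: "0 < k" "k < p"
begin

abbreviation "C i \<equiv> V_mod P (res_index p k i) g"

lemma res_map_carrier:
  assumes "x \<in> carrier (C (Suc i))"
  shows "res_map p k i g x \<in> carrier (C i)"
proof -
  obtain y where y: "x = Phi g g y" "y \<in> PV (p * Suc i + res_exp p k (Suc i)) g"
    using assms k by (auto simp: carrier_V_mod res_index_eq)
  have "(hE ^^ res_exp p k (Suc i)) y \<in> PV (p * (i + 1) - res_exp p k (Suc i)) g"
    using y(2) res_exp_le[of k p "Suc i"] k by (intro hE_pow_PV[OF p]) auto
  then show ?thesis
    using k by (simp add: carrier_V_mod res_map_eq y(1) E_op_pow_Phi res_index_diff)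
qed

lemma mod_hom_res_map:
  "mod_hom class_ring (C (Suc i)) (C i) (res_map p k i g)"
  unfolding mod_hom_def mod_hom_axioms_def LinearCombinations.module_hom_def
  using module_V_mod res_map_carrier
  by (auto simp: V_mod_simps(3,4) res_map_eq linop_simps[OF linop_funpow[OF linop_E_op]])

lemma group_module_hom_res_map:
  "group_module_hom (Sp g) class_ring (C (Suc i)) (ext_act g)
     (C i) (ext_act g) (res_map p k i g)"
  unfolding group_module_hom_def
proof (intro conjI ballI)
  fix A x assume A: "A \<in> carrier (Sp g)" and "x \<in> carrier (C (Suc i))"
  then obtain X where X: "x = red X" "X \<in> V_int (res_index p k (Suc i)) g"
    by (auto simp: V_mod_simps)
  note Xs = V_int_ext_space[OF X(2)]
  show "res_map p k i g (ext_act g A x) = ext_act g A (res_map p k i g x)"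
    by (simp add: X(1) res_map_eq ext_act_red Xs E_op_pow_red ext_space_ext_act E_op_pow_ext_act A)
qed (rule group_module_V_mod mod_hom_res_map)+

lemma res_map_exact:
  "res_map p k (Suc i) g ` carrier (C (Suc (Suc i))) =
    {x \<in> carrier (C (Suc i)). res_map p k i g x = 0}"
proof (intro equalityI subsetI)
  fix x assume "x \<in> res_map p k (Suc i) g ` carrier (C (Suc (Suc i)))"
  then obtain y where y: "y \<in> carrier (C (Suc (Suc i)))" "x = res_map p k (Suc i) g y"
    by blast
  obtain z :: "'p mod_ring hfun" where z: "y = Phi g g z"
    using y(1) by (auto simp: carrier_V_mod)
  \<comment> \<open>Consecutive exponents add up to p, so the composite is
    \<open>E^p = 0\<close>.\<close>
  have "res_map p k i g x = Phi g g ((hE ^^ (res_exp p k (Suc i) + res_exp p k (Suc (Suc i)))) z)"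
    by (simp add: y(2) z res_map_eq E_op_pow_Phi funpow_add)
  also have "\<dots> = 0"
    using res_exp_add[of k p "Suc i"] k hE_pow_char[of z] p by (simp add: lin_Phi)
  finally show "x \<in> {x \<in> carrier (C (Suc i)). res_map p k i g x = 0}"
    using res_map_carrier[OF y(1)] y(2) by simp
next
  fix x assume "x \<in> {x \<in> carrier (C (Suc i)). res_map p k i g x = 0}"
  then have x: "x \<in> carrier (C (Suc i))" "res_map p k i g x = 0"
    by auto
  define l where "l = res_exp p k (Suc i)"
  have l: "l \<le> p" "res_exp p k (Suc (Suc i)) = p - l"
    using k by (auto simp: l_def res_exp_def)
  obtain y where y: "x = Phi g g y" "y \<in> PV (p * Suc i + l) g"
    using x(1) k by (auto simp: carrier_V_mod res_index_eq l_def)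
  have "(hE ^^ l) y \<in> PV (p * Suc i - l) g"
    using y(2) l by (intro hE_pow_PV[OF p]) auto
  moreover have "Phi g g ((hE ^^ l) y) = 0"
    using x(2) by (simp add: y(1) res_map_eq E_op_pow_Phi l_def)
  ultimately have "(hE ^^ l) y = 0"
    using Phi_zero_iff PV_hsupp by blast
  then obtain z where z: "z \<in> PV (p * (Suc i + 2) - l) g" "(hE ^^ (p - l)) z = y"
    using hE_pow_exact[OF p l(1) _ y(2)] by auto
  have "p * (Suc i + 2) - l = res_index p k (Suc (Suc i))"
    using k l by (simp add: res_index_eq)
  then have "Phi g g z \<in> carrier (C (Suc (Suc i)))"
    using z(1) by (auto simp: carrier_V_mod)
  moreover have "x = res_map p k (Suc i) g (Phi g g z)"
    by (simp add: y(1) res_map_eq l(2) E_op_pow_Phi z(2))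
  ultimately show "x \<in> res_map p k (Suc i) g ` carrier (C (Suc (Suc i)))"
    by blast
qed

lemma res_map_image_null:
  "res_map p k 0 g ` carrier (C (Suc 0)) = V_null P k g"
proof (intro equalityI subsetI)
  fix x assume "x \<in> res_map p k 0 g ` carrier (C (Suc 0))"
  then obtain y where y: "y \<in> carrier (C (Suc 0))" "x = res_map p k 0 g y"
    by blast
  then obtain z where z: "y = Phi g g z" "z \<in> PV (res_index p k (Suc 0)) g"
    by (auto simp: carrier_V_mod)
  have "x \<in> carrier (V_mod P k g)"
    using res_map_carrier[OF y(1)] y(2) by (simp add: res_index_def)
  moreover have "ext_inner g x v = 0" if v: "v \<in> carrier (V_mod P k g)" for v
  proof -
    obtain u where u: "v = Phi g g u" "u \<in> PV k g"
      using v by (auto simp: carrier_V_mod)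
    \<comment> \<open>As \<open>k < p\<close>, at least one \<open>F\<close> reaches
      \<open>u\<close> and kills it; moving \<open>E^(p-k)\<close> across the form thus makes the
      image orthogonal to the kernel.\<close>
    have "(hF ^^ (p - k)) u = (hF ^^ (p - k - 1)) (hF u)"
      using k by (metis Suc_diff_Suc diff_Suc_1 funpow_Suc_right comp_apply zero_less_diff diff_diff_left One_nat_def)
    also have "\<dots> = 0"
      using PV_hF[OF u(2)] by (simp only: linop_zero[OF linop_funpow[OF linop_hF]])
    finally show ?thesis
      by (simp add: y(2) z(1) u(1) res_map_eq res_exp_def E_op_pow_Phi hEn_adjoint ext_inner_Phi)
  qed
  ultimately show "x \<in> V_null P k g"
    by (simp add: V_null_def)
next
  fix x assume x: "x \<in> V_null P k g"
  then obtain y where y: "x = Phi g g y" "y \<in> PV k g"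
    by (auto simp: V_null_def carrier_V_mod)
  have "hdot g y v = 0" if "v \<in> PV k g" for v
  proof -
    have "ext_inner g x (Phi g g v) = 0"
      using x that by (auto simp: V_null_def carrier_V_mod)
    then show ?thesis
      by (simp add: y(1) ext_inner_Phi)
  qed
  then obtain z where z: "z \<in> PV (2 * p - k) g" "(hE ^^ (p - k)) z = y"
    using hE_pow_radical[OF p _ y(2)] k by auto
  have "2 * p - k = res_index p k (Suc 0)"
    by (simp add: res_index_def)
  then have "Phi g g z \<in> carrier (C (Suc 0))"
    using z(1) by (auto simp: carrier_V_mod)
  moreover have "x = res_map p k 0 g (Phi g g z)"
    by (simp add: y(1) res_map_eq res_exp_def E_op_pow_Phi z(2))
  ultimately show "x \<in> res_map p k 0 g ` carrier (C (Suc 0))"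
    by blast
qed

end

theorem mainTheorem2:
  fixes p k :: nat and P :: "'p::prime_card itself"
  assumes "p = CARD('p)" and "p \<ge> 3" and "0 < k" and "k < p"
  shows "\<forall>g.
     \<comment> \<open>the maps are morphisms of modules over the mapping class group\<close>
     (\<forall>i. group_module_hom (Sp g) class_ring
            (V_mod P (res_index p k (i + 1)) g) (ext_act g)
            (V_mod P (res_index p k i) g) (ext_act g) (res_map p k i g))
   \<and> group_module_hom (Sp g) class_ring (V_mod P k g) (ext_act g)
            (Vbar_mod P k g) (Vbar_act P k g) (Vbar_proj P k g)
     \<comment> \<open>exactness\<close>
   \<and> (\<forall>i. mod_hom.im (V_mod P (res_index p k (i + 2)) g) (res_map p k (i + 1) g)
            = mod_hom.ker (V_mod P (res_index p k (i + 1)) g)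
                (V_mod P (res_index p k i) g) (res_map p k i g))
   \<and> mod_hom.im (V_mod P (res_index p k 1) g) (res_map p k 0 g)
            = mod_hom.ker (V_mod P k g) (Vbar_mod P k g) (Vbar_proj P k g)
   \<and> mod_hom.im (V_mod P k g) (Vbar_proj P k g) = carrier (Vbar_mod P k g)
     \<comment> \<open>irreducibility\<close>
   \<and> (carrier (Vbar_mod P k g) = {\<zero>\<^bsub>Vbar_mod P k g\<^esub>}
        \<or> irreducible_group_module (Sp g) class_ring (Vbar_mod P k g) (Vbar_act P k g))"
proof (intro allI conjI)
  fix g
  note hom = mod_hom_res_map[OF assms(1,3,4), where P=P and g=g]
  note proj = mod_hom_Vbar_proj[where P=P and k=k and g=g]
  show "group_module_hom (Sp g) class_ring (V_mod P (res_index p k (i + 1)) g) (ext_act g)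
      (V_mod P (res_index p k i) g) (ext_act g) (res_map p k i g)" for i
    using group_module_hom_res_map[OF assms(1,3,4), where P=P and g=g and i=i] by simp
  show "group_module_hom (Sp g) class_ring (V_mod P k g) (ext_act g)
      (Vbar_mod P k g) (Vbar_act P k g) (Vbar_proj P k g)"
    by (rule group_module_hom_Vbar_proj)
  show "mod_hom.im (V_mod P (res_index p k (i + 2)) g) (res_map p k (i + 1) g)
      = mod_hom.ker (V_mod P (res_index p k (i + 1)) g) (V_mod P (res_index p k i) g) (res_map p k i g)" for i
    using mod_hom.im_def[OF hom[of "Suc i"]] mod_hom.ker_def[OF hom[of i]]
      res_map_exact[OF assms(1,3,4), where P=P and g=g and i=i]
    by (simp add: V_mod_simps(2))
  show "mod_hom.im (V_mod P (res_index p k 1) g) (res_map p k 0 g)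
      = mod_hom.ker (V_mod P k g) (Vbar_mod P k g) (Vbar_proj P k g)"
  proof -
    have "mod_hom.ker (V_mod P k g) (Vbar_mod P k g) (Vbar_proj P k g) =
        {v \<in> carrier (V_mod P k g). Vbar_proj P k g v = V_null P k g}"
      using mod_hom.ker_def[OF proj] by (simp only: Vbar_simps(1))
    also have "\<dots> = {v \<in> carrier (V_mod P k g). v \<in> V_null P k g}"
      by (rule Collect_cong) (metis Vbar_proj_eq_zero)
    also have "\<dots> = V_null P k g"
      unfolding V_null_def by blast
    finally show ?thesis
      using mod_hom.im_def[OF hom[of 0]] res_map_image_null[OF assms(1,3,4), where P=P and g=g]
      by simp
  qed
  show "mod_hom.im (V_mod P k g) (Vbar_proj P k g) = carrier (Vbar_mod P k g)"
    using mod_hom.im_def[OF proj] by (simp add: Vbar_carrier)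
  show "carrier (Vbar_mod P k g) = {\<zero>\<^bsub>Vbar_mod P k g\<^esub>} \<or>
      irreducible_group_module (Sp g) class_ring (Vbar_mod P k g) (Vbar_act P k g)"
    using irreducible_Vbar[where P=P and k=k and g=g] assms(3) by auto
qed

end
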